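(* For every integer $k\ge 2$ and all $u\ge 0$, $\alpha,\beta\ge 0$, $$\mathbb E_u\left(e^{-\alpha\tau_0^{(k)-}+\beta X_{\tau_0^{(k)-}}};\tau_0^{(k)-}<\infty\right)=\mathbb E\left[e^{-\alpha T^U}\,\mathbb E_{u+U}\left(e^{-\alpha\widehat\tau_0^{(k-2)-}+\beta X_{\widehat\tau_0^{(k-2)-}}};\widehat\tau_0^{(k-2)-}<\infty\right)\right]\,\mathbb E\, e^{-\alpha T^D+\beta D}$$ and $$\mathbb E_u\left(e^{-\alpha\widehat\tau_0^{(k-2)-}+\beta X_{\widehat\tau_0^{(k-2)-}}};\widehat\tau_0^{(k-2)-}<\infty\right)\,\mathbb E\, e^{-\alpha T^D+\beta D}=\mathbb E\left[e^{-\alpha T^D}\,\mathbb E_{u+D}\left(e^{-\alpha\tau_0^{(k)-}+\beta X_{\tau_0^{(k)-}}};\tau_0^{(k)-}<\infty\right)\right].$$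
   Context: $X=(X_t)_{t\ge 0}$ is a real-valued (càdlàg) Lévy process; $\mathbb P_v$, $\mathbb E_v$ denote probability and expectation when $X$ is started at $v$, and $\mathbb P=\mathbb P_0$, $\mathbb E=\mathbb E_0$. $0<T_1<T_2<\dots$ are the epochs of a homogeneous Poisson process of fixed intensity $\lambda>0$ independent of $X$, and $T_0=0$. The minimum of an empty set is $\infty$. $\mathbb E(Y;A)$ means $\mathbb E(Y\mathbf 1_A)$. Parisian ruin under continuous observation: $\tau_0^{(k)-}$ is the time of Parisian ruin with Erlang$(k,\lambda)$ implementation delay (ruin occurs when an excursion of $X$ below $0$ lasts longer than an Erlang$(k,\lambda)$ time, a sum of $k$ independent exponential times of rate $\lambda$, with an independent copy for each excursion), realized through the Poisson epochs as follows: for $k\ge 1$, $\tau_0^{(k)-}$ is the first epoch $T_i$, $i\ge k-1$, such that $\sup\{X_t:t\in[T_{i-k+1},T_i]\}<0$. Thus $\tau_0^{(1)-}=\min\{T_i,i\ge 0:X_{T_i}<0\}$, and $\tau_0^{(2)-}$ is the first $T_i$, $i\ge1$, with $\sup\{X_t:t\in[T_{i-1},T_i]\}<0$. The time $T_0=0$ counts as an epoch (this matters only when $X$ starts below $0$). Parisian ruin under Poisson observation: for $k\ge 0$, $\widehat\tau_0^{(k)-}$ is the first epoch $T_i$, $i\ge k$, such that $X_{T_{i-k}},\dots,X_{T_i}<0$, i.e. the process has been observed negative at the last $k+1$ Poisson epochs ($T_0=0$ included). Infimum and its first time of occurrence: $\underline X_t=\inf\{X_s:s\in[0,t]\}$,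 $\underline G_t=\inf\{s\in[0,t]: X_s\wedge X_{s-}=\underline X_t\}$. Supremum and its last time of occurrence: $\overline X_t=\sup\{X_s:s\in[0,t]\}$, $\overline G_t=\sup\{s\in[0,t]: X_s\vee X_{s-}=\overline X_t\}$ (with $X_{0-}=X_0$). The pairs $(D,T^D)$ and $(U,T^U)$ have the laws of $(\underline X_{T_1},\underline G_{T_1})$ and $(\overline X_{T_1},\overline G_{T_1})$ under $\mathbb P$, respectively, and are sampled independently of each other and of everything else. In expressions such as $\mathbb E[e^{-\alpha T^U}\mathbb E_{u+U}(\cdot)]$, the inner expectation is the function $v\mapsto\mathbb E_v(\cdot)$ evaluated at $v=u+U$, and the outer expectation is over $(U,T^U)$ (similarly for $(D,T^D)$). *)

theory Defs
  imports "HOL-Probability.Probability"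
begin

section \<open>Paths\<close>

definition cadlag :: "(real \<Rightarrow> real) \<Rightarrow> bool" where
  "cadlag x \<longleftrightarrow>
     (\<forall>t\<ge>0. continuous (at_right t) x) \<and>
     (\<forall>t>0. \<exists>l. (x \<longlongrightarrow> l) (at_left t))"

text \<open>The value \<open>x(t-)\<close>, with the convention \<open>x(0-) = x(0)\<close>. Paths are functions on all of
  \<^typ>\<open>real\<close>, but only their values at nonnegative times are ever used.\<close>

definition left_lim :: "(real \<Rightarrow> real) \<Rightarrow> real \<Rightarrow> real" where
  "left_lim x t = (if t > 0 then Lim (at_left t) x else x 0)"

definition running_inf :: "(real \<Rightarrow> real) \<Rightarrow> real \<Rightarrow> real" where
  "running_inf x t = (INF s\<in>{0..t}. x s)"

definition running_sup :: "(real \<Rightarrow> real) \<Rightarrow> real \<Rightarrow> real" where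
  "running_sup x t = (SUP s\<in>{0..t}. x s)"

definition first_inf_time :: "(real \<Rightarrow> real) \<Rightarrow> real \<Rightarrow> real" where
  "first_inf_time x t = Inf {s\<in>{0..t}. min (x s) (left_lim x s) = running_inf x t}"

definition last_sup_time :: "(real \<Rightarrow> real) \<Rightarrow> real \<Rightarrow> real" where
  "last_sup_time x t = Sup {s\<in>{0..t}. max (x s) (left_lim x s) = running_sup x t}"


section \<open>Parisian ruin times of a path \<open>x\<close> with observation epochs \<open>T\<close>\<close>

text \<open>The epochs are strictly increasing wherever these times are used, so the infimum of a
  nonempty set of epochs is attained at the first of them; in \<^typ>\<open>ereal\<close> the infimum of the
  empty set is \<open>\<infinity>\<close>. In the first definition \<open>k \<ge> 1\<close> is intended, and \<open>i + 1 - k\<close>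
  is written instead of \<open>i - k + 1\<close> because of truncated subtraction.\<close>

definition parisian_ruin_cont :: "nat \<Rightarrow> (real \<Rightarrow> real) \<Rightarrow> (nat \<Rightarrow> real) \<Rightarrow> ereal" where
  "parisian_ruin_cont k x T =
     (INF i\<in>{i. k - 1 \<le> i \<and> (SUP t\<in>{T (i + 1 - k)..T i}. x t) < 0}. ereal (T i))"

definition parisian_ruin_obs :: "nat \<Rightarrow> (real \<Rightarrow> real) \<Rightarrow> (nat \<Rightarrow> real) \<Rightarrow> ereal" where
  "parisian_ruin_obs k x T =
     (INF i\<in>{i. k \<le> i \<and> (\<forall>j\<in>{i - k..i}. x (T j) < 0)}. ereal (T i))"

text \<open>The functional \<open>exp (- \<alpha> \<tau> + \<beta> x(\<tau>))\<close> on \<open>\<tau> < \<infinity>\<close>, extended by zero.\<close>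

definition ruin_functional ::
  "real \<Rightarrow> real \<Rightarrow> ((real \<Rightarrow> real) \<Rightarrow> (nat \<Rightarrow> real) \<Rightarrow> ereal) \<Rightarrow>
   (real \<Rightarrow> real) \<Rightarrow> (nat \<Rightarrow> real) \<Rightarrow> real" where
  "ruin_functional \<alpha> \<beta> \<tau> x T =
     (if \<tau> x T < \<infinity>
      then exp (- \<alpha> * real_of_ereal (\<tau> x T) + \<beta> * x (real_of_ereal (\<tau> x T)))
      else 0)"


section \<open>Levy processes and independent Poisson epochs\<close>

locale levy_process = prob_space M
  for M :: "'a measure" +
  fixes X :: "real \<Rightarrow> 'a \<Rightarrow> real"
  assumes measurable_process: "\<And>t. 0 \<le> t \<Longrightarrow> X t \<in> borel_measurable M"
    and start_zero: "AE \<omega> in M. X 0 \<omega> = 0"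
    and cadlag_paths: "\<And>\<omega>. \<omega> \<in> space M \<Longrightarrow> cadlag (\<lambda>t. X t \<omega>)"
    and independent_increments:
      "\<And>(t :: nat \<Rightarrow> real) n. 0 \<le> t 0 \<Longrightarrow> (\<And>i. i < n \<Longrightarrow> t i \<le> t (Suc i)) \<Longrightarrow>
         indep_vars (\<lambda>_. borel) (\<lambda>i \<omega>. X (t (Suc i)) \<omega> - X (t i) \<omega>) {..<n}"
    and stationary_increments:
      "\<And>s t. 0 \<le> s \<Longrightarrow> 0 \<le> t \<Longrightarrow>
         distr M borel (\<lambda>\<omega>. X (s + t) \<omega> - X s \<omega>) = distr M borel (X t)"

locale poisson_epochs = prob_space M
  for M :: "'a measure" +
  fixes rate :: real and T :: "nat \<Rightarrow> 'a \<Rightarrow> real"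
  assumes intensity_pos: "0 < rate"
    and epoch_zero: "\<And>\<omega>. \<omega> \<in> space M \<Longrightarrow> T 0 \<omega> = 0"
    and epochs_increasing: "\<And>\<omega>. \<omega> \<in> space M \<Longrightarrow> strict_mono (\<lambda>i. T i \<omega>)"
    and interarrival_indep:
      "indep_vars (\<lambda>_. borel) (\<lambda>i \<omega>. T (Suc i) \<omega> - T i \<omega>) UNIV"
    and interarrival_distr:
      "\<And>i. distributed M lborel (\<lambda>\<omega>. T (Suc i) \<omega> - T i \<omega>) (exponential_density rate)"

text \<open>Independence is stated for the generated \<open>\<sigma>\<close>-algebras, since \<^const>\<open>prob_space.indep_var\<close>
  requires both random elements to take values in the same type.\<close>

locale levy_poisson = levy_process M X + poisson_epochs M rate T
  for M :: "'a measure" and X :: "real \<Rightarrow> 'a \<Rightarrow> real"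
    and rate :: real and T :: "nat \<Rightarrow> 'a \<Rightarrow> real" +
  assumes process_epochs_indep:
    "indep_set
       (sets (vimage_algebra (space M) (\<lambda>\<omega>. \<lambda>t\<in>{0..}. X t \<omega>) (Pi\<^sub>M {0..} (\<lambda>_. borel))))
       (sets (vimage_algebra (space M) (\<lambda>\<omega> i. T i \<omega>) (Pi\<^sub>M UNIV (\<lambda>_. borel))))"

text \<open>The expectation of a functional of the process and the epochs when the process is started
  at \<open>v\<close>, that is, for the process \<open>v + X\<close>.\<close>

definition expectation_from ::
  "'a measure \<Rightarrow> (real \<Rightarrow> 'a \<Rightarrow> real) \<Rightarrow> (nat \<Rightarrow> 'a \<Rightarrow> real) \<Rightarrow> real \<Rightarrow>
   ((real \<Rightarrow> real) \<Rightarrow> (nat \<Rightarrow> real) \<Rightarrow> real) \<Rightarrow> real" where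
  "expectation_from M X T v F = (\<integral>\<omega>. F (\<lambda>t. v + X t \<omega>) (\<lambda>i. T i \<omega>) \<partial>M)"

text \<open>The laws of the pairs \<open>(D, T\<^sup>D)\<close> and \<open>(U, T\<^sup>U)\<close>: extremum over \<open>[0, T\<^sub>1]\<close> first, time of
  its occurrence second.\<close>

definition inf_law ::
  "'a measure \<Rightarrow> (real \<Rightarrow> 'a \<Rightarrow> real) \<Rightarrow> (nat \<Rightarrow> 'a \<Rightarrow> real) \<Rightarrow> (real \<times> real) measure" where
  "inf_law M X T = distr M (borel \<Otimes>\<^sub>M borel)
     (\<lambda>\<omega>. (running_inf (\<lambda>t. X t \<omega>) (T 1 \<omega>), first_inf_time (\<lambda>t. X t \<omega>) (T 1 \<omega>)))"

definition sup_law ::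
  "'a measure \<Rightarrow> (real \<Rightarrow> 'a \<Rightarrow> real) \<Rightarrow> (nat \<Rightarrow> 'a \<Rightarrow> real) \<Rightarrow> (real \<times> real) measure" where
  "sup_law M X T = distr M (borel \<Otimes>\<^sub>M borel)
     (\<lambda>\<omega>. (running_sup (\<lambda>t. X t \<omega>) (T 1 \<omega>), last_sup_time (\<lambda>t. X t \<omega>) (T 1 \<omega>)))"

end

theory Submission
  imports Defs
begin

text \<open>
  Cut the path at the epochs, and cut the segment between \<open>T\<^sub>i\<close> and \<open>T\<^sub>i\<^sub>+\<^sub>1\<close> once more at the last time
  at which it attains its supremum. Each segment is then split into a first part, with increment \<open>U\<^sub>i\<close> and
  duration \<open>T\<^sup>U\<^sub>i\<close>, and a remainder, with increment \<open>D\<^sub>i\<close> and duration \<open>T\<^sup>D\<^sub>i\<close>. The Wiener-Hopf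
  factorization says that all these pairs are independent, that the first parts have the law of
  \<open>(U, T\<^sup>U)\<close> and that the remainders have the law of \<open>(D, T\<^sup>D)\<close> (lemmas \<open>part_indep\<close> and \<open>part_law\<close>).

  Given this, the theorem is a regrouping of a sum of independent vectors. Let \<open>S\<^sub>j\<close> be the supremum over the
  \<open>j\<close>-th segment, so that \<open>X\<close> is at \<open>S\<^sub>j + D\<^sub>j\<close> at the epoch \<open>T\<^sub>j\<^sub>+\<^sub>1\<close>. The walk \<open>S\<close> starts at
  \<open>u + U\<^sub>0\<close> and has the steps \<open>D\<^sub>j + U\<^sub>j\<^sub>+\<^sub>1\<close>, whereas the walk \<open>X(T\<^sub>j)\<close> has the steps \<open>U\<^sub>j + D\<^sub>j\<close>;
  both sequences of steps, together with their durations, have the same law. Ruin under continuous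
  observation occurs at the epoch that ends the first run of \<open>k - 1\<close> segments with negative suprema. It
  is therefore ruin with parameter \<open>k - 2\<close> of a walk with the law of the observed one, started at
  \<open>u + U\<^sub>0\<close> at time \<open>T\<^sup>U\<^sub>0\<close>, followed by one more independent remainder. This is the first identity
  (lemma \<open>expectation_cont\<close>). For the second identity it is applied at a starting point that is shifted by
  an independent copy of \<open>D\<close>. Then \<open>D + U\<^sub>0\<close> is one step of the observed walk, and the walk
  of suprema has the law of the observed walk without its starting point. Since \<open>u \<ge> 0\<close>, the starting point
  does not belong to any run of negative values (lemma \<open>obs_value_first_step\<close>).

  The factorization is obtained from random walks. For a walk stopped at an independent geometric time, the
  event that the last maximum occurs at step \<open>m\<close> is the intersection of an event about the first \<open>m\<close> steps
  and an event about the steps after \<open>m\<close>, so that sums over the geometric time factorize; reversing the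
  order of the steps turns the second factor into the law of the minimum (lemma \<open>geo_Wiener_Hopf\<close>).
  A Levy process sampled on a grid is such a walk, and the number of cells in an exponential time is
  geometric. As the grid is refined, the maxima converge, but the time of the maximum is not a continuous
  functional of the path. It is recovered by adding a small drift \<open>e\<close>: the last time of the supremum is the
  right derivative at \<open>e = 0\<close> of the supremum of \<open>x(s) + e s\<close> (lemma \<open>sup_right_derivative\<close>), and on a
  grid the time of the maximum with drift \<open>e\<close> lies between two difference quotients of maxima (lemma
  \<open>grid_sup_time_bounds\<close>). Refining the grid first and letting the drift vanish afterwards, along a diagonal
  sequence, gives almost sure convergence of all parts (lemma \<open>grid_parts_converge\<close>).
\<close>

section \<open>Cadlag paths and the times of their extremes\<close>

lemma cadlag_left_lim:
  assumes "cadlag x" "0 < c" shows "(x \<longlongrightarrow> left_lim x c) (at_left c)"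
proof -
  from assms obtain l where l: "(x \<longlongrightarrow> l) (at_left c)" unfolding cadlag_def by blast
  then have "Lim (at_left c) x = l" by (intro tendsto_Lim) simp_all
  then show ?thesis using l assms by (simp add: left_lim_def)
qed

lemma cadlag_right: "cadlag x \<Longrightarrow> 0 \<le> c \<Longrightarrow> (x \<longlongrightarrow> x c) (at_right c)"
  unfolding cadlag_def continuous_within by blast

lemma left_lim_eqI:
  assumes "0 < c" "(x \<longlongrightarrow> l) (at_left c)" shows "left_lim x c = l"
  using assms by (simp add: left_lim_def tendsto_Lim)

lemma cadlag_scale:
  assumes x: "cadlag x" shows "cadlag (\<lambda>s. c * x s)"
proof -
  have "((\<lambda>s. c * x s) \<longlongrightarrow> c * l) (at_left t)" if "(x \<longlongrightarrow> l) (at_left t)" for l t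
    using that by (intro tendsto_mult tendsto_const)
  moreover have "continuous (at_right t) (\<lambda>s. c * x s)" if "0 \<le> t" for t
    using x that unfolding cadlag_def by (intro continuous_mult continuous_const) simp
  ultimately show ?thesis using x unfolding cadlag_def by metis
qed

lemma cadlag_uminus: "cadlag x \<Longrightarrow> cadlag (\<lambda>s. - x s)"
  using cadlag_scale[of x "- 1"] by simp

lemma cadlag_drift: "cadlag x \<Longrightarrow> cadlag (\<lambda>s. x s + e * s)"
proof -
  assume x: "cadlag x"
  have "((\<lambda>s. x s + e * s) \<longlongrightarrow> l + e * t) (at_left t)" if "(x \<longlongrightarrow> l) (at_left t)" for l t
    using that by (intro tendsto_add tendsto_mult tendsto_const tendsto_ident_at)
  moreover have "continuous (at_right t) (\<lambda>s. x s + e * s)" if "0 \<le> t" for t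
    using x that unfolding cadlag_def by (intro continuous_add continuous_mult continuous_const continuous_ident) simp
  ultimately show ?thesis using x unfolding cadlag_def by metis
qed

lemma cadlag_restart:
  assumes "cadlag x" "0 \<le> a" shows "cadlag (\<lambda>s. x (a + s) - c)"
  unfolding cadlag_def
proof (intro conjI allI impI)
  fix t :: real assume t: "0 \<le> t"
  have "(x \<longlongrightarrow> x (a + t)) (at_right (a + t))" using assms t by (intro cadlag_right) auto
  then have "((\<lambda>s. x (s + a)) \<longlongrightarrow> x (a + t)) (at_right t)"
    by (subst (asm) add.commute, subst (asm) at_right_to_0) (simp add: at_right_to_0[of t] filterlim_filtermap ac_simps)
  then show "continuous (at_right t) (\<lambda>s. x (a + s) - c)"
    unfolding continuous_within by (intro tendsto_intros) (simp add: ac_simps)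
next
  fix t :: real assume t: "0 < t"
  have "(x \<longlongrightarrow> left_lim x (a + t)) (at_left (a + t))" using assms t by (intro cadlag_left_lim) auto
  then have "((\<lambda>s. x (a + s)) \<longlongrightarrow> left_lim x (a + t)) (at_left t)"
  proof (rule filterlim_compose)
    show "filterlim ((+) a) (at_left (a + t)) (at_left t)"
      by (auto simp: filterlim_at eventually_at_filter intro!: tendsto_intros)
  qed
  from tendsto_diff[OF this tendsto_const[of c]]
  show "\<exists>l. ((\<lambda>s. x (a + s) - c) \<longlongrightarrow> l) (at_left t)" by blast
qed

lemma left_lim_uminus:
  assumes "cadlag x" "0 \<le> c" shows "left_lim (\<lambda>s. - x s) c = - left_lim x c"
proof (cases "c = 0")
  case False
  then have "0 < c" using assms by simp
  with cadlag_left_lim[OF assms(1) this] show ?thesis by (intro left_lim_eqI tendsto_minus)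
qed (simp add: left_lim_def)

lemma left_lim_drift:
  assumes "cadlag x" "0 \<le> c" shows "left_lim (\<lambda>s. x s + e * s) c = left_lim x c + e * c"
proof (cases "c = 0")
  case False
  then have "0 < c" using assms by simp
  with cadlag_left_lim[OF assms(1) this] show ?thesis
    by (intro left_lim_eqI tendsto_add tendsto_mult tendsto_const tendsto_ident_at)
qed (simp add: left_lim_def)

text \<open>  The only compactness property of cadlag paths that is used: infinitely many of the arguments lie on the same
  side of their limit, and on each side the path has a limit.\<close>

lemma cadlag_subseq:
  assumes x: "cadlag x" and s: "\<And>n. s n \<in> {a..b}" and a: "0 \<le> a"
  obtains c r l where "c \<in> {a..b}" "strict_mono (r :: nat \<Rightarrow> nat)" "(\<lambda>n. s (r n)) \<longlonglongrightarrow> c"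
    "(\<lambda>n. x (s (r n))) \<longlonglongrightarrow> l" "l = x c \<or> l = left_lim x c"
proof -
  have "compact {a..b}" by simp
  then obtain c r where c: "c \<in> {a..b}" and r: "strict_mono (r :: nat \<Rightarrow> nat)" "(s \<circ> r) \<longlonglongrightarrow> c"
    using s unfolding compact_def by metis
  show thesis
  proof (cases "\<exists>\<^sub>\<infinity>n. s (r n) < c")
    case True
    then obtain q :: "nat \<Rightarrow> nat" where q: "strict_mono q" "\<And>n. s (r (q n)) < c"
      using infinite_enumerate[of "{n. s (r n) < c}"] by (auto simp: INFM_iff_infinite)
    have lim: "(\<lambda>n. s (r (q n))) \<longlonglongrightarrow> c"
      using LIMSEQ_subseq_LIMSEQ[OF r(2) q(1)] by (simp add: o_def)
    have "0 < c" using q(2)[of 0] s[of "r (q 0)"] a by auto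
    have "filterlim (\<lambda>n. s (r (q n))) (at_left c) sequentially"
      using lim q(2) by (auto simp: filterlim_at less_imp_neq intro!: always_eventually)
    from filterlim_compose[OF cadlag_left_lim[OF x \<open>0 < c\<close>] this] 
    show thesis using that[of c "r \<circ> q"] c lim strict_mono_o[OF r(1) q(1)] by (simp add: o_def)
  next
    case False
    then have ev: "\<forall>\<^sub>F n in sequentially. c \<le> s (r n)"
      by (simp add: not_INFM MOST_nat eventually_sequentially not_less) (metis le_less_linear less_imp_le_nat lessI less_le_trans)
    have "continuous (at c within {c..}) x"
      using x c a unfolding cadlag_def by (auto simp: continuous_within at_within_Ici_at_right)
    moreover have "filterlim (\<lambda>n. s (r n)) (nhds c) sequentially" using r(2) by (simp add: o_def)
    ultimately have "(\<lambda>n. x (s (r n))) \<longlonglongrightarrow> x c"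
      using ev by (intro continuous_within_tendsto_compose[of c "{c..}" x]) auto
    then show thesis using that[of c r] c r by (simp add: o_def)
  qed
qed

lemma cadlag_bdd_above:
  assumes x: "cadlag x" and a: "0 \<le> a" shows "bdd_above (x ` {a..b})"
proof (rule ccontr)
  assume "\<not> bdd_above (x ` {a..b})"
  then have "\<exists>s\<in>{a..b}. real n < x s" for n
    unfolding bdd_above_def by (auto simp: not_le)
  then obtain s where s: "\<And>n. s n \<in> {a..b}" "\<And>n. real n < x (s n)" by metis
  obtain c r l where "c \<in> {a..b}" and r: "strict_mono (r :: nat \<Rightarrow> nat)" and "(\<lambda>n. s (r n)) \<longlonglongrightarrow> c"
    and lim: "(\<lambda>n. x (s (r n))) \<longlonglongrightarrow> l" and "l = x c \<or> l = left_lim x c"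
    by (rule cadlag_subseq[OF x s(1) a])
  have "filterlim (\<lambda>n. x (s (r n))) at_top sequentially"
  proof (rule filterlim_at_top_mono[OF filterlim_real_sequentially])
    have "real n \<le> x (s (r n))" for n
      using s(2)[of "r n"] seq_suble[OF r, of n] by linarith
    then show "\<forall>\<^sub>F n in sequentially. real n \<le> x (s (r n))" by simp
  qed
  with lim show False
    using filterlim_at_top_imp_at_infinity not_tendsto_and_filterlim_at_infinity sequentially_bot by blast
qed

lemma running_inf_eq_sup: "running_inf x t = - running_sup (\<lambda>s. - x s) t"
  by (simp only: running_inf_def running_sup_def Inf_real_def image_image)

lemma running_sup_upper:
  assumes "cadlag x" "s \<in> {0..t}" shows "x s \<le> running_sup x t"
  unfolding running_sup_def using assms by (intro cSUP_upper cadlag_bdd_above) auto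

lemma running_sup_upper_left:
  assumes x: "cadlag x" and s: "s \<in> {0..t}" shows "left_lim x s \<le> running_sup x t"
proof (cases "s = 0")
  case True then show ?thesis using running_sup_upper[OF x, of s t] s by (simp add: left_lim_def)
next
  case False
  then have "0 < s" using s by auto
  have "\<forall>\<^sub>F r in at_left s. r \<in> {0<..<s}" 
    using \<open>0 < s\<close> by (rule eventually_at_left_real)
  then have "\<forall>\<^sub>F r in at_left s. x r \<le> running_sup x t"
    by eventually_elim (use s in \<open>auto intro!: running_sup_upper[OF x]\<close>)
  then show ?thesis 
    by (rule tendsto_upperbound[OF cadlag_left_lim[OF x \<open>0 < s\<close>]]) simp
qed

text \<open>  An envelope theorem, proved for a general weight \<open>w\<close> because \<open>w s = s\<close> gives the last time of the
  supremum and \<open>w s = - s\<close>, applied to the reflected path, gives the first time of the infimum. The quotient is at least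
  \<open>w c\<close> for every maximizer \<open>c\<close>. Conversely, points at which the perturbed path nearly attains its
  supremum make the unperturbed path nearly maximal, so that they accumulate at a maximizer.\<close>

lemma sup_right_derivative:
  fixes w :: "real \<Rightarrow> real"
  assumes x: "cadlag x" and t: "0 \<le> t" and w: "continuous_on {0..t} w"
    and e: "e \<longlonglongrightarrow> 0" "\<And>n. 0 < e n"
  shows "(\<lambda>n. ((SUP s\<in>{0..t}. x s + e n * w s) - running_sup x t) / e n)
     \<longlonglongrightarrow> Sup (w ` {s\<in>{0..t}. max (x s) (left_lim x s) = running_sup x t})"
proof -
  define C where "C = {s\<in>{0..t}. max (x s) (left_lim x s) = running_sup x t}"
  define m where "m = running_sup x t"
  define G where "G = Sup (w ` C)"
  obtain B where B: "\<And>s. s \<in> {0..t} \<Longrightarrow> \<bar>w s\<bar> \<le> B"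
    using compact_imp_bounded[OF compact_continuous_image[OF w]] unfolding bounded_iff by fastforce
  then have "0 \<le> B" using t by force
  have bdd: "bdd_above ((\<lambda>s. x s + d * w s) ` {0..t})" for d
  proof (rule bdd_aboveI2)
    fix s assume s: "s \<in> {0..t}"
    have "d * w s \<le> \<bar>d\<bar> * B" using B[OF s] abs_mult[of d "w s"] mult_left_mono[of "\<bar>w s\<bar>" B "\<bar>d\<bar>"] by linarith
    then show "x s + d * w s \<le> m + \<bar>d\<bar> * B" using running_sup_upper[OF x s] unfolding m_def by linarith
  qed
  have bddw: "bdd_above (w ` C)"
    using B unfolding C_def by (intro bdd_aboveI2[where M=B]) (auto simp: abs_le_iff)
  \<comment> \<open>maximizing sequences in a closed set of arguments lead to a maximizer in this set\<close>
  have near: "\<exists>c\<in>C. c \<in> A" if A: "A = {0..t} \<inter> w -` {l..}" and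
    s: "\<And>n. s n \<in> A" "(\<lambda>n. x (s n)) \<longlonglongrightarrow> m" for A s and l :: real
  proof -
    have "s n \<in> {0..t}" for n using s A by auto
    from cadlag_subseq[OF x this order_refl] obtain c r l where c: "c \<in> {0..t}" and r: "strict_mono (r :: nat \<Rightarrow> nat)"
      "(\<lambda>n. s (r n)) \<longlonglongrightarrow> c" "(\<lambda>n. x (s (r n))) \<longlonglongrightarrow> l" "l = x c \<or> l = left_lim x c" .
    have "closed A" unfolding A by (intro continuous_closed_preimage w) auto
    with r(2) s(1) have cA: "c \<in> A" by (auto intro: closed_sequentially[where f="\<lambda>n. s (r n)"])
    have "(\<lambda>n. x (s (r n))) \<longlonglongrightarrow> m"
      using LIMSEQ_subseq_LIMSEQ[OF s(2) r(1)] by (simp add: o_def)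
    then have "m = x c \<or> m = left_lim x c"
      using r(3,4) LIMSEQ_unique by blast
    moreover have "x c \<le> m" "left_lim x c \<le> m"
      using c unfolding m_def by (auto intro!: running_sup_upper running_sup_upper_left x)
    ultimately show ?thesis using cA c unfolding C_def m_def by auto
  qed
  have "\<exists>s\<in>{0..t}. m - d < x s" if "0 < d" for d
    using less_cSUP_iff[of "{0..t}" x "m - d"] cadlag_bdd_above[OF x, of 0 t] t that unfolding m_def running_sup_def by auto
  then have "\<exists>s\<in>{0..t}. m - 1 / real (Suc n) < x s" for n by simp
  then obtain s where s: "\<And>n. s n \<in> {0..t}" "\<And>n. m - 1 / real (Suc n) < x (s n)" by metis
  have "(\<lambda>n. x (s n)) \<longlonglongrightarrow> m"
  proof (rule tendsto_sandwich[OF always_eventually always_eventually])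
    show "(\<lambda>n. m - 1 / real (Suc n)) \<longlonglongrightarrow> m" 
      using tendsto_diff[OF tendsto_const LIMSEQ_Suc[OF lim_const_over_n[of 1]], of m] by simp
    show "(\<lambda>n. m) \<longlonglongrightarrow> m" by simp
  qed (use s in \<open>auto intro: less_imp_le running_sup_upper[OF x] simp: m_def\<close>)
  moreover have "s n \<in> {0..t} \<inter> w -` {- B..}" for n using s(1)[of n] B[of "s n"] by (simp add: abs_le_iff)
  ultimately obtain c0 where c0: "c0 \<in> C" using near[OF refl] by blast
  have lower: "G \<le> ((SUP s\<in>{0..t}. x s + e n * w s) - m) / e n" for n
  proof -
    have "w c \<le> ((SUP s\<in>{0..t}. x s + e n * w s) - m) / e n" if "c \<in> C" for c
    proof -
      have c: "c \<in> {0..t}" "max (x c) (left_lim x c) = m" using that unfolding C_def m_def by auto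
      have "m + e n * w c \<le> (SUP s\<in>{0..t}. x s + e n * w s)"
      proof (cases "x c = m")
        case True
        then show ?thesis using cSUP_upper[OF c(1) bdd[of "e n"]] by simp
      next
        case False
        then have lm: "left_lim x c = m" using c by (auto simp: max_def split: if_splits)
        then have c0: "0 < c" using False c by (cases "c = 0") (auto simp: left_lim_def)
        have "(w \<longlongrightarrow> w c) (at c within {0..t})" using w c by (auto simp: continuous_on_def)
        moreover have "at_left c \<le> at c within {0..t}"
        proof -
          have "at_left c = at c within {0..<c}"
            using c0 by (subst at_within_nhd[of c "{0<..}" "{..<c}" "{0..<c}"]) auto
          also have "\<dots> \<le> at c within {0..t}" using c by (intro at_le) auto
          finally show ?thesis .
        qed
        ultimately have wl: "(w \<longlongrightarrow> w c) (at_left c)" by (rule tendsto_mono[rotated])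
        have "((\<lambda>s. x s + e n * w s) \<longlongrightarrow> m + e n * w c) (at_left c)"
          using cadlag_left_lim[OF x c0] unfolding lm by (intro tendsto_intros wl)
        moreover have "\<forall>\<^sub>F r in at_left c. r \<in> {0<..<c}" using c0 by (rule eventually_at_left_real)
        then have "\<forall>\<^sub>F r in at_left c. x r + e n * w r \<le> (SUP s\<in>{0..t}. x s + e n * w s)"
          by eventually_elim (use c in \<open>auto intro!: cSUP_upper bdd\<close>)
        ultimately show ?thesis by (rule tendsto_upperbound) simp
      qed
      then show ?thesis using e(2)[of n] by (simp add: field_simps)
    qed
    then show ?thesis unfolding G_def using c0 by (intro cSUP_least) auto
  qed
  have upper: "\<forall>\<^sub>F n in sequentially. ((SUP s\<in>{0..t}. x s + e n * w s) - m) / e n < G + \<eta>" if \<eta>: "0 < \<eta>" for \<eta>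
  proof (rule ccontr)
    assume "\<not> ?thesis"
    then have "\<exists>\<^sub>F n in sequentially. G + \<eta> \<le> ((SUP s\<in>{0..t}. x s + e n * w s) - m) / e n"
      by (simp add: not_eventually not_less)
    then obtain r :: "nat \<Rightarrow> nat" where r: "strict_mono r" 
      "\<And>n. G + \<eta> \<le> ((SUP s\<in>{0..t}. x s + e (r n) * w s) - m) / e (r n)"
      using infinite_enumerate[of "{n. G + \<eta> \<le> ((SUP s\<in>{0..t}. x s + e n * w s) - m) / e n}"]
      by (auto simp: INFM_iff_infinite cofinite_eq_sequentially[symmetric])
    have "\<exists>s\<in>{0..t}. m + e (r n) * (G + \<eta> / 2) < x s + e (r n) * w s" for n
    proof -
      have "(G + \<eta>) * e (r n) \<le> (SUP s\<in>{0..t}. x s + e (r n) * w s) - m"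
        using r(2)[of n] e(2)[of "r n"] by (simp add: field_simps)
      moreover have "e (r n) * (\<eta> / 2) > 0" using e(2)[of "r n"] \<eta> by simp
      ultimately have "m + e (r n) * (G + \<eta> / 2) < (SUP s\<in>{0..t}. x s + e (r n) * w s)"
        by (simp add: algebra_simps)
      then show ?thesis using less_cSUP_iff[OF _ bdd[of "e (r n)"]] t by auto
    qed
    then obtain s where s: "\<And>n. s n \<in> {0..t}" "\<And>n. m + e (r n) * (G + \<eta> / 2) < x (s n) + e (r n) * w (s n)" by metis
    have ub: "x (s n) \<le> m" for n using s(1) running_sup_upper[OF x] by (auto simp: m_def)
    have wbig: "G + \<eta> / 2 \<le> w (s n)" for n
    proof -
      have "e (r n) * (G + \<eta> / 2) < e (r n) * w (s n)" using s(2)[of n] ub[of n] by linarith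
      then show ?thesis using e(2)[of "r n"] by simp
    qed
    have er: "(\<lambda>n. e (r n)) \<longlonglongrightarrow> 0" using LIMSEQ_subseq_LIMSEQ[OF e(1) r(1)] by (simp add: o_def)
    have "(\<lambda>n. x (s n)) \<longlonglongrightarrow> m"
    proof (rule tendsto_sandwich[OF always_eventually always_eventually])
      show "(\<lambda>n. m + e (r n) * (G + \<eta> / 2 - B)) \<longlonglongrightarrow> m" 
        using tendsto_add[OF tendsto_const tendsto_mult_left_zero[OF er]] by simp
      show "\<forall>n. m + e (r n) * (G + \<eta> / 2 - B) \<le> x (s n)"
      proof
        fix n
        have "e (r n) * w (s n) \<le> e (r n) * B" using B[OF s(1)[of n]] e(2)[of "r n"] by (intro mult_left_mono) auto
        then show "m + e (r n) * (G + \<eta> / 2 - B) \<le> x (s n)" using s(2)[of n] by (simp add: algebra_simps)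
      qed
      show "(\<lambda>n. m) \<longlonglongrightarrow> m" by simp
    qed (use ub in auto)
    moreover have "s n \<in> {0..t} \<inter> w -` {G + \<eta> / 2..}" for n using s(1)[of n] wbig[of n] by simp
    ultimately have "\<exists>c\<in>C. c \<in> {0..t} \<inter> w -` {G + \<eta> / 2..}" by (intro near[OF refl])
    then obtain c where "c \<in> C" "G + \<eta> / 2 \<le> w c" by auto
    moreover from \<open>c \<in> C\<close> have "w c \<le> G" unfolding G_def by (intro cSUP_upper bddw)
    ultimately show False using \<eta> by linarith
  qed
  have "(\<lambda>n. ((SUP s\<in>{0..t}. x s + e n * w s) - m) / e n) \<longlonglongrightarrow> G"
  proof (rule tendstoI)
    fix \<eta> :: real assume "0 < \<eta>"
    from upper[OF this] show "\<forall>\<^sub>F n in sequentially. dist (((SUP s\<in>{0..t}. x s + e n * w s) - m) / e n) G < \<eta>"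
    proof eventually_elim
      case (elim n) then show ?case using lower[of n] by (auto simp: dist_real_def)
    qed
  qed
  then show ?thesis by (simp only: m_def G_def C_def)
qed

lemma last_sup_time_derivative:
  assumes x: "cadlag x" and t: "0 \<le> t" and e: "e \<longlonglongrightarrow> 0" "\<And>n. 0 < e n"
  shows "(\<lambda>n. (running_sup (\<lambda>s. x s + e n * s) t - running_sup x t) / e n) \<longlonglongrightarrow> last_sup_time x t"
  using sup_right_derivative[OF x t continuous_on_id e]
  by (simp only: last_sup_time_def running_sup_def id_apply image_ident)

lemma first_inf_time_derivative:
  assumes x: "cadlag x" and t: "0 \<le> t" and e: "e \<longlonglongrightarrow> 0" "\<And>n. 0 < e n"
  shows "(\<lambda>n. (running_inf (\<lambda>s. x s + e n * s) t - running_inf x t) / e n) \<longlonglongrightarrow> first_inf_time x t"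
proof -
  define C where "C = {s\<in>{0..t}. max (- x s) (left_lim (\<lambda>s. - x s) s) = running_sup (\<lambda>s. - x s) t}"
  have "C = {s\<in>{0..t}. min (x s) (left_lim x s) = running_inf x t}"
    unfolding C_def running_inf_eq_sup
    by (rule Collect_cong) (use left_lim_uminus[OF x] in \<open>auto simp: max_def min_def\<close>)
  then have g: "first_inf_time x t = - Sup (uminus ` C)"
    unfolding first_inf_time_def by (simp add: Inf_real_def)
  have "(\<lambda>n. ((SUP s\<in>{0..t}. - x s + e n * - s) - running_sup (\<lambda>s. - x s) t) / e n) \<longlonglongrightarrow> Sup (uminus ` C)"
    unfolding C_def by (intro sup_right_derivative cadlag_uminus x t continuous_intros e)
  then have "(\<lambda>n. (running_sup (\<lambda>s. - (x s + e n * s)) t - running_sup (\<lambda>s. - x s) t) / e n) \<longlonglongrightarrow> Sup (uminus ` C)"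
    by (simp only: running_sup_def minus_add_distrib mult_minus_right)
  from tendsto_minus[OF this] show ?thesis unfolding g running_inf_eq_sup
    by (simp only: minus_divide_left minus_diff_eq minus_diff_minus minus_minus diff_minus_eq_add add_uminus_conv_diff uminus_add_conv_diff)
qed

section \<open>Wiener-Hopf factorization of a random walk at a geometric time\<close>

definition walk :: "(nat \<Rightarrow> real) \<Rightarrow> nat \<Rightarrow> real" where
  "walk z n = (\<Sum>i<n. z i)"

definition walk_max :: "(nat \<Rightarrow> real) \<Rightarrow> nat \<Rightarrow> real" where
  "walk_max z n = Max (walk z ` {..n})"

definition walk_min :: "(nat \<Rightarrow> real) \<Rightarrow> nat \<Rightarrow> real" where
  "walk_min z n = Min (walk z ` {..n})"

definition last_argmax :: "(nat \<Rightarrow> real) \<Rightarrow> nat \<Rightarrow> nat" where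
  "last_argmax z n = Max {m. m \<le> n \<and> walk z m = walk_max z n}"

definition first_argmin :: "(nat \<Rightarrow> real) \<Rightarrow> nat \<Rightarrow> nat" where
  "first_argmin z n = Min {m. m \<le> n \<and> walk z m = walk_min z n}"

definition ends_at_max :: "nat \<Rightarrow> (nat \<Rightarrow> real) \<Rightarrow> bool" where
  "ends_at_max m z \<longleftrightarrow> (\<forall>j\<le>m. walk z j \<le> walk z m)"

definition stays_negative :: "nat \<Rightarrow> (nat \<Rightarrow> real) \<Rightarrow> bool" where
  "stays_negative m z \<longleftrightarrow> (\<forall>j\<in>{0<..m}. walk z j < 0)"

lemma walk_shift: "walk (\<lambda>i. z (m + i)) l = walk z (m + l) - walk z m"
proof -
  have "walk z (m + l) = walk z m + walk (\<lambda>i. z (m + i)) l"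
    unfolding walk_def by (induction l) auto
  then show ?thesis by simp
qed

lemma walk_cong: "(\<And>i. i < n \<Longrightarrow> z i = z' i) \<Longrightarrow> walk z n = walk z' n"
  unfolding walk_def by (intro sum.cong) auto

lemma last_argmax_mem: "last_argmax z n \<le> n" "walk z (last_argmax z n) = walk_max z n"
proof -
  have "walk_max z n \<in> walk z ` {..n}" unfolding walk_max_def by (intro Max_in) auto
  then have "last_argmax z n \<in> {m. m \<le> n \<and> walk z m = walk_max z n}"
    unfolding last_argmax_def by (intro Max_in) auto
  then show "last_argmax z n \<le> n" "walk z (last_argmax z n) = walk_max z n" by auto
qed

lemma first_argmin_mem: "first_argmin z n \<le> n" "walk z (first_argmin z n) = walk_min z n"
proof -
  have "walk_min z n \<in> walk z ` {..n}" unfolding walk_min_def by (intro Min_in) auto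
  then have "first_argmin z n \<in> {m. m \<le> n \<and> walk z m = walk_min z n}"
    unfolding first_argmin_def by (intro Min_in) auto
  then show "first_argmin z n \<le> n" "walk z (first_argmin z n) = walk_min z n" by auto
qed

lemma walk_max_upper: "j \<le> n \<Longrightarrow> walk z j \<le> walk_max z n"
  unfolding walk_max_def by (intro Max_ge) auto

lemma walk_min_lower: "j \<le> n \<Longrightarrow> walk_min z n \<le> walk z j"
  unfolding walk_min_def by (intro Min_le) auto

lemma last_argmax_upper: "j \<le> n \<Longrightarrow> walk z j = walk_max z n \<Longrightarrow> j \<le> last_argmax z n"
  unfolding last_argmax_def by (intro Max_ge) auto

lemma first_argmin_lower: "j \<le> n \<Longrightarrow> walk z j = walk_min z n \<Longrightarrow> first_argmin z n \<le> j"
  unfolding first_argmin_def by (intro Min_le) auto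

text \<open>  The decomposition at the last maximum. The first condition concerns the first \<open>m\<close> steps, the second one the
  steps after \<open>m\<close>; this is what makes the two sides independent.\<close>

lemma last_argmax_eq_iff:
  assumes "m \<le> n"
  shows "last_argmax z n = m \<longleftrightarrow> ends_at_max m z \<and> stays_negative (n - m) (\<lambda>i. z (m + i))"
proof
  assume l: "last_argmax z n = m"
  have "walk z (m + j) < walk z m" if "0 < j" "j \<le> n - m" for j
    using last_argmax_upper[of "m + j" n z] walk_max_upper[of "m + j" n z] last_argmax_mem[of z n] that assms l
    by force
  then show "ends_at_max m z \<and> stays_negative (n - m) (\<lambda>i. z (m + i))"
    using walk_max_upper[of _ n z] last_argmax_mem[of z n] l
    unfolding ends_at_max_def stays_negative_def walk_shift by auto
next
  assume r: "ends_at_max m z \<and> stays_negative (n - m) (\<lambda>i. z (m + i))"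
  have lt: "walk z j < walk z m" if "m < j" "j \<le> n" for j
    using r that unfolding stays_negative_def walk_shift by (auto dest!: bspec[of _ _ "j - m"])
  have le: "walk z j \<le> walk z m" if "j \<le> n" for j
    using r lt[of j] that unfolding ends_at_max_def by (cases "j \<le> m") auto
  have eq: "walk z m = walk_max z n"
    using le[OF last_argmax_mem(1)[of z n]] last_argmax_mem(2)[of z n] walk_max_upper[OF assms, of z] by simp
  have "\<not> m < last_argmax z n" using lt[of "last_argmax z n"] last_argmax_mem[of z n] eq by auto
  then show "last_argmax z n = m" using last_argmax_upper[OF assms eq] by simp
qed

lemma first_argmin_eq_iff:
  assumes "m \<le> n"
  shows "first_argmin z n = m \<longleftrightarrow>
    (\<forall>j<m. walk z m < walk z j) \<and> (\<forall>j\<le>n - m. 0 \<le> walk (\<lambda>i. z (m + i)) j)"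
proof
  assume l: "first_argmin z n = m"
  have "walk z m < walk z j" if "j < m" for j
    using first_argmin_lower[of j n z] walk_min_lower[of j n z] first_argmin_mem[of z n] that assms l by force
  then show "(\<forall>j<m. walk z m < walk z j) \<and> (\<forall>j\<le>n - m. 0 \<le> walk (\<lambda>i. z (m + i)) j)"
    using walk_min_lower[of _ n z] first_argmin_mem[of z n] l assms unfolding walk_shift by auto
next
  assume r: "(\<forall>j<m. walk z m < walk z j) \<and> (\<forall>j\<le>n - m. 0 \<le> walk (\<lambda>i. z (m + i)) j)"
  have le: "walk z m \<le> walk z j" if "j \<le> n" for j
  proof (cases "j < m")
    case False
    then have "m + (j - m) = j" "j - m \<le> n - m" using that by auto
    with r show ?thesis unfolding walk_shift by (metis diff_ge_0_iff_ge)
  qed (use r in \<open>auto intro: less_imp_le\<close>)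
  have eq: "walk z m = walk_min z n"
    using le[OF first_argmin_mem(1)[of z n]] first_argmin_mem(2)[of z n] walk_min_lower[OF assms, of z] by simp
  have "\<not> first_argmin z n < m" using r first_argmin_mem[of z n] eq by auto
  then show "first_argmin z n = m" using first_argmin_lower[OF assms eq] by simp
qed

lemma ends_at_max_cong: "(\<And>i. i < n \<Longrightarrow> z i = z' i) \<Longrightarrow> ends_at_max n z = ends_at_max n z'"
proof -
  assume z: "\<And>i. i < n \<Longrightarrow> z i = z' i"
  have "walk z j = walk z' j" if "j \<le> n" for j by (rule walk_cong) (use z that in simp)
  then show ?thesis by (simp add: ends_at_max_def)
qed

text \<open>  Reversal of the first \<open>m\<close> steps. The remaining steps are kept, which makes the map a permutation of all
  steps.\<close>

definition reverse_steps :: "nat \<Rightarrow> (nat \<Rightarrow> real) \<Rightarrow> nat \<Rightarrow> real" where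
  "reverse_steps m z i = z (if i < m then m - 1 - i else i)"

lemma walk_reverse_steps:
  assumes "j \<le> m" shows "walk (reverse_steps m z) j = walk z m - walk z (m - j)"
proof -
  have "walk (reverse_steps m z) j = (\<Sum>i<j. z (m - 1 - i))"
    unfolding walk_def reverse_steps_def using assms by (intro sum.cong) auto
  also have "\<dots> = (\<Sum>i\<in>{m - j..<m}. z i)"
    using assms by (intro sum.reindex_bij_witness[where i="\<lambda>i. m - 1 - i" and j="\<lambda>i. m - 1 - i"]) auto
  also have "\<dots> = walk z m - walk z (m - j)"
    unfolding walk_def using sum.atLeastLessThan_concat[of 0 "m - j" m z] assms
    by (simp add: lessThan_atLeast0)
  finally show ?thesis .
qed

lemma ends_at_max_reverse_steps:
  "ends_at_max l (reverse_steps l z) \<longleftrightarrow> (\<forall>j\<le>l. 0 \<le> walk z j)"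
proof -
  have "ends_at_max l (reverse_steps l z) \<longleftrightarrow> (\<forall>j\<le>l. 0 \<le> walk z (l - j))"
    unfolding ends_at_max_def using walk_def[of z 0] by (auto simp: walk_reverse_steps)
  also have "\<dots> \<longleftrightarrow> (\<forall>j\<le>l. 0 \<le> walk z j)" by (metis diff_diff_cancel diff_le_self)
  finally show ?thesis .
qed

lemma stays_negative_reverse_steps:
  "stays_negative m (reverse_steps m z) \<longleftrightarrow> (\<forall>j<m. walk z m < walk z j)"
proof -
  have "stays_negative m (reverse_steps m z) \<longleftrightarrow> (\<forall>j\<in>{0<..m}. walk z m < walk z (m - j))"
    unfolding stays_negative_def by (auto simp: walk_reverse_steps)
  also have "\<dots> \<longleftrightarrow> (\<forall>j<m. walk z m < walk z j)"
  proof safe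
    fix j assume "\<forall>j\<in>{0<..m}. walk z m < walk z (m - j)" "j < m"
    then show "walk z m < walk z j" by (auto dest!: bspec[of _ _ "m - j"])
  qed auto
  finally show ?thesis .
qed

lemma suminf_swap_ennreal:
  fixes c :: "nat \<Rightarrow> nat \<Rightarrow> ennreal"
  shows "(\<Sum>n. \<Sum>m. c n m) = (\<Sum>m. \<Sum>n. c n m)"
proof -
  have "(\<Sum>n. \<Sum>m. c n m) = (\<integral>\<^sup>+n. (\<Sum>m. c n m) \<partial>count_space UNIV)"
    by (simp add: nn_integral_count_space_nat)
  also have "\<dots> = (\<Sum>m. \<integral>\<^sup>+n. c n m \<partial>count_space UNIV)" by (intro nn_integral_suminf) auto
  finally show ?thesis by (simp add: nn_integral_count_space_nat)
qed

text \<open>  The Cauchy product of series of nonnegative extended reals.\<close>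

lemma suminf_triangle_ennreal:
  fixes c :: "nat \<Rightarrow> nat \<Rightarrow> ennreal"
  shows "(\<Sum>n. \<Sum>m\<le>n. c m (n - m)) = (\<Sum>m. \<Sum>l. c m l)"
proof -
  have "(\<Sum>m\<le>n. c m (n - m)) = (\<Sum>m. if m \<le> n then c m (n - m) else 0)" for n
    by (subst suminf_finite[of "{..n}"]) auto
  then have 1: "(\<Sum>n. \<Sum>m\<le>n. c m (n - m)) = (\<Sum>m. \<Sum>n. if m \<le> n then c m (n - m) else 0)"
    by (simp only: suminf_swap_ennreal[of "\<lambda>n m. if m \<le> n then c m (n - m) else 0"])
  have 2: "(\<Sum>n. if m \<le> n then c m (n - m) else 0) = (\<Sum>l. c m l)" for m
    by (subst suminf_offset[of _ m]) auto
  show ?thesis unfolding 1 2 ..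
qed

locale random_walk = sequence_space \<rho> for \<rho> :: "real measure" +
  assumes sets_step [measurable_cong, simp]: "sets \<rho> = sets borel"
begin

lemma measurable_step [measurable]: "(\<lambda>z. z i) \<in> borel_measurable S"
  using measurable_component_singleton[of i UNIV "\<lambda>_. \<rho>"] by (simp cong: measurable_cong_sets)

lemma measurable_shift: "(\<lambda>z i. z (m + i)) \<in> S \<rightarrow>\<^sub>M S"
  by (rule measurable_PiM_single') (auto simp: space_PiM)

lemma measurable_walk [measurable]: "(\<lambda>z. walk z n) \<in> borel_measurable S"
  unfolding walk_def by measurable

lemma measurable_walk_max [measurable]: "(\<lambda>z. walk_max z n) \<in> borel_measurable S"
  unfolding walk_max_def by measurable

lemma measurable_walk_min [measurable]: "(\<lambda>z. walk_min z n) \<in> borel_measurable S"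
  unfolding walk_min_def by measurable

lemma measurable_ends_at_max [measurable]: "Measurable.pred S (ends_at_max m)"
  unfolding ends_at_max_def[abs_def]
  unfolding pred_def by (intro sets.sets_Collect borel_measurable_le measurable_walk)

lemma measurable_stays_negative [measurable]: "Measurable.pred S (stays_negative m)"
  unfolding stays_negative_def[abs_def]
  unfolding pred_def by (intro sets.sets_Collect_countable_Ball borel_measurable_less measurable_walk) auto

lemma nn_integral_split_at:
  assumes [measurable]: "A \<in> borel_measurable S" "B \<in> borel_measurable S"
    and A: "\<And>z z'. (\<And>i. i < m \<Longrightarrow> z i = z' i) \<Longrightarrow> A z = A z'"
  shows "(\<integral>\<^sup>+z. A z * B (\<lambda>i. z (m + i)) \<partial>S) = (\<integral>\<^sup>+z. A z \<partial>S) * (\<integral>\<^sup>+z. B z \<partial>S)"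
proof -
  note [measurable] = measurable_shift[of m]
  have "(\<integral>\<^sup>+z. A z * B (\<lambda>i. z (m + i)) \<partial>S)
      = (\<integral>\<^sup>+z. A z * B (\<lambda>i. z (m + i)) \<partial>distr (S \<Otimes>\<^sub>M S) S (\<lambda>(\<omega>, \<omega>'). comb_seq m \<omega> \<omega>'))"
    by (simp only: PiM_comb_seq)
  also have "\<dots> = (\<integral>\<^sup>+(\<omega>, \<omega>'). A (comb_seq m \<omega> \<omega>') * B (\<lambda>i. comb_seq m \<omega> \<omega>' (m + i)) \<partial>(S \<Otimes>\<^sub>M S))"
    by (subst nn_integral_distr) (auto simp: measurable_comb_seq case_prod_beta')
  also have "\<dots> = (\<integral>\<^sup>+(\<omega>, \<omega>'). A \<omega> * B \<omega>' \<partial>(S \<Otimes>\<^sub>M S))"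
  proof -
    have "A (comb_seq m \<omega> \<omega>') = A \<omega>" for \<omega> \<omega>' by (intro A) (simp add: comb_seq_less)
    moreover have "comb_seq m \<omega> \<omega>' (m + i) = \<omega>' i" for \<omega> \<omega>' :: "nat \<Rightarrow> real" and i by (simp add: comb_seq_def)
    ultimately show ?thesis by simp
  qed
  also have "\<dots> = (\<integral>\<^sup>+\<omega>. \<integral>\<^sup>+\<omega>'. A \<omega> * B \<omega>' \<partial>S \<partial>S)"
    by (subst P.nn_integral_fst[symmetric]) auto
  finally show ?thesis by (simp add: nn_integral_cmult nn_integral_multc)
qed

text \<open>  Permuting independent steps with a common law does not change their joint law.\<close>

lemma nn_integral_reverse_steps:
  assumes [measurable]: "A \<in> borel_measurable S"
  shows "(\<integral>\<^sup>+z. A (reverse_steps m z) \<partial>S) = (\<integral>\<^sup>+z. A z \<partial>S)"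
proof -
  define \<pi> where "\<pi> i = (if i < m then m - 1 - i else i)" for i :: nat
  have "inj \<pi>" by (rule inj_on_inverseI[of _ \<pi>]) (auto simp: \<pi>_def)
  then have "distr S S (\<lambda>z. \<lambda>i\<in>UNIV. z (\<pi> i)) = S"
    using distr_PiM_reindex[of UNIV "\<lambda>_. \<rho>" \<pi> UNIV] by (simp add: prob_space)
  moreover have "(\<lambda>z. \<lambda>i\<in>UNIV. z (\<pi> i)) = reverse_steps m"
    by (auto simp: fun_eq_iff reverse_steps_def \<pi>_def)
  ultimately have d: "distr S S (reverse_steps m) = S" by simp
  have [measurable]: "reverse_steps m \<in> S \<rightarrow>\<^sub>M S"
    unfolding reverse_steps_def[abs_def] by (rule measurable_PiM_single') (auto simp: space_PiM)
  show ?thesis by (subst (2) d[symmetric]) (simp add: nn_integral_distr)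
qed

text \<open>Expectation of a functional of the walk and of an independent time that has the value \<open>n\<close> with
  probability \<open>p q\<^sup>n\<close>. Writing the expectation as a series avoids a product space.\<close>

definition geo :: "ennreal \<Rightarrow> ennreal \<Rightarrow> (nat \<Rightarrow> (nat \<Rightarrow> real) \<Rightarrow> ennreal) \<Rightarrow> ennreal" where
  "geo p q F = (\<Sum>n. p * q ^ n * (\<integral>\<^sup>+z. F n z \<partial>S))"

text \<open>  Since \<open>q\<^sup>n = q\<^sup>m q\<^sup>n\<^sup>-\<^sup>m\<close>, the time before the cut and the time after it can be summed
  independently of each other.\<close>

lemma geo_split:
  assumes [measurable]: "\<And>m. A m \<in> borel_measurable S" "\<And>m. B m \<in> borel_measurable S"
    and A: "\<And>m z z'. (\<And>i. i < m \<Longrightarrow> z i = z' i) \<Longrightarrow> A m z = A m z'"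
    and F: "\<And>n z. F n z = (\<Sum>m\<le>n. A m z * B (n - m) (\<lambda>i. z (m + i)))"
  shows "geo p q F = p * (\<Sum>m. q ^ m * (\<integral>\<^sup>+z. A m z \<partial>S)) * (\<Sum>l. q ^ l * (\<integral>\<^sup>+z. B l z \<partial>S))"
proof -
  note [measurable] = measurable_shift
  let ?a = "\<lambda>m. \<integral>\<^sup>+z. A m z \<partial>S" and ?b = "\<lambda>m. \<integral>\<^sup>+z. B m z \<partial>S"
  have "p * q ^ n * (\<integral>\<^sup>+z. F n z \<partial>S) = (\<Sum>m\<le>n. p * (q ^ m * ?a m * (q ^ (n - m) * ?b (n - m))))" for n
  proof -
    have "(\<integral>\<^sup>+z. F n z \<partial>S) = (\<Sum>m\<le>n. ?a m * ?b (n - m))"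
      unfolding F by (subst nn_integral_sum) (auto intro!: sum.cong nn_integral_split_at A)
    moreover have "q ^ n = q ^ m * q ^ (n - m)" if "m \<le> n" for m
      using that by (simp add: power_add[symmetric])
    ultimately show ?thesis
      by (auto simp: sum_distrib_left ac_simps intro!: sum.cong)
  qed
  then have "geo p q F = (\<Sum>m. \<Sum>l. p * (q ^ m * ?a m * (q ^ l * ?b l)))"
    unfolding geo_def by (simp only: suminf_triangle_ennreal[of "\<lambda>m l. p * (q ^ m * ?a m * (q ^ l * ?b l))"])
  then show ?thesis by (simp only: ennreal_suminf_cmult ennreal_suminf_multc) (simp only: mult.assoc)
qed

text \<open>  With \<open>a f\<close> and \<open>b g\<close> for the sums over the paths that end at their maximum and over the paths that stay
  negative, the left-hand side is \<open>p a(f) b(g)\<close>, by the decomposition at the last maximum. The decomposition at the first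
  minimum gives the same sums after a reversal of the steps on each side of the cut, so the last factor is
  \<open>p b(g) a(1)\<close>. The superfluous factors cancel because the total mass is \<open>p a(1) b(1) = 1\<close>.\<close>

theorem geo_Wiener_Hopf:
  assumes [measurable]: "f \<in> borel_measurable (borel \<Otimes>\<^sub>M borel)" "g \<in> borel_measurable (borel \<Otimes>\<^sub>M borel)"
    and p: "(\<Sum>n. p * q ^ n) = 1"
  shows "geo p q (\<lambda>n z. f (walk_max z n, real (last_argmax z n)) *
             g (walk z n - walk_max z n, real (n - last_argmax z n))) =
    geo p q (\<lambda>n z. f (walk_max z n, real (last_argmax z n))) *
    geo p q (\<lambda>n z. g (walk_min z n, real (first_argmin z n)))"
proof -
  define A where "A f m z = f (walk z m, real m) * of_bool (ends_at_max m z)" for f :: "real \<times> real \<Rightarrow> ennreal" and m z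
  define B where "B g l z = g (walk z l, real l) * of_bool (stays_negative l z)" for g :: "real \<times> real \<Rightarrow> ennreal" and l z
  define a where "a f = (\<Sum>m. q ^ m * (\<integral>\<^sup>+z. A f m z \<partial>S))" for f
  define b where "b g = (\<Sum>l. q ^ l * (\<integral>\<^sup>+z. B g l z \<partial>S))" for g
  have A_meas [measurable]: "A f m \<in> borel_measurable S" and B_meas [measurable]: "B f m \<in> borel_measurable S"
    if [measurable]: "f \<in> borel_measurable (borel \<Otimes>\<^sub>M borel)" for f m
    unfolding A_def[abs_def] B_def[abs_def] by measurable
  have A_cong: "A f m z = A f m z'" if "\<And>i. i < m \<Longrightarrow> z i = z' i" for f z z' and m :: nat
  proof -
    have "walk z m = walk z' m" by (rule walk_cong) (rule that)
    moreover have "ends_at_max m z = ends_at_max m z'" by (rule ends_at_max_cong) (rule that)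
    ultimately show ?thesis by (simp only: A_def)
  qed
  have max: "geo p q (\<lambda>n z. f (walk_max z n, real (last_argmax z n)) *
             g (walk z n - walk_max z n, real (n - last_argmax z n))) = p * a f * b g"
    if [measurable]: "f \<in> borel_measurable (borel \<Otimes>\<^sub>M borel)" "g \<in> borel_measurable (borel \<Otimes>\<^sub>M borel)" for f g
    unfolding a_def b_def
  proof (rule geo_split)
    fix n z
    have "A f m z * B g (n - m) (\<lambda>i. z (m + i)) = 
      (if m = last_argmax z n then f (walk_max z n, real (last_argmax z n)) *
             g (walk z n - walk_max z n, real (n - last_argmax z n)) else 0)" if "m \<le> n" for m
      using last_argmax_eq_iff[OF that, of z] last_argmax_mem[of z n] that
      by (auto simp: A_def B_def walk_shift)
    then show "f (walk_max z n, real (last_argmax z n)) * g (walk z n - walk_max z n, real (n - last_argmax z n)) =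
       (\<Sum>m\<le>n. A f m z * B g (n - m) (\<lambda>i. z (m + i)))"
      using last_argmax_mem(1)[of z n] by simp
  next
    fix m :: nat and z z' assume "\<And>i. i < m \<Longrightarrow> z i = (z' i :: real)"
    then show "A f m z = A f m z'" by (rule A_cong)
  qed measurable
  have B_rev: "(\<integral>\<^sup>+z. g (walk z m, real m) * of_bool (\<forall>j<m. walk z m < walk z j) \<partial>S) = (\<integral>\<^sup>+z. B g m z \<partial>S)"
    if [measurable]: "g \<in> borel_measurable (borel \<Otimes>\<^sub>M borel)" for g m
    by (subst nn_integral_reverse_steps[symmetric, of _ m])
      (auto simp: B_def stays_negative_reverse_steps walk_reverse_steps walk_def[of _ 0])
  have A_rev: "(\<integral>\<^sup>+z. of_bool (\<forall>j\<le>l. 0 \<le> walk z j) \<partial>S) = (\<integral>\<^sup>+z. A (\<lambda>_. 1) l z \<partial>S)" for l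
    by (subst nn_integral_reverse_steps[symmetric, of _ l]) (auto simp: A_def ends_at_max_reverse_steps)
  have min: "geo p q (\<lambda>n z. g (walk_min z n, real (first_argmin z n))) = p * b g * a (\<lambda>_. 1)"
  proof -
    have "geo p q (\<lambda>n z. g (walk_min z n, real (first_argmin z n))) =
      p * (\<Sum>m. q ^ m * (\<integral>\<^sup>+z. g (walk z m, real m) * of_bool (\<forall>j<m. walk z m < walk z j) \<partial>S)) *
        (\<Sum>l. q ^ l * (\<integral>\<^sup>+z. of_bool (\<forall>j\<le>l. 0 \<le> walk z j) \<partial>S))"
    proof (rule geo_split)
      fix n z
      have "g (walk z m, real m) * of_bool (\<forall>j<m. walk z m < walk z j) *
          of_bool (\<forall>j\<le>n - m. 0 \<le> walk (\<lambda>i. z (m + i)) j) = 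
        (if m = first_argmin z n then g (walk_min z n, real (first_argmin z n)) else 0)" if "m \<le> n" for m
        using first_argmin_eq_iff[OF that, of z] first_argmin_mem[of z n] that by auto
      then show "g (walk_min z n, real (first_argmin z n)) = 
        (\<Sum>m\<le>n. g (walk z m, real m) * of_bool (\<forall>j<m. walk z m < walk z j) *
          of_bool (\<forall>j\<le>n - m. 0 \<le> walk (\<lambda>i. z (m + i)) j))"
        using first_argmin_mem(1)[of z n] by simp
    next
      fix m :: nat and z z' assume "\<And>i. i < m \<Longrightarrow> z i = (z' i :: real)"
      then have "walk z j = walk z' j" if "j \<le> m" for j using that by (intro walk_cong) auto
      then show "g (walk z m, real m) * of_bool (\<forall>j<m. walk z m < walk z j) =
        g (walk z' m, real m) * of_bool (\<forall>j<m. walk z' m < walk z' j)" by simp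
    qed measurable
    then show ?thesis unfolding a_def b_def using A_rev B_rev[of g] by simp
  qed
  have one: "p * a (\<lambda>_. 1) * b (\<lambda>_. 1) = 1"
    using max[of "\<lambda>_. 1" "\<lambda>_. 1"] p by (simp add: geo_def emeasure_space_1)
  have "geo p q (\<lambda>n z. f (walk_max z n, real (last_argmax z n))) = p * a f * b (\<lambda>_. 1)"
    using max[of f "\<lambda>_. 1"] by simp
  then have "geo p q (\<lambda>n z. f (walk_max z n, real (last_argmax z n))) *
    geo p q (\<lambda>n z. g (walk_min z n, real (first_argmin z n))) = 
    (p * a f * b g) * (p * a (\<lambda>_. 1) * b (\<lambda>_. 1))" 
    unfolding min by (simp only: ac_simps)
  then show ?thesis unfolding one max[OF assms(1,2)] by simp
qed

end

section \<open>Paths along a grid and at random times\<close>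

text \<open>  Near a point where the path exceeds a level it does so on an interval to the right of the point, and fine
  grids meet this interval. Left continuity at \<open>b\<close> excludes that the supremum is attained by a jump at \<open>b\<close>,
  which the grid misses; left continuity at \<open>a\<close> controls the grid points slightly to the left of \<open>a\<close>.\<close>

lemma grid_max_tendsto:
  fixes x :: "real \<Rightarrow> real" and K N :: "nat \<Rightarrow> nat"
  assumes x: "cadlag x" and ab: "0 \<le> a" "a < b"
    and cont: "left_lim x a = x a" "left_lim x b = x b"
    and h: "\<And>m. 0 < h m" "h \<longlonglongrightarrow> 0"
    and K: "\<And>m. real (K m) * h m \<le> a" "(\<lambda>m. real (K m) * h m) \<longlonglongrightarrow> a"
    and N: "\<And>m. real (K m + N m) * h m \<le> b" "(\<lambda>m. real (K m + N m) * h m) \<longlonglongrightarrow> b"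
  shows "(\<lambda>m. Max ((\<lambda>l. x (real (K m + l) * h m)) ` {..N m})) \<longlonglongrightarrow> (SUP s\<in>{a..b}. x s)"
proof (rule order_tendstoI)
  fix c assume "c < (SUP s\<in>{a..b}. x s)"
  then obtain s0 where s0: "s0 \<in> {a..b}" "c < x s0"
    using less_cSUP_iff[OF _ cadlag_bdd_above[OF x ab(1)]] ab by auto
  have "\<exists>s\<in>{a..<b}. c < x s"
  proof (cases "s0 = b")
    case True
    have "(x \<longlongrightarrow> x b) (at_left b)" using cadlag_left_lim[OF x, of b] cont ab by simp
    then have "\<forall>\<^sub>F s in at_left b. c < x s" using s0 True by (auto dest: order_tendstoD)
    moreover have "\<forall>\<^sub>F s in at_left b. s \<in> {a<..<b}" using ab(2) by (rule eventually_at_left_real)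
    ultimately have "\<forall>\<^sub>F s in at_left b. s \<in> {a..<b} \<and> c < x s" by eventually_elim auto
    then show ?thesis using eventually_happens'[OF trivial_limit_at_left_real] by blast
  qed (use s0 in auto)
  then obtain s where s: "a \<le> s" "s < b" "c < x s" by auto
  have "\<forall>\<^sub>F r in at_right s. c < x r" using cadlag_right[OF x, of s] s ab by (auto dest: order_tendstoD)
  then obtain d where d: "s < d" "\<And>r. s < r \<Longrightarrow> r < d \<Longrightarrow> c < x r"
    unfolding eventually_at_right_field by auto
  have "\<forall>\<^sub>F m in sequentially. h m < d - s" using order_tendstoD(2)[OF h(2), of "d - s"] d(1) by simp
  moreover have "(\<lambda>m. real (K m + N m) * h m - h m) \<longlonglongrightarrow> b - 0" using N h by (intro tendsto_diff)
  then have "\<forall>\<^sub>F m in sequentially. s < real (K m + N m) * h m - h m" using s order_tendstoD(1) by fastforce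
  ultimately show "\<forall>\<^sub>F m in sequentially. c < Max ((\<lambda>l. x (real (K m + l) * h m)) ` {..N m})"
  proof eventually_elim
    case (elim m)
    \<comment> \<open>the first grid point to the right of \<open>s\<close>\<close>
    define j where "j = Suc (nat \<lfloor>s / h m\<rfloor>)"
    have "0 \<le> s / h m" using s ab h(1)[of m] by simp
    then have "real j = of_int \<lfloor>s / h m\<rfloor> + 1" unfolding j_def by simp
    then have "s / h m < real j" "real j \<le> s / h m + 1" by linarith+
    then have j: "s < real j * h m" "real j * h m \<le> s + h m" using h(1)[of m] by (simp_all add: field_simps)
    have "real (K m) * h m < real j * h m" using j K(1)[of m] s by linarith
    then have "K m < j" using h(1)[of m] by simp
    moreover have "real j * h m < real (K m + N m) * h m" using j elim by linarith
    then have "j < K m + N m" using h(1)[of m] by (simp only: mult_less_cancel_right_pos of_nat_less_iff)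
    ultimately have "x (real (K m + (j - K m)) * h m) \<le> Max ((\<lambda>l. x (real (K m + l) * h m)) ` {..N m})"
      by (intro Max_ge finite_imageI imageI) auto
    moreover have "c < x (real j * h m)" using j elim by (intro d) auto
    ultimately show ?case using \<open>K m < j\<close> by simp
  qed
next
  fix c assume c: "(SUP s\<in>{a..b}. x s) < c"
  have le: "x s < c" if "s \<in> {a..b}" for s
    using cSUP_upper[OF that cadlag_bdd_above[OF x ab(1)]] c by linarith
  have "\<forall>\<^sub>F m in sequentially. \<forall>r\<in>{real (K m) * h m..a}. x r < c"
  proof (cases "a = 0")
    case True
    have "r = 0" if "r \<in> {real (K m) * h m..a}" for r m
    proof -
      have "0 \<le> real (K m) * h m" using h(1)[of m] by simp
      then show ?thesis using that True by simp
    qed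
    moreover have "x 0 < c" using le[of 0] ab True by simp
    ultimately show ?thesis by (intro always_eventually) metis
  next
    case False
    have "(x \<longlongrightarrow> x a) (at_left a)" using cadlag_left_lim[OF x, of a] cont ab False by simp
    then have "\<forall>\<^sub>F s in at_left a. x s < c" using le[of a] ab by (auto dest: order_tendstoD)
    then obtain d where d: "d < a" "\<And>r. d < r \<Longrightarrow> r < a \<Longrightarrow> x r < c"
      unfolding eventually_at_left_field by auto
    have "\<forall>\<^sub>F m in sequentially. d < real (K m) * h m" using order_tendstoD(1)[OF K(2) d(1)] .
    then show ?thesis
    proof eventually_elim
      case (elim m)
      have "x a < c" using le[of a] ab by simp
      show ?case
      proof
        fix r assume r: "r \<in> {real (K m) * h m..a}"
        then show "x r < c" using d(2)[of r] elim \<open>x a < c\<close> by (cases "r = a") auto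
      qed
    qed
  qed
  then show "\<forall>\<^sub>F m in sequentially. Max ((\<lambda>l. x (real (K m + l) * h m)) ` {..N m}) < c"
  proof eventually_elim
    case (elim m)
    have "x (real (K m + l) * h m) < c" if "l \<le> N m" for l
    proof (cases "real (K m + l) * h m \<le> a")
      case True
      moreover have "real (K m) * h m \<le> real (K m + l) * h m" using h(1)[of m] by (simp add: mult_right_mono)
      ultimately show ?thesis using elim by simp
    next
      case False
      moreover have "real (K m + l) * h m \<le> real (K m + N m) * h m" using that h(1)[of m] by (simp add: mult_right_mono)
      ultimately show ?thesis using N(1)[of m] by (intro le) auto
    qed
    then show ?case by (subst Max_less_iff) auto
  qed
qed

definition grid_steps :: "real \<Rightarrow> real \<Rightarrow> (real \<Rightarrow> real) \<Rightarrow> nat \<Rightarrow> real" where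
  "grid_steps e h x j = x (real (Suc j) * h) - x (real j * h) + e * h"

lemma walk_grid_steps:
  "walk (\<lambda>j. grid_steps e h x (K + j)) l =
    (x (real (K + l) * h) + e * (real (K + l) * h)) - (x (real K * h) + e * (real K * h))"
  unfolding walk_def grid_steps_def by (induction l) (auto simp: algebra_simps)

lemma Max_diff_const:
  fixes f :: "'b \<Rightarrow> real" assumes "finite A" "A \<noteq> {}"
  shows "Max ((\<lambda>l. f l - c) ` A) = Max (f ` A) - c"
  using Max_add_commute[OF assms, of f "- c"] by simp

lemma Min_eq_Max:
  fixes f :: "'b \<Rightarrow> real" assumes "finite A" "A \<noteq> {}"
  shows "Min (f ` A) = - Max ((\<lambda>l. - f l) ` A)"
proof (rule Min_eqI)
  have "Max ((\<lambda>l. - f l) ` A) \<in> (\<lambda>l. - f l) ` A" using assms by (intro Max_in) auto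
  then show "- Max ((\<lambda>l. - f l) ` A) \<in> f ` A" by force
  fix y assume "y \<in> f ` A"
  then obtain l where l: "l \<in> A" "y = f l" by auto
  have "- f l \<le> Max ((\<lambda>l. - f l) ` A)" using assms l by (intro Max_ge) auto
  then show "- Max ((\<lambda>l. - f l) ` A) \<le> y" using l by simp
qed (use assms in simp)

lemma walk_max_grid: "walk_max (\<lambda>j. grid_steps e h x (K + j)) n =
    Max ((\<lambda>l. x (real (K + l) * h) + e * (real (K + l) * h)) ` {..n}) - (x (real K * h) + e * (real K * h))"
  unfolding walk_max_def by (subst Max_diff_const[symmetric]) (auto simp: walk_grid_steps cong: image_cong)

lemma walk_min_grid: "walk_min (\<lambda>j. grid_steps e h x (K + j)) n =
    - Max ((\<lambda>l. - x (real (K + l) * h) + (- e) * (real (K + l) * h)) ` {..n}) - (x (real K * h) + e * (real K * h))"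
proof -
  let ?c = "- (x (real K * h) + e * (real K * h))"
  have "walk_min (\<lambda>j. grid_steps e h x (K + j)) n = - Max ((\<lambda>l. - walk (\<lambda>j. grid_steps e h x (K + j)) l) ` {..n})"
    unfolding walk_min_def by (rule Min_eq_Max) auto
  also have "(\<lambda>l. - walk (\<lambda>j. grid_steps e h x (K + j)) l) = (\<lambda>l. (- x (real (K + l) * h) + (- e) * (real (K + l) * h)) - ?c)"
    by (rule ext) (simp add: walk_grid_steps)
  also have "Max (\<dots> ` {..n}) = Max ((\<lambda>l. - x (real (K + l) * h) + (- e) * (real (K + l) * h)) ` {..n}) - ?c"
    by (rule Max_diff_const) auto
  finally show ?thesis by simp
qed

lemma running_sup_restart:
  assumes x: "cadlag x" and "0 \<le> a" "a \<le> b"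
  shows "running_sup (\<lambda>s. x (a + s) - x a + e * s) (b - a) =
    (SUP s\<in>{a..b}. x s + e * s) - (x a + e * a)"
proof -
  have im: "(+) a ` {0..b - a} = {a..b}" by simp
  have bdd: "bdd_above ((\<lambda>s. x s + e * s) ` {a..b})"
    by (rule cadlag_bdd_above[OF cadlag_drift[OF x] assms(2)])
  have "(SUP s\<in>{a..b}. x s + e * s) - (x a + e * a) = (SUP s\<in>{a..b}. x s + e * s - (x a + e * a))"
  proof (rule antisym)
    have "(SUP s\<in>{a..b}. x s + e * s) \<le> (SUP s\<in>{a..b}. x s + e * s - (x a + e * a)) + (x a + e * a)"
    proof (rule cSUP_least)
      fix s assume "s \<in> {a..b}"
      then have "x s + e * s - (x a + e * a) \<le> (SUP s\<in>{a..b}. x s + e * s - (x a + e * a))"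
      proof (rule cSUP_upper)
        obtain B where "\<forall>s\<in>{a..b}. x s + e * s \<le> B" using bdd unfolding bdd_above_def by auto
        then show "bdd_above ((\<lambda>s. x s + e * s - (x a + e * a)) ` {a..b})"
          by (intro bdd_aboveI2[where M="B - (x a + e * a)"]) auto
      qed
      then show "x s + e * s \<le> (SUP s\<in>{a..b}. x s + e * s - (x a + e * a)) + (x a + e * a)" by linarith
    qed (use assms in auto)
    then show "(SUP s\<in>{a..b}. x s + e * s) - (x a + e * a) \<le> (SUP s\<in>{a..b}. x s + e * s - (x a + e * a))" by linarith
    show "(SUP s\<in>{a..b}. x s + e * s - (x a + e * a)) \<le> (SUP s\<in>{a..b}. x s + e * s) - (x a + e * a)"
      using assms by (intro cSUP_least diff_right_mono cSUP_upper bdd) auto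
  qed
  also have "\<dots> = running_sup (\<lambda>s. x (a + s) - x a + e * s) (b - a)"
    unfolding running_sup_def im[symmetric] image_image by (simp add: algebra_simps)
  finally show ?thesis by simp
qed

lemma cadlag_tendsto_from_left:
  assumes x: "cadlag x" and a: "0 \<le> a" "left_lim x a = x a"
    and s: "\<And>m. 0 \<le> s m" "\<And>m. s m \<le> a" "s \<longlonglongrightarrow> a"
  shows "(\<lambda>m. x (s m)) \<longlonglongrightarrow> x a"
proof (cases "a = 0")
  case True
  then have "s m = a" for m using s(1,2)[of m] by simp
  then show ?thesis by simp
next
  case False
  then have "(x \<longlongrightarrow> x a) (at_left a)" using cadlag_left_lim[OF x, of a] a by simp
  then have "continuous (at a within {..a}) x" by (simp add: continuous_within at_within_Iic_at_left)
  then show ?thesis using s by (intro continuous_within_tendsto_compose[of a "{..a}" x]) auto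
qed

context
  fixes x :: "real \<Rightarrow> real" and K N :: "nat \<Rightarrow> nat" and a b :: real and h :: "nat \<Rightarrow> real"
  assumes x: "cadlag x" and ab: "0 \<le> a" "a < b"
    and cont: "left_lim x a = x a" "left_lim x b = x b"
    and h: "\<And>m. 0 < h m" "h \<longlonglongrightarrow> 0"
    and K: "\<And>m. real (K m) * h m \<le> a" "(\<lambda>m. real (K m) * h m) \<longlonglongrightarrow> a"
    and N: "\<And>m. real (K m + N m) * h m \<le> b" "(\<lambda>m. real (K m + N m) * h m) \<longlonglongrightarrow> b"
begin

lemma grid_drift_left_end:
  "(\<lambda>m. x (real (K m) * h m) + e * (real (K m) * h m)) \<longlonglongrightarrow> x a + e * a"
  by (intro tendsto_add tendsto_mult tendsto_const K cadlag_tendsto_from_left[where x=x] x ab cont)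
    (simp add: h(1) less_imp_le)

lemma grid_drift_right_end:
  "(\<lambda>m. x (real (K m + N m) * h m) + e * (real (K m + N m) * h m)) \<longlonglongrightarrow> x b + e * b"
proof -
  have "0 \<le> b" using ab by simp
  then show ?thesis
    by (intro tendsto_add tendsto_mult tendsto_const N cadlag_tendsto_from_left[where x=x] x cont)
      (simp_all add: h(1) less_imp_le)
qed

lemma walk_grid_tendsto:
  "(\<lambda>m. walk (\<lambda>j. grid_steps e (h m) x (K m + j)) (N m)) \<longlonglongrightarrow> x b - x a + e * (b - a)"
proof -
  have "x b - x a + e * (b - a) = (x b + e * b) - (x a + e * a)" by (simp add: algebra_simps)
  then show ?thesis unfolding walk_grid_steps
    using tendsto_diff[OF grid_drift_right_end[of e] grid_drift_left_end[of e]] by (simp only:)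
qed

lemma walk_max_grid_tendsto:
  "(\<lambda>m. walk_max (\<lambda>j. grid_steps e (h m) x (K m + j)) (N m))
     \<longlonglongrightarrow> running_sup (\<lambda>s. x (a + s) - x a + e * s) (b - a)"
  unfolding walk_max_grid running_sup_restart[OF x ab(1) less_imp_le[OF ab(2)]]
proof (rule tendsto_diff[OF grid_max_tendsto[where x="\<lambda>s. x s + e * s", OF cadlag_drift[OF x] ab _ _ h K N] grid_drift_left_end])
  show "left_lim (\<lambda>s. x s + e * s) a = x a + e * a" "left_lim (\<lambda>s. x s + e * s) b = x b + e * b"
    using ab cont by (simp_all add: left_lim_drift x)
qed

lemma walk_min_grid_tendsto:
  "(\<lambda>m. walk_min (\<lambda>j. grid_steps e (h m) x (K m + j)) (N m))
     \<longlonglongrightarrow> running_inf (\<lambda>s. x (a + s) - x a + e * s) (b - a)"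
proof -
  have "(\<lambda>s. - (x (a + s) - x a + e * s)) = (\<lambda>s. (- x (a + s)) - (- x a) + (- e) * s)"
    by (simp add: fun_eq_iff)
  then have "running_inf (\<lambda>s. x (a + s) - x a + e * s) (b - a) =
    - running_sup (\<lambda>s. (- x (a + s)) - (- x a) + (- e) * s) (b - a)"
    by (simp only: running_inf_eq_sup)
  also have "\<dots> = - ((SUP s\<in>{a..b}. - x s + (- e) * s)) - (x a + e * a)"
    using running_sup_restart[OF cadlag_uminus[OF x] ab(1) less_imp_le[OF ab(2)], of "- e"] by simp
  finally have r: "running_inf (\<lambda>s. x (a + s) - x a + e * s) (b - a) = - ((SUP s\<in>{a..b}. - x s + (- e) * s)) - (x a + e * a)" .
  show ?thesis unfolding walk_min_grid r
  proof (rule tendsto_diff[OF tendsto_minus[OF grid_max_tendsto[where x="\<lambda>s. - x s + (- e) * s",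
          OF cadlag_drift[OF cadlag_uminus[OF x]] ab _ _ h K N]] grid_drift_left_end])
    show "left_lim (\<lambda>s. - x s + (- e) * s) a = - x a + (- e) * a" "left_lim (\<lambda>s. - x s + (- e) * s) b = - x b + (- e) * b"
      using ab cont by (simp_all only: left_lim_drift[OF cadlag_uminus[OF x]] left_lim_uminus[OF x]
          order_trans[OF ab(1) less_imp_le[OF ab(2)]])
  qed
qed

end

text \<open>  For measurability at random times: right continuity reduces the supremum to countably many arguments, which
  are rational multiples of \<open>t\<close> so that the end point is among them.\<close>

lemma running_sup_le_iff:
  assumes x: "cadlag x" and t: "0 \<le> t"
  shows "running_sup x t \<le> c \<longleftrightarrow> (\<forall>q\<in>\<rat> \<inter> {0..1}. x (q * t) \<le> c)"
proof
  assume c: "running_sup x t \<le> c"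
  show "\<forall>q\<in>\<rat> \<inter> {0..1}. x (q * t) \<le> c"
  proof
    fix q :: real assume "q \<in> \<rat> \<inter> {0..1}"
    then have "q * t \<in> {0..t}" using t by (auto intro: mult_left_le_one_le)
    with c show "x (q * t) \<le> c" using running_sup_upper[OF x] order_trans by blast
  qed
next
  assume q: "\<forall>q\<in>\<rat> \<inter> {0..1}. x (q * t) \<le> c"
  show "running_sup x t \<le> c" unfolding running_sup_def
  proof (rule cSUP_least)
    fix s assume s: "s \<in> {0..t}"
    show "x s \<le> c"
    proof (cases "s = t")
      case True then show ?thesis using q by (auto dest!: bspec[of _ _ 1])
    next
      case False
      then have st: "0 \<le> s" "s < t" using s by auto
      show ?thesis
      proof (rule ccontr)
        assume "\<not> x s \<le> c"
        then have "\<forall>\<^sub>F r in at_right s. c < x r" using order_tendstoD(1)[OF cadlag_right[OF x st(1)], of c] by simp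
        then obtain d where d: "s < d" "\<And>r. s < r \<Longrightarrow> r < d \<Longrightarrow> c < x r"
          unfolding eventually_at_right_field by auto
        have "s / t < min d t / t" using d st by (intro divide_strict_right_mono) auto
        then obtain p where p: "p \<in> \<rat>" "s / t < p" "p < min d t / t" using Rats_dense_in_real by blast
        then have "s < p * t" "p * t < d" "p * t < t" using st by (auto simp: field_simps)
        moreover have "0 \<le> p" using p st by (meson divide_nonneg_nonneg le_less_trans less_imp_le t)
        moreover have "p \<le> 1" using \<open>p * t < t\<close> st by simp
        ultimately show False using d(2)[of "p * t"] q p by force
      qed
    qed
  qed (use t in auto)
qed

text \<open>  The random time is approximated from the right by times with countably many values.\<close>

lemma measurable_eval_cadlag:
  fixes Y :: "real \<Rightarrow> 'a \<Rightarrow> real"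
  assumes Y: "\<And>t. 0 \<le> t \<Longrightarrow> Y t \<in> borel_measurable M" "\<And>\<omega>. \<omega> \<in> space M \<Longrightarrow> cadlag (\<lambda>t. Y t \<omega>)"
    and \<tau> [measurable]: "\<tau> \<in> borel_measurable M" and \<tau>0: "\<And>\<omega>. \<omega> \<in> space M \<Longrightarrow> 0 \<le> \<tau> \<omega>"
  shows "(\<lambda>\<omega>. Y (\<tau> \<omega>) \<omega>) \<in> borel_measurable M"
proof (rule borel_measurable_LIMSEQ_real)
  let ?j = "\<lambda>m \<omega>. nat \<lfloor>\<tau> \<omega> * real (Suc m)\<rfloor>"
  show "(\<lambda>\<omega>. Y ((real (?j m \<omega>) + 1) / real (Suc m)) \<omega>) \<in> borel_measurable M" for m
    by (rule measurable_compose_countable[where f="\<lambda>i \<omega>. Y ((real i + 1) / real (Suc m)) \<omega>"]) (auto intro!: Y)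
  fix \<omega> assume \<omega>: "\<omega> \<in> space M"
  let ?s = "\<lambda>m. (real (?j m \<omega>) + 1) / real (Suc m)"
  have s: "\<tau> \<omega> < ?s m" "?s m \<le> \<tau> \<omega> + 1 / real (Suc m)" for m
  proof -
    have "0 \<le> \<tau> \<omega> * real (Suc m)" using \<tau>0[OF \<omega>] by simp
    then have "real (?j m \<omega>) = of_int \<lfloor>\<tau> \<omega> * real (Suc m)\<rfloor>" by simp
    then have "\<tau> \<omega> * real (Suc m) < real (?j m \<omega>) + 1" "real (?j m \<omega>) + 1 \<le> \<tau> \<omega> * real (Suc m) + 1" by linarith+
    then have "\<tau> \<omega> < ?s m" "?s m \<le> (\<tau> \<omega> * real (Suc m) + 1) / real (Suc m)"
      by (simp_all only: pos_less_divide_eq of_nat_0_less_iff zero_less_Suc divide_right_mono of_nat_0_le_iff)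
    then show "\<tau> \<omega> < ?s m" "?s m \<le> \<tau> \<omega> + 1 / real (Suc m)"
      by (simp_all add: add_divide_distrib del: of_nat_Suc)
  qed
  have "?s \<longlonglongrightarrow> \<tau> \<omega>"
  proof (rule tendsto_sandwich[where f="\<lambda>_. \<tau> \<omega>" and h="\<lambda>m. \<tau> \<omega> + 1 / real (Suc m)"])
    show "(\<lambda>m. \<tau> \<omega> + 1 / real (Suc m)) \<longlonglongrightarrow> \<tau> \<omega>"
      using tendsto_add[OF tendsto_const LIMSEQ_Suc[OF lim_const_over_n[of 1]], of "\<tau> \<omega>"] by simp
  qed (intro always_eventually allI s less_imp_le[OF s(1)] tendsto_const)+
  then have "filterlim ?s (at_right (\<tau> \<omega>)) sequentially"
    using s(1) by (auto simp: filterlim_at intro!: always_eventually) (metis less_irrefl)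
  from filterlim_compose[OF cadlag_right[OF Y(2)[OF \<omega>] \<tau>0[OF \<omega>]] this]
  show "(\<lambda>m. Y (?s m) \<omega>) \<longlonglongrightarrow> Y (\<tau> \<omega>) \<omega>" .
qed

lemma measurable_running_sup:
  fixes Y :: "real \<Rightarrow> 'a \<Rightarrow> real"
  assumes Y: "\<And>t. 0 \<le> t \<Longrightarrow> Y t \<in> borel_measurable M" "\<And>\<omega>. \<omega> \<in> space M \<Longrightarrow> cadlag (\<lambda>t. Y t \<omega>)"
    and \<tau> [measurable]: "\<tau> \<in> borel_measurable M" and \<tau>0: "\<And>\<omega>. \<omega> \<in> space M \<Longrightarrow> 0 \<le> \<tau> \<omega>"
  shows "(\<lambda>\<omega>. running_sup (\<lambda>t. Y t \<omega>) (\<tau> \<omega>)) \<in> borel_measurable M"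
  unfolding borel_measurable_iff_le
proof
  fix c
  have ev: "(\<lambda>\<omega>. Y (q * \<tau> \<omega>) \<omega>) \<in> borel_measurable M" if "q \<in> \<rat> \<inter> {0..1}" for q
    using that \<tau>0 by (intro measurable_eval_cadlag[where Y=Y and \<tau>="\<lambda>\<omega>. q * \<tau> \<omega>"] Y) auto
  have "{\<omega> \<in> space M. running_sup (\<lambda>t. Y t \<omega>) (\<tau> \<omega>) \<le> c} = 
    {\<omega> \<in> space M. \<forall>q\<in>\<rat> \<inter> {0..1}. Y (q * \<tau> \<omega>) \<omega> \<le> c}"
    using running_sup_le_iff[OF Y(2) \<tau>0] by auto
  also have "\<dots> \<in> sets M"
    by (intro sets.sets_Collect_countable_All' borel_measurable_le ev borel_measurable_const countable_Int1 countable_rat)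
  finally show "{\<omega> \<in> space M. running_sup (\<lambda>t. Y t \<omega>) (\<tau> \<omega>) \<le> c} \<in> sets M" .
qed

context
  fixes Y :: "real \<Rightarrow> 'a \<Rightarrow> real" and M :: "'a measure" and \<tau> :: "'a \<Rightarrow> real"
  assumes Y: "\<And>t. 0 \<le> t \<Longrightarrow> Y t \<in> borel_measurable M" "\<And>\<omega>. \<omega> \<in> space M \<Longrightarrow> cadlag (\<lambda>t. Y t \<omega>)"
    and \<tau>: "\<tau> \<in> borel_measurable M" and \<tau>0: "\<And>\<omega>. \<omega> \<in> space M \<Longrightarrow> 0 \<le> \<tau> \<omega>"
begin

lemma measurable_running_sup_drift:
  "(\<lambda>\<omega>. running_sup (\<lambda>t. Y t \<omega> + e * t) (\<tau> \<omega>)) \<in> borel_measurable M"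
  using Y by (intro measurable_running_sup cadlag_drift \<tau> \<tau>0) auto

lemma measurable_running_inf_drift:
  "(\<lambda>\<omega>. running_inf (\<lambda>t. Y t \<omega> + e * t) (\<tau> \<omega>)) \<in> borel_measurable M"
  unfolding running_inf_eq_sup
  using Y by (intro borel_measurable_uminus measurable_running_sup cadlag_uminus cadlag_drift \<tau> \<tau>0) auto

lemma measurable_last_sup_time:
  "(\<lambda>\<omega>. last_sup_time (\<lambda>t. Y t \<omega>) (\<tau> \<omega>)) \<in> borel_measurable M"
proof (rule borel_measurable_LIMSEQ_real)
  have e: "(\<lambda>n. 1 / real (Suc n)) \<longlonglongrightarrow> 0" by (rule LIMSEQ_Suc[OF lim_const_over_n])
  show "(\<lambda>n. (running_sup (\<lambda>t. Y t \<omega> + 1 / real (Suc n) * t) (\<tau> \<omega>) - running_sup (\<lambda>t. Y t \<omega>) (\<tau> \<omega>)) / (1 / real (Suc n)))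
    \<longlonglongrightarrow> last_sup_time (\<lambda>t. Y t \<omega>) (\<tau> \<omega>)" if "\<omega> \<in> space M" for \<omega>
    using that by (intro last_sup_time_derivative Y \<tau>0 e) auto
  show "(\<lambda>\<omega>. (running_sup (\<lambda>t. Y t \<omega> + 1 / real (Suc n) * t) (\<tau> \<omega>) - running_sup (\<lambda>t. Y t \<omega>) (\<tau> \<omega>)) / (1 / real (Suc n)))
    \<in> borel_measurable M" for n
    using measurable_running_sup_drift[of 0]
    by (intro borel_measurable_divide borel_measurable_diff measurable_running_sup_drift) auto
qed

lemma measurable_first_inf_time:
  "(\<lambda>\<omega>. first_inf_time (\<lambda>t. Y t \<omega>) (\<tau> \<omega>)) \<in> borel_measurable M"
proof (rule borel_measurable_LIMSEQ_real)
  have e: "(\<lambda>n. 1 / real (Suc n)) \<longlonglongrightarrow> 0" by (rule LIMSEQ_Suc[OF lim_const_over_n])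
  show "(\<lambda>n. (running_inf (\<lambda>t. Y t \<omega> + 1 / real (Suc n) * t) (\<tau> \<omega>) - running_inf (\<lambda>t. Y t \<omega>) (\<tau> \<omega>)) / (1 / real (Suc n)))
    \<longlonglongrightarrow> first_inf_time (\<lambda>t. Y t \<omega>) (\<tau> \<omega>)" if "\<omega> \<in> space M" for \<omega>
    using that by (intro first_inf_time_derivative Y \<tau>0 e) auto
  show "(\<lambda>\<omega>. (running_inf (\<lambda>t. Y t \<omega> + 1 / real (Suc n) * t) (\<tau> \<omega>) - running_inf (\<lambda>t. Y t \<omega>) (\<tau> \<omega>)) / (1 / real (Suc n)))
    \<in> borel_measurable M" for n
    using measurable_running_inf_drift[of 0]
    by (intro borel_measurable_divide borel_measurable_diff measurable_running_inf_drift) auto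
qed

end

section \<open>Independence of the segments of a walk\<close>

text \<open>  A version of independence of disjoint blocks of coordinates for functionals that are defined on all
  coordinates but depend on one block only.\<close>

lemma (in prob_space) nn_integral_indep_split:
  fixes Y :: "'i \<Rightarrow> 'a \<Rightarrow> 'b"
  assumes Y: "indep_vars (\<lambda>_. N) Y UNIV" and d: "d \<in> space N" and J: "J1 \<inter> J2 = {}"
    and G: "G1 \<in> borel_measurable (\<Pi>\<^sub>M i\<in>UNIV. N)" "G2 \<in> borel_measurable (\<Pi>\<^sub>M i\<in>UNIV. N)"
    and J1: "\<And>y y'. (\<And>i. i \<in> J1 \<Longrightarrow> y i = y' i) \<Longrightarrow> G1 y = G1 y'"
    and J2: "\<And>y y'. (\<And>i. i \<in> J2 \<Longrightarrow> y i = y' i) \<Longrightarrow> G2 y = G2 y'"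
  shows "(\<integral>\<^sup>+\<omega>. G1 (\<lambda>i. Y i \<omega>) * G2 (\<lambda>i. Y i \<omega>) \<partial>M) =
    (\<integral>\<^sup>+\<omega>. G1 (\<lambda>i. Y i \<omega>) \<partial>M) * (\<integral>\<^sup>+\<omega>. G2 (\<lambda>i. Y i \<omega>) \<partial>M)"
proof -
  let ?e = "\<lambda>J y i. if i \<in> J then y i else d"
  have e: "?e J \<in> (\<Pi>\<^sub>M i\<in>J. N) \<rightarrow>\<^sub>M (\<Pi>\<^sub>M i\<in>UNIV. N)" for J :: "'i set"
  proof (rule measurable_PiM_single')
    show "(\<lambda>y. if i \<in> J then y i else d) \<in> (\<Pi>\<^sub>M i\<in>J. N) \<rightarrow>\<^sub>M N" for i
      using d by (cases "i \<in> J") auto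
  qed (use d in \<open>auto simp: space_PiM\<close>)
  have r: "(G \<circ> ?e J) (\<lambda>i\<in>J. Y i \<omega>) = G (\<lambda>i. Y i \<omega>)"
    if "\<And>y y'. (\<And>i. i \<in> J \<Longrightarrow> y i = y' i) \<Longrightarrow> G y = G y'" for G :: "('i \<Rightarrow> 'b) \<Rightarrow> ennreal" and J \<omega>
    unfolding comp_def by (rule that) simp
  have "indep_var (\<Pi>\<^sub>M i\<in>J1. N) (\<lambda>\<omega>. \<lambda>i\<in>J1. Y i \<omega>) (\<Pi>\<^sub>M i\<in>J2. N) (\<lambda>\<omega>. \<lambda>i\<in>J2. Y i \<omega>)"
    using indep_var_restrict[OF Y J] by simp
  from indep_var_compose[OF this measurable_comp[OF e G(1)] measurable_comp[OF e G(2)]]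
  have "indep_var borel (\<lambda>\<omega>. G1 (\<lambda>i. Y i \<omega>)) borel (\<lambda>\<omega>. G2 (\<lambda>i. Y i \<omega>))"
    using r[of J1 G1, OF J1] r[of J2 G2, OF J2] by (simp add: comp_def)
  then have "indep_vars (\<lambda>_. borel) (case_bool (\<lambda>\<omega>. G1 (\<lambda>i. Y i \<omega>)) (\<lambda>\<omega>. G2 (\<lambda>i. Y i \<omega>))) UNIV"
    unfolding indep_var_def by (rule indep_vars_cong[THEN iffD1, rotated -1]) (auto split: bool.split)
  from indep_vars_nn_integral[OF _ this] show ?thesis by (simp add: UNIV_bool ac_simps)
qed

text \<open>The steps \<open>\<zeta>\<close> are cut into consecutive segments, the \<open>i\<close>-th of which has length \<open>\<nu> (g i)\<close>. The
  lengths are kept as functions of real variables so that all variables take values in one type, as joint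
  independence requires.\<close>

locale cut_walk = prob_space M for M :: "'a measure" +
  fixes \<zeta> g :: "nat \<Rightarrow> 'a \<Rightarrow> real" and \<nu> :: "real \<Rightarrow> nat" and \<rho> :: "real measure" and p q :: ennreal
  assumes indep: "indep_vars (\<lambda>_. borel) (case_sum \<zeta> g) UNIV"
    and step_law: "\<And>j. distr M borel (\<zeta> j) = \<rho>"
    and \<nu> [measurable]: "\<nu> \<in> borel \<rightarrow>\<^sub>M count_space UNIV"
    and geometric: "\<And>i n. emeasure M {\<omega> \<in> space M. \<nu> (g i \<omega>) = n} = p * q ^ n"
begin

lemma rv [measurable]: "\<zeta> j \<in> borel_measurable M" "g j \<in> borel_measurable M"
proof -
  have "\<forall>i\<in>UNIV. random_variable borel (case_sum \<zeta> g i)" using indep unfolding indep_vars_def by blast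
  from bspec[OF this, of "Inl j"] bspec[OF this, of "Inr j"]
  show "\<zeta> j \<in> borel_measurable M" "g j \<in> borel_measurable M" by simp_all
qed

sublocale W: random_walk \<rho>
proof -
  interpret R: prob_space \<rho> unfolding step_law[of 0, symmetric] by (rule prob_space_distr) simp
  show "random_walk \<rho>" by unfold_locales (simp add: step_law[of 0, symmetric])
qed


lemma Y_rv [measurable]: "case_sum \<zeta> g s \<in> borel_measurable M"
  by (cases s) (simp_all add: rv)

lemma steps_law: "distr M W.S (\<lambda>\<omega> j. \<zeta> (m + j) \<omega>) = W.S"
proof -
  let ?f = "\<lambda>j. Inl (m + j) :: nat + nat"
  have "indep_vars (\<lambda>j. \<Pi>\<^sub>M i\<in>{?f j}. borel) (\<lambda>j \<omega>. \<lambda>i\<in>{?f j}. case_sum \<zeta> g i \<omega>) UNIV"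
    by (rule indep_vars_restrict[OF indep]) (auto simp: disjoint_family_on_def)
  then have "indep_vars (\<lambda>j. borel) (\<lambda>j \<omega>. (\<lambda>i\<in>{?f j}. case_sum \<zeta> g i \<omega>) (?f j)) UNIV"
    by (rule indep_vars_compose2) (auto intro!: measurable_component_singleton)
  then have "indep_vars (\<lambda>j. borel) (\<lambda>j. \<zeta> (m + j)) UNIV" by simp
  then have "distr M (\<Pi>\<^sub>M j\<in>UNIV. borel) (\<lambda>\<omega>. \<lambda>j\<in>UNIV. \<zeta> (m + j) \<omega>) = (\<Pi>\<^sub>M j\<in>UNIV. distr M borel (\<zeta> (m + j)))"
    by (subst (asm) indep_vars_iff_distr_eq_PiM) auto
  moreover have "distr M W.S (\<lambda>\<omega> j. \<zeta> (m + j) \<omega>) =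
      distr M (\<Pi>\<^sub>M j\<in>UNIV. borel) (\<lambda>\<omega>. \<lambda>j\<in>UNIV. \<zeta> (m + j) \<omega>)"
    by (rule distr_cong) (auto intro!: sets_PiM_cong)
  ultimately show ?thesis by (simp only: step_law)
qed

definition len :: "(nat + nat \<Rightarrow> real) \<Rightarrow> nat \<Rightarrow> nat" where
  "len y i = \<nu> (y (Inr i))"

definition pos :: "(nat + nat \<Rightarrow> real) \<Rightarrow> nat \<Rightarrow> nat" where
  "pos y i = (\<Sum>j<i. len y j)"

abbreviation "PY \<equiv> \<Pi>\<^sub>M i\<in>(UNIV::(nat + nat) set). (borel :: real measure)"

lemma measurable_len [measurable]: "(\<lambda>y. len y i) \<in> PY \<rightarrow>\<^sub>M count_space UNIV"
  unfolding len_def by measurable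

lemma measurable_pos [measurable]: "(\<lambda>y. pos y i) \<in> PY \<rightarrow>\<^sub>M count_space UNIV"
  unfolding pos_def by measurable

lemma measurable_steps_from: "(\<lambda>y j. y (Inl (c + j))) \<in> PY \<rightarrow>\<^sub>M W.S"
proof (rule measurable_PiM_single')
  show "(\<lambda>y. y (Inl (c + j))) \<in> PY \<rightarrow>\<^sub>M \<rho>" for j by (simp cong: measurable_cong_sets)
next
  have "space \<rho> = UNIV" using sets_eq_imp_space_eq[OF W.sets_step] by simp
  then show "(\<lambda>y j. y (Inl (c + j))) \<in> space PY \<rightarrow> UNIV \<rightarrow>\<^sub>E space \<rho>" by auto
qed

lemma measurable_segment:
  assumes F: "\<And>n. F n \<in> W.S \<rightarrow>\<^sub>M R"
  shows "(\<lambda>y. F (len y i) (\<lambda>j. y (Inl (pos y i + j)))) \<in> PY \<rightarrow>\<^sub>M R"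
proof -
  note [measurable] = F measurable_steps_from
  have "(\<lambda>y. F n (\<lambda>j. y (Inl (pos y i + j)))) \<in> PY \<rightarrow>\<^sub>M R" for n
    by (rule measurable_compose_countable[where f="\<lambda>c y. F n (\<lambda>j. y (Inl (c + j)))" and g="\<lambda>y. pos y i"]) measurable
  then show ?thesis
    by (rule measurable_compose_countable[where f="\<lambda>n y. F n (\<lambda>j. y (Inl (pos y i + j)))" and g="\<lambda>y. len y i"]) measurable
qed

abbreviation sample :: "'a \<Rightarrow> nat + nat \<Rightarrow> real" where
  "sample \<omega> \<equiv> \<lambda>s. case_sum \<zeta> g s \<omega>"

lemma measurable_sample [measurable]: "sample \<in> M \<rightarrow>\<^sub>M PY"
  by (rule measurable_PiM_single') auto

lemma nn_integral_one_segment: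
  assumes F [measurable]: "\<And>n. F n \<in> borel_measurable W.S"
  shows "(\<integral>\<^sup>+\<omega>. of_bool (len (sample \<omega>) i = n) * F n (\<lambda>j. \<zeta> (m + j) \<omega>) \<partial>M) = p * q ^ n * (\<integral>\<^sup>+z. F n z \<partial>W.S)"
proof -
  note [measurable] = measurable_steps_from[of m]
  have z: "(\<lambda>\<omega> j. \<zeta> (m + j) \<omega>) \<in> M \<rightarrow>\<^sub>M W.S" 
    using measurable_compose[OF measurable_sample, of "\<lambda>y j. y (Inl (m + j))" W.S] by simp
  have "(\<integral>\<^sup>+\<omega>. of_bool (len (sample \<omega>) i = n) * F n (\<lambda>j. sample \<omega> (Inl (m + j))) \<partial>M) =
    (\<integral>\<^sup>+\<omega>. of_bool (len (sample \<omega>) i = n) \<partial>M) * (\<integral>\<^sup>+\<omega>. F n (\<lambda>j. sample \<omega> (Inl (m + j))) \<partial>M)"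
  proof (rule nn_integral_indep_split[OF indep, of 0, where ?J1.0="{Inr i}" and ?J2.0="range Inl"])
    show "(\<lambda>y. of_bool (len y i = n)) \<in> borel_measurable PY" by measurable
    show "(\<lambda>y. F n (\<lambda>j. y (Inl (m + j)))) \<in> borel_measurable PY" by measurable
  qed (auto simp: len_def)
  also have "(\<integral>\<^sup>+\<omega>. of_bool (len (sample \<omega>) i = n) \<partial>M) = (\<integral>\<^sup>+\<omega>. indicator {\<omega> \<in> space M. \<nu> (g i \<omega>) = n} \<omega> \<partial>M)"
    by (intro nn_integral_cong) (auto simp: len_def)
  also have "\<dots> = p * q ^ n" by (subst nn_integral_indicator) (auto simp: geometric)
  also have "(\<integral>\<^sup>+\<omega>. F n (\<lambda>j. sample \<omega> (Inl (m + j))) \<partial>M) = (\<integral>\<^sup>+z. F n z \<partial>distr M W.S (\<lambda>\<omega> j. \<zeta> (m + j) \<omega>))"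
    by (subst nn_integral_distr) (use z in auto)
  also have "\<dots> = (\<integral>\<^sup>+z. F n z \<partial>W.S)" by (simp only: steps_law)
  finally show ?thesis by simp
qed

text \<open>  On the event that the first \<open>n\<close> segments consume \<open>m\<close> steps, they depend on the first \<open>m\<close> steps and
  on the first \<open>n\<close> lengths only, while the next segment is built from later steps and the next length. Summing over \<open>m\<close>
  separates the last segment, whose law does not depend on \<open>m\<close>.\<close>

theorem nn_integral_segments:
  assumes F: "\<And>i n. F i n \<in> borel_measurable W.S"
    and dep: "\<And>i n z z'. (\<And>j. j < n \<Longrightarrow> z j = z' j) \<Longrightarrow> F i n z = F i n z'"
  shows "(\<integral>\<^sup>+\<omega>. (\<Prod>i<n. F i (len (sample \<omega>) i) (\<lambda>j. \<zeta> (pos (sample \<omega>) i + j) \<omega>)) \<partial>M) =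
    (\<Prod>i<n. W.geo p q (F i))"
proof (induction n)
  case 0
  then show ?case by (simp add: emeasure_space_1)
next
  case (Suc n)
  define H where "H y = (\<Prod>i<n. F i (len y i) (\<lambda>j. y (Inl (pos y i + j))))" for y
  have H [measurable]: "H \<in> borel_measurable PY"
    unfolding H_def by (intro borel_measurable_prod_ennreal measurable_segment F)
  note [measurable] = F
  have pos_n: "pos y i + len y i \<le> pos y n" if "i < n" for y i
  proof -
    have "pos y i + len y i = pos y (Suc i)" by (simp add: pos_def)
    also have "\<dots> \<le> pos y n" unfolding pos_def using that by (intro sum_mono2) auto
    finally show ?thesis .
  qed
  have H_dep: "of_bool (pos y n = m) * H y = of_bool (pos y' n = m) * H y'"
    if y: "\<And>s. s \<in> Inl ` {..<m} \<union> Inr ` {..<n} \<Longrightarrow> y s = y' s" for y y' m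
  proof -
    have len: "len y i = len y' i" if "i < n" for i using y[of "Inr i"] that by (simp add: len_def)
    have pos: "pos y i = pos y' i" if "i \<le> n" for i unfolding pos_def using len that by (intro sum.cong) auto
    have "H y = H y'" if m: "pos y n = m"
      unfolding H_def
    proof (rule prod.cong[OF refl])
      fix i assume "i \<in> {..<n}"
      then have i: "i < n" by simp
      have "F i (len y i) (\<lambda>j. y (Inl (pos y i + j))) = F i (len y i) (\<lambda>j. y' (Inl (pos y' i + j)))"
      proof (rule dep)
        fix j assume "j < len y i"
        then have "pos y' i + j < m" using pos_n[OF i, of y] m pos[of i] i by simp
        then show "y (Inl (pos y i + j)) = y' (Inl (pos y' i + j))" using y pos[of i] i by simp
      qed
      then show "F i (len y i) (\<lambda>j. y (Inl (pos y i + j))) = F i (len y' i) (\<lambda>j. y' (Inl (pos y' i + j)))"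
        using len[OF i] by simp
    qed
    then show ?thesis using pos[of n] by auto
  qed
  have seg_meas: "(\<lambda>y. F n l (\<lambda>j. y (Inl (m + j)))) \<in> borel_measurable PY" for l m
    using measurable_compose[OF measurable_steps_from F] .
  let ?Y = sample
  let ?H = "\<lambda>m \<omega>. of_bool (pos (sample \<omega>) n = m) * H (sample \<omega>)"
  let ?S = "\<lambda>m l \<omega>. of_bool (len (sample \<omega>) n = l) * F n l (\<lambda>j. sample \<omega> (Inl (m + j)))"
  have one: "(\<integral>\<^sup>+\<omega>. ?H m \<omega> * ?S m l \<omega> \<partial>M) =
    (\<integral>\<^sup>+\<omega>. ?H m \<omega> \<partial>M) * (p * q ^ l * (\<integral>\<^sup>+z. F n l z \<partial>W.S))" for m l
  proof -
    have "(\<integral>\<^sup>+\<omega>. ?H m \<omega> *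
        ?S m l \<omega> \<partial>M) =
      (\<integral>\<^sup>+\<omega>. ?H m \<omega> \<partial>M) *
      (\<integral>\<^sup>+\<omega>. ?S m l \<omega> \<partial>M)"
    proof (rule nn_integral_indep_split[OF indep, of 0, where ?J1.0="Inl ` {..<m} \<union> Inr ` {..<n}" and ?J2.0="Inl ` {m..} \<union> {Inr n}"
          and ?G1.0="\<lambda>y. of_bool (pos y n = m) * H y" and ?G2.0="\<lambda>y. of_bool (len y n = l) * F n l (\<lambda>j. y (Inl (m + j)))"])
      show "(\<lambda>y. of_bool (pos y n = m) * H y) \<in> borel_measurable PY" by measurable
      show "(\<lambda>y. of_bool (len y n = l) * F n l (\<lambda>j. y (Inl (m + j)))) \<in> borel_measurable PY"
        by (intro borel_measurable_times_ennreal seg_meas) measurable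
      show "of_bool (len y n = l) * F n l (\<lambda>j. y (Inl (m + j))) = of_bool (len y' n = l) * F n l (\<lambda>j. y' (Inl (m + j)))"
        if "\<And>i. i \<in> Inl ` {m..} \<union> {Inr n} \<Longrightarrow> y i = y' i" for y y'
        using that by (simp add: len_def)
      show "of_bool (pos y n = m) * H y = of_bool (pos y' n = m) * H y'"
        if "\<And>s. s \<in> Inl ` {..<m} \<union> Inr ` {..<n} \<Longrightarrow> y s = y' s" for y y' by (rule H_dep) (rule that)
      show "(Inl ` {..<m} \<union> Inr ` {..<n}) \<inter> (Inl ` {m..} \<union> {Inr n}) = {}" by auto
    qed simp
    then show ?thesis using nn_integral_one_segment[where F="F n", OF F, of n l m] by simp
  qed
  have "(\<integral>\<^sup>+\<omega>. (\<Prod>i<Suc n. F i (len (?Y \<omega>) i) (\<lambda>j. ?Y \<omega> (Inl (pos (?Y \<omega>) i + j)))) \<partial>M) =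
    (\<integral>\<^sup>+\<omega>. (\<Sum>m. \<Sum>l. ?H m \<omega> * ?S m l \<omega>) \<partial>M)"
  proof (rule nn_integral_cong)
    fix \<omega>
    have "(\<Sum>l. ?H m \<omega> * ?S m l \<omega>) =
      ?H m \<omega> * F n (len (?Y \<omega>) n) (\<lambda>j. ?Y \<omega> (Inl (m + j)))" for m
      by (subst suminf_finite[of "{len (?Y \<omega>) n}"]) auto
    moreover have "(\<Sum>m. ?H m \<omega> * F n (len (?Y \<omega>) n) (\<lambda>j. ?Y \<omega> (Inl (m + j)))) =
      H (?Y \<omega>) * F n (len (?Y \<omega>) n) (\<lambda>j. ?Y \<omega> (Inl (pos (?Y \<omega>) n + j)))"
      by (subst suminf_finite[of "{pos (?Y \<omega>) n}"]) auto
    ultimately show "(\<Prod>i<Suc n. F i (len (?Y \<omega>) i) (\<lambda>j. ?Y \<omega> (Inl (pos (?Y \<omega>) i + j)))) =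
      (\<Sum>m. \<Sum>l. ?H m \<omega> * ?S m l \<omega>)"
      by (simp add: H_def)
  qed
  also have "\<dots> = (\<Sum>m. \<Sum>l. \<integral>\<^sup>+\<omega>. ?H m \<omega> * ?S m l \<omega> \<partial>M)"
  proof -
    have meas: "(\<lambda>\<omega>. ?H m \<omega> * ?S m l \<omega>) \<in> borel_measurable M" for m l
    proof -
      have "(\<lambda>y. of_bool (pos y n = m) * H y * (of_bool (len y n = l) * F n l (\<lambda>j. y (Inl (m + j))))) \<in> borel_measurable PY"
        by (intro borel_measurable_times_ennreal seg_meas) measurable
      from measurable_compose[OF measurable_sample this] show ?thesis .
    qed
    have "(\<integral>\<^sup>+\<omega>. (\<Sum>m. \<Sum>l. ?H m \<omega> * ?S m l \<omega>) \<partial>M) = (\<Sum>m. \<integral>\<^sup>+\<omega>. (\<Sum>l. ?H m \<omega> * ?S m l \<omega>) \<partial>M)"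
      by (rule nn_integral_suminf) (rule borel_measurable_suminf_order[OF meas])
    also have "\<dots> = (\<Sum>m. \<Sum>l. \<integral>\<^sup>+\<omega>. ?H m \<omega> * ?S m l \<omega> \<partial>M)"
      by (rule suminf_cong) (rule nn_integral_suminf[OF meas])
    finally show ?thesis .
  qed
  also have "\<dots> = (\<Sum>m. \<integral>\<^sup>+\<omega>. ?H m \<omega> \<partial>M) * W.geo p q (F n)"
    unfolding one W.geo_def by (simp only: ennreal_suminf_cmult ennreal_suminf_multc)
  also have "(\<Sum>m. \<integral>\<^sup>+\<omega>. ?H m \<omega> \<partial>M) = (\<integral>\<^sup>+\<omega>. H (?Y \<omega>) \<partial>M)"
  proof -
    have "(\<Sum>m. ?H m \<omega>) = H (?Y \<omega>)" for \<omega>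
      by (subst suminf_finite[of "{pos (?Y \<omega>) n}"]) auto
    moreover have "(\<Sum>m. \<integral>\<^sup>+\<omega>. ?H m \<omega> \<partial>M) =
        (\<integral>\<^sup>+\<omega>. (\<Sum>m. ?H m \<omega>) \<partial>M)"
    proof (rule nn_integral_suminf[symmetric])
      fix m
      have "(\<lambda>y. of_bool (pos y n = m) * H y) \<in> borel_measurable PY" by measurable
      from measurable_compose[OF measurable_sample this]
      show "(\<lambda>\<omega>. ?H m \<omega>) \<in> borel_measurable M" .
    qed
    ultimately show ?thesis by simp
  qed
  also have "\<dots> = (\<Prod>i<n. W.geo p q (F i))"
    using Suc.IH by (simp add: H_def)
  finally show ?case by simp
qed

end

section \<open>The grid walk of a Levy process between the epochs\<close>

lemma (in prob_space) indep_vars_nat_if_initial: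
  fixes Y :: "nat \<Rightarrow> 'a \<Rightarrow> 'b"
  assumes "\<And>n. indep_vars N Y {..<n}"
  shows "indep_vars N Y UNIV"
  unfolding indep_vars_def2
proof (intro conjI ballI)
  show "random_variable (N j) (Y j)" for j
    using assms[of "Suc j"] unfolding indep_vars_def2 by blast
  show "indep_sets (\<lambda>j. {Y j -` A \<inter> space M |A. A \<in> sets (N j)}) UNIV"
  proof (subst indep_sets_finite_index_sets, intro allI impI)
    fix J :: "nat set" assume "finite J"
    then have "J \<subseteq> {..<Suc (Max J)}" by (auto simp: less_Suc_eq_le)
    from indep_vars_subset[OF assms this]
    show "indep_sets (\<lambda>j. {Y j -` A \<inter> space M |A. A \<in> sets (N j)}) J"
      unfolding indep_vars_def2 by blast
  qed
qed

lemma (in prob_space) indep_vars_case_sum: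
  fixes A :: "'i \<Rightarrow> 'a \<Rightarrow> 'b" and B :: "'j \<Rightarrow> 'a \<Rightarrow> 'b"
  assumes A: "indep_vars (\<lambda>_. N) A UNIV" "\<And>i. A i \<in> V1 \<rightarrow>\<^sub>M N"
    and B: "indep_vars (\<lambda>_. N) B UNIV" "\<And>i. B i \<in> V2 \<rightarrow>\<^sub>M N"
    and V: "space V1 = space M" "space V2 = space M" "indep_set (sets V1) (sets V2)"
  shows "indep_vars (\<lambda>_. N) (case_sum A B) UNIV"
  unfolding indep_vars_def2
proof (intro conjI ballI)
  have rA: "random_variable N (A i)" for i using A(1) unfolding indep_vars_def2 by blast
  have rB: "random_variable N (B i)" for i using B(1) unfolding indep_vars_def2 by blast
  show r: "random_variable N (case_sum A B s)" for s using rA rB by (cases s) auto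
  show "indep_sets (\<lambda>s. {case_sum A B s -` E \<inter> space M |E. E \<in> sets N}) UNIV"
  proof (rule indep_setsI)
    show "{case_sum A B s -` E \<inter> space M |E. E \<in> sets N} \<subseteq> events" for s
      using r[of s] by (auto intro: measurable_sets)
    fix F :: "'i + 'j \<Rightarrow> 'a set" and J assume J: "J \<noteq> {}" "finite J"
      and "\<forall>s\<in>J. F s \<in> {case_sum A B s -` E \<inter> space M |E. E \<in> sets N}"
    then have "\<forall>s\<in>J. \<exists>E. E \<in> sets N \<and> F s = case_sum A B s -` E \<inter> space M" by blast
    then obtain E where E: "\<And>s. s \<in> J \<Longrightarrow> E s \<in> sets N" "\<And>s. s \<in> J \<Longrightarrow> F s = case_sum A B s -` E s \<inter> space M" by metis
    define J1 where "J1 = Inl -` J"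
    define J2 where "J2 = Inr -` J"
    have fin: "finite J1" "finite J2" unfolding J1_def J2_def using J by (auto intro!: finite_vimageI)
    have J_eq: "J = Inl ` J1 \<union> Inr ` J2" unfolding J1_def J2_def
      by (auto simp: image_iff) (metis sum.exhaust)
    define P1 where "P1 = {\<omega> \<in> space M. \<forall>i\<in>J1. A i \<omega> \<in> E (Inl i)}"
    define P2 where "P2 = {\<omega> \<in> space M. \<forall>i\<in>J2. B i \<omega> \<in> E (Inr i)}"
    have P1_eq: "P1 = (\<Inter>i\<in>J1. A i -` E (Inl i) \<inter> space M)" if "J1 \<noteq> {}" unfolding P1_def using that by auto
    have P2_eq: "P2 = (\<Inter>i\<in>J2. B i -` E (Inr i) \<inter> space M)" if "J2 \<noteq> {}" unfolding P2_def using that by auto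
    have m1: "A i -` E (Inl i) \<inter> space M \<in> sets V1" if "i \<in> J1" for i
      using measurable_sets[OF A(2), of "E (Inl i)"] E that V(1) unfolding J1_def by auto
    have m2: "B i -` E (Inr i) \<inter> space M \<in> sets V2" if "i \<in> J2" for i
      using measurable_sets[OF B(2), of "E (Inr i)"] E that V(2) unfolding J2_def by auto
    have "P1 \<in> sets V1"
    proof (cases "J1 = {}")
      case True then show ?thesis using V(1) sets.top[of V1] by (simp add: P1_def)
    qed (unfold P1_eq, intro sets.finite_INT m1 fin)
    moreover have "P2 \<in> sets V2"
    proof (cases "J2 = {}")
      case True then show ?thesis using V(2) sets.top[of V2] by (simp add: P2_def)
    qed (unfold P2_eq, intro sets.finite_INT m2 fin)
    ultimately have "prob (P1 \<inter> P2) = prob P1 * prob P2" by (rule indep_setD[OF V(3)])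
    moreover have "prob P1 = (\<Prod>i\<in>J1. prob (F (Inl i)))"
    proof (cases "J1 = {}")
      case False
      then have "prob P1 = (\<Prod>i\<in>J1. prob (A i -` E (Inl i) \<inter> space M))"
        unfolding P1_eq[OF False] using E fin by (intro indep_varsD[OF A(1)]) (auto simp: J1_def)
      also have "\<dots> = (\<Prod>i\<in>J1. prob (F (Inl i)))" using E(2) by (intro prod.cong) (auto simp: J1_def)
      finally show ?thesis .
    qed (simp add: P1_def prob_space)
    moreover have "prob P2 = (\<Prod>i\<in>J2. prob (F (Inr i)))"
    proof (cases "J2 = {}")
      case False
      then have "prob P2 = (\<Prod>i\<in>J2. prob (B i -` E (Inr i) \<inter> space M))"
        unfolding P2_eq[OF False] using E fin by (intro indep_varsD[OF B(1)]) (auto simp: J2_def)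
      also have "\<dots> = (\<Prod>i\<in>J2. prob (F (Inr i)))" using E(2) by (intro prod.cong) (auto simp: J2_def)
      finally show ?thesis .
    qed (simp add: P2_def prob_space)
    moreover have "(\<Inter>s\<in>J. F s) = P1 \<inter> P2"
    proof -
      have "(\<Inter>s\<in>J. F s) = (\<Inter>s\<in>J. case_sum A B s -` E s \<inter> space M)" using E(2) by auto
      also have "\<dots> = {\<omega> \<in> space M. \<forall>s\<in>J. case_sum A B s \<omega> \<in> E s}" using J(1) by auto
      also have "\<dots> = P1 \<inter> P2" unfolding P1_def P2_def J_eq by (auto simp: ball_Un)
      finally show ?thesis .
    qed
    moreover have "(\<Prod>s\<in>J. prob (F s)) = (\<Prod>i\<in>J1. prob (F (Inl i))) * (\<Prod>i\<in>J2. prob (F (Inr i)))"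
      unfolding J_eq using fin by (subst prod.union_disjoint) (auto simp: prod.reindex)
    ultimately show "prob (\<Inter>s\<in>J. F s) = (\<Prod>s\<in>J. prob (F s))" by simp
  qed
qed

text \<open>The index of the last grid point strictly before \<open>d\<close>. Rounding up and subtracting one, rather than
  rounding down, keeps the inequality strict, which is what the tail of the exponential law and limits from
  the left need.\<close>

definition grid_len :: "real \<Rightarrow> real \<Rightarrow> nat" where
  "grid_len h d = nat (\<lceil>d / h\<rceil> - 1)"

lemma measurable_grid_len [measurable]: "grid_len h \<in> borel \<rightarrow>\<^sub>M count_space UNIV"
  unfolding grid_len_def[abs_def] by measurable

lemma grid_len_bounds:
  assumes "0 < h" "0 < d" shows "real (grid_len h d) * h < d" "d \<le> real (Suc (grid_len h d)) * h"
proof -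
  have "0 < \<lceil>d / h\<rceil>" using assms by simp
  then have "real (grid_len h d) = of_int \<lceil>d / h\<rceil> - 1" by (simp add: grid_len_def)
  then have "real (grid_len h d) < d / h" "d / h \<le> real (Suc (grid_len h d))" by (simp_all, linarith+)
  then show "real (grid_len h d) * h < d" "d \<le> real (Suc (grid_len h d)) * h" using assms by (simp_all add: field_simps)
qed

lemma grid_len_eq_iff:
  assumes "0 < h" "0 < d" shows "grid_len h d = n \<longleftrightarrow> real n * h < d \<and> d \<le> real (Suc n) * h"
proof
  assume r: "real n * h < d \<and> d \<le> real (Suc n) * h"
  note b = grid_len_bounds[OF assms]
  have "real n * h < real (Suc (grid_len h d)) * h" "real (grid_len h d) * h < real (Suc n) * h" using r b by linarith+
  then have "n < Suc (grid_len h d)" "grid_len h d < Suc n"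
    using assms(1) by (simp_all only: mult_less_cancel_right_pos of_nat_less_iff)
  then show "grid_len h d = n" by simp
qed (use grid_len_bounds[OF assms] in auto)

context poisson_epochs begin

definition gap :: "nat \<Rightarrow> 'a \<Rightarrow> real" where
  "gap i \<omega> = T (Suc i) \<omega> - T i \<omega>"

lemma gap_pos: "\<omega> \<in> space M \<Longrightarrow> 0 < gap i \<omega>"
  using epochs_increasing[of \<omega>] by (simp add: gap_def strict_mono_def)

lemma gap_measurable [measurable]: "gap i \<in> borel_measurable M"
  using interarrival_distr[of i] unfolding gap_def[abs_def] by (auto dest: distributed_measurable)

lemma T_eq_sum_gap: "\<omega> \<in> space M \<Longrightarrow> T n \<omega> = (\<Sum>i<n. gap i \<omega>)"
  by (induction n) (auto simp: epoch_zero gap_def)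

lemma T_nonneg: "\<omega> \<in> space M \<Longrightarrow> 0 \<le> T n \<omega>"
  unfolding T_eq_sum_gap by (intro sum_nonneg less_imp_le gap_pos)

lemma T_pos: "\<omega> \<in> space M \<Longrightarrow> 0 < n \<Longrightarrow> 0 < T n \<omega>"
  using epochs_increasing[of \<omega>] epoch_zero[of \<omega>] by (metis strict_monoD)

lemma T_measurable [measurable]: "T n \<in> borel_measurable M"
  by (subst measurable_cong[OF T_eq_sum_gap]) auto

lemma prob_gap_greater: "0 \<le> a \<Longrightarrow> prob {\<omega> \<in> space M. a < gap i \<omega>} = exp (- rate * a)"
  using exponential_distributedD_gt[OF interarrival_distr[of i], of a] intensity_pos by (simp add: gap_def mult.commute)

lemma grid_len_geometric:
  assumes h: "0 < h"
  shows "emeasure M {\<omega> \<in> space M. grid_len h (gap i \<omega>) = n} =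
    ennreal (1 - exp (- rate * h)) * ennreal (exp (- rate * h)) ^ n"
proof -
  have "{\<omega> \<in> space M. grid_len h (gap i \<omega>) = n} =
    {\<omega> \<in> space M. real n * h < gap i \<omega>} - {\<omega> \<in> space M. real (Suc n) * h < gap i \<omega>}"
  proof (rule set_eqI)
    fix \<omega>
    show "\<omega> \<in> {\<omega> \<in> space M. grid_len h (gap i \<omega>) = n} \<longleftrightarrow>
      \<omega> \<in> {\<omega> \<in> space M. real n * h < gap i \<omega>} - {\<omega> \<in> space M. real (Suc n) * h < gap i \<omega>}"
      by (cases "\<omega> \<in> space M") (simp_all add: grid_len_eq_iff[OF h gap_pos] not_less del: of_nat_Suc)
  qed
  also have "prob \<dots> = exp (- rate * (real n * h)) - exp (- rate * (real (Suc n) * h))"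
  proof (subst finite_measure_Diff)
    have "real n * h \<le> real (Suc n) * h" using h by simp
    then show "{\<omega> \<in> space M. real (Suc n) * h < gap i \<omega>} \<subseteq> {\<omega> \<in> space M. real n * h < gap i \<omega>}" by auto
  qed (use h in \<open>simp_all add: prob_gap_greater del: of_nat_Suc\<close>)
  also have "\<dots> = (1 - exp (- rate * h)) * exp (- rate * h) ^ n"
    by (simp add: exp_of_nat_mult[symmetric] algebra_simps exp_add[symmetric])
  finally have "prob {\<omega> \<in> space M. grid_len h (gap i \<omega>) = n} = (1 - exp (- rate * h)) * exp (- rate * h) ^ n" .
  then show ?thesis using h intensity_pos by (simp add: emeasure_eq_measure ennreal_mult ennreal_power)
qed

lemma geometric_weights_sum:
  assumes h: "0 < h"
  shows "(\<Sum>n. ennreal (1 - exp (- rate * h)) * ennreal (exp (- rate * h)) ^ n) = 1"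
proof -
  define q where "q = exp (- rate * h)"
  have q: "0 < q" "q < 1" using h intensity_pos by (simp_all add: q_def)
  then have "(\<lambda>n. (1 - q) * q ^ n) sums ((1 - q) * (1 / (1 - q)))" by (intro sums_mult geometric_sums) simp
  then have "(\<Sum>n. ennreal ((1 - q) * q ^ n)) = ennreal 1"
    using q by (intro suminf_ennreal_eq) auto
  then show ?thesis using q unfolding q_def[symmetric] by (simp add: ennreal_mult ennreal_power)
qed

end

context levy_process begin

lemma grid_steps_law:
  assumes h: "0 \<le> h"
  shows "distr M borel (\<lambda>\<omega>. grid_steps e h (\<lambda>t. X t \<omega>) j) = distr M borel (\<lambda>\<omega>. grid_steps e h (\<lambda>t. X t \<omega>) 0)"
proof -
  have "distr M borel (\<lambda>\<omega>. grid_steps e h (\<lambda>t. X t \<omega>) j) = distr (distr M borel (X h)) borel (\<lambda>y. y + e * h)" for j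
  proof -
    have m: "(\<lambda>\<omega>. X (real j * h + h) \<omega> - X (real j * h) \<omega>) \<in> borel_measurable M"
      using h by (intro borel_measurable_diff measurable_process) auto
    have "(\<lambda>\<omega>. grid_steps e h (\<lambda>t. X t \<omega>) j) = (\<lambda>y. y + e * h) \<circ> (\<lambda>\<omega>. X (real j * h + h) \<omega> - X (real j * h) \<omega>)"
      by (simp add: fun_eq_iff grid_steps_def algebra_simps)
    then have "distr M borel (\<lambda>\<omega>. grid_steps e h (\<lambda>t. X t \<omega>) j) =
      distr (distr M borel (\<lambda>\<omega>. X (real j * h + h) \<omega> - X (real j * h) \<omega>)) borel (\<lambda>y. y + e * h)"
      by (subst distr_distr[OF _ m]) auto
    then show ?thesis using stationary_increments[of "real j * h" h] h by simp
  qed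
  then show ?thesis by simp
qed

lemma grid_steps_indep:
  assumes h: "0 \<le> h"
  shows "indep_vars (\<lambda>_. borel) (\<lambda>j \<omega>. grid_steps e h (\<lambda>t. X t \<omega>) j) UNIV"
proof -
  have "indep_vars (\<lambda>_. borel) (\<lambda>j \<omega>. X (real (Suc j) * h) \<omega> - X (real j * h) \<omega>) {..<n}" for n
    using independent_increments[of "\<lambda>j. real j * h" n] h by (simp add: mult_right_mono)
  then have "indep_vars (\<lambda>_. borel) (\<lambda>j \<omega>. X (real (Suc j) * h) \<omega> - X (real j * h) \<omega> + e * h) {..<n}" for n
    by (rule indep_vars_compose2[where Y="\<lambda>_ y. y + e * h"]) auto
  then have fin: "indep_vars (\<lambda>_. borel) (\<lambda>j \<omega>. grid_steps e h (\<lambda>t. X t \<omega>) j) {..<n}" for n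
    by (simp only: grid_steps_def)
  show ?thesis by (rule indep_vars_nat_if_initial) (rule fin)
qed

end

context levy_poisson begin

abbreviation "VX \<equiv> vimage_algebra (space M) (\<lambda>\<omega>. \<lambda>t\<in>{0..}. X t \<omega>) (Pi\<^sub>M {0..} (\<lambda>_. borel))"
abbreviation "VT \<equiv> vimage_algebra (space M) (\<lambda>\<omega> i. T i \<omega>) (Pi\<^sub>M UNIV (\<lambda>_. borel))"

lemma X_VX: "0 \<le> t \<Longrightarrow> X t \<in> borel_measurable VX"
proof -
  assume t: "0 \<le> t"
  have "(\<lambda>\<omega>. \<lambda>t\<in>{0..}. X t \<omega>) \<in> VX \<rightarrow>\<^sub>M Pi\<^sub>M {0..} (\<lambda>_. borel)"
    by (rule measurable_vimage_algebra1) (auto simp: space_PiM)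
  from measurable_compose[OF this measurable_component_singleton[of t]] show ?thesis using t by simp
qed

lemma T_VT: "T i \<in> borel_measurable VT"
proof -
  have "(\<lambda>\<omega> i. T i \<omega>) \<in> VT \<rightarrow>\<^sub>M Pi\<^sub>M UNIV (\<lambda>_. borel)"
    by (rule measurable_vimage_algebra1) (auto simp: space_PiM)
  from measurable_compose[OF this measurable_component_singleton[of i]] show ?thesis by simp
qed

lemma grid_steps_gap_indep:
  assumes h: "0 \<le> h"
  shows "indep_vars (\<lambda>_. borel) (case_sum (\<lambda>j \<omega>. grid_steps e h (\<lambda>t. X t \<omega>) j) gap) UNIV"
proof (rule indep_vars_case_sum[OF grid_steps_indep[OF h] _ _ _ _ _ process_epochs_indep])
  show "(\<lambda>\<omega>. grid_steps e h (\<lambda>t. X t \<omega>) j) \<in> borel_measurable VX" for j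
    unfolding grid_steps_def using h by (intro borel_measurable_add borel_measurable_diff X_VX) auto
  show "gap i \<in> borel_measurable VT" for i
    unfolding gap_def[abs_def] by (intro borel_measurable_diff T_VT)
  show "indep_vars (\<lambda>_. borel) gap UNIV" using interarrival_indep by (simp add: gap_def[abs_def])
qed auto

lemma cut_walk_grid:
  assumes h: "0 < h"
  shows "cut_walk M (\<lambda>j \<omega>. grid_steps e h (\<lambda>t. X t \<omega>) j) gap (grid_len h)
    (distr M borel (\<lambda>\<omega>. grid_steps e h (\<lambda>t. X t \<omega>) 0)) (ennreal (1 - exp (- rate * h))) (ennreal (exp (- rate * h)))"
  by unfold_locales
    (rule grid_steps_gap_indep grid_steps_law grid_len_geometric measurable_grid_len h less_imp_le[OF h])+

text \<open>An index that is determined by the epochs is independent of the process, and all increments over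
  intervals of the same length have the same law.\<close>

lemma nn_integral_increment_at_random_index:
  fixes \<kappa> :: "'a \<Rightarrow> nat"
  assumes \<kappa>: "\<kappa> \<in> VT \<rightarrow>\<^sub>M count_space UNIV" and h: "0 \<le> h" and d: "0 \<le> d"
    and \<phi> [measurable]: "\<phi> \<in> borel_measurable (borel :: real measure)"
  shows "(\<integral>\<^sup>+\<omega>. \<phi> (X (real (\<kappa> \<omega>) * h + d) \<omega> - X (real (\<kappa> \<omega>) * h) \<omega>) \<partial>M) = (\<integral>\<^sup>+\<omega>. \<phi> (X d \<omega>) \<partial>M)"
proof -
  define Z where "Z n \<omega> = X (real n * h + d) \<omega> - X (real n * h) \<omega>" for n \<omega>
  have ZV: "Z n \<in> borel_measurable VX" for n
    unfolding Z_def[abs_def] using h d by (intro borel_measurable_diff X_VX) auto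
  have Z [measurable]: "Z n \<in> borel_measurable M" for n
    unfolding Z_def[abs_def] using h d by (intro borel_measurable_diff measurable_process) auto
  have ev: "{\<omega> \<in> space M. \<kappa> \<omega> = n} \<in> sets VT" for n
    using measurable_sets[OF \<kappa>, of "{n}"] by (simp add: vimage_def Int_def conj_commute)
  moreover have "sets VT \<subseteq> events" using process_epochs_indep by (simp add: indep_sets2_eq)
  ultimately have ev': "{\<omega> \<in> space M. \<kappa> \<omega> = n} \<in> events" for n by blast
  have law: "(\<integral>\<^sup>+\<omega>. \<phi> (Z n \<omega>) \<partial>M) = (\<integral>\<^sup>+\<omega>. \<phi> (X d \<omega>) \<partial>M)" for n
  proof -
    have [measurable]: "X d \<in> borel_measurable M" using d by (rule measurable_process)
    have "(\<integral>\<^sup>+\<omega>. \<phi> (Z n \<omega>) \<partial>M) = (\<integral>\<^sup>+y. \<phi> y \<partial>distr M borel (Z n))"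
      by (subst nn_integral_distr) auto
    also have "distr M borel (Z n) = distr M borel (X d)"
      unfolding Z_def[abs_def] using h d by (intro stationary_increments) auto
    finally show ?thesis by (subst (asm) nn_integral_distr) auto
  qed
  have split: "(\<integral>\<^sup>+\<omega>. indicator {\<omega> \<in> space M. \<kappa> \<omega> = n} \<omega> * \<phi> (Z n \<omega>) \<partial>M) =
    emeasure M {\<omega> \<in> space M. \<kappa> \<omega> = n} * (\<integral>\<^sup>+\<omega>. \<phi> (X d \<omega>) \<partial>M)" for n
  proof -
    let ?I = "indicator {\<omega> \<in> space M. \<kappa> \<omega> = n} :: 'a \<Rightarrow> ennreal"
    have "indep_var borel ?I borel (\<lambda>\<omega>. \<phi> (Z n \<omega>))"
      unfolding indep_var_eq
    proof (intro conjI)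
      show "random_variable borel ?I" using ev' by measurable
      show "random_variable borel (\<lambda>\<omega>. \<phi> (Z n \<omega>))" by measurable
      have "?I \<in> borel_measurable VT" using ev by measurable
      then have 1: "{?I -` A \<inter> space M |A. A \<in> sets borel} \<subseteq> sets VT"
        by (auto dest: measurable_sets)
      have "(\<lambda>\<omega>. \<phi> (Z n \<omega>)) \<in> borel_measurable VX" using measurable_compose[OF ZV \<phi>] .
      then have 2: "{(\<lambda>\<omega>. \<phi> (Z n \<omega>)) -` A \<inter> space M |A. A \<in> sets borel} \<subseteq> sets VX"
        by (auto dest: measurable_sets)
      have "indep_set (sets VT) (sets VX)"
        using process_epochs_indep by (simp add: indep_sets2_eq) (metis Int_commute mult.commute)
      then show "indep_set (sigma_sets (space M) {?I -` A \<inter> space M |A. A \<in> sets borel})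
         (sigma_sets (space M) {(\<lambda>\<omega>. \<phi> (Z n \<omega>)) -` A \<inter> space M |A. A \<in> sets borel})"
        unfolding indep_set_def
        by (rule indep_sets_mono_sets)
          (use sets.sigma_sets_subset[OF 1] sets.sigma_sets_subset[OF 2] in \<open>simp split: bool.split\<close>)
    qed
    then have "indep_vars (\<lambda>_. borel) (case_bool ?I (\<lambda>\<omega>. \<phi> (Z n \<omega>))) UNIV"
      unfolding indep_var_def by (rule indep_vars_cong[THEN iffD1, rotated -1]) (auto split: bool.split)
    from indep_vars_nn_integral[OF _ this]
    have "(\<integral>\<^sup>+\<omega>. ?I \<omega> * \<phi> (Z n \<omega>) \<partial>M) = (\<integral>\<^sup>+\<omega>. ?I \<omega> \<partial>M) * (\<integral>\<^sup>+\<omega>. \<phi> (Z n \<omega>) \<partial>M)"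
      by (simp add: UNIV_bool ac_simps)
    then show ?thesis using ev' law by simp
  qed
  have "(\<integral>\<^sup>+\<omega>. \<phi> (Z (\<kappa> \<omega>) \<omega>) \<partial>M) = (\<integral>\<^sup>+\<omega>. (\<Sum>n. indicator {\<omega> \<in> space M. \<kappa> \<omega> = n} \<omega> * \<phi> (Z n \<omega>)) \<partial>M)"
  proof (rule nn_integral_cong)
    fix \<omega> assume "\<omega> \<in> space M"
    then show "\<phi> (Z (\<kappa> \<omega>) \<omega>) = (\<Sum>n. indicator {\<omega> \<in> space M. \<kappa> \<omega> = n} \<omega> * \<phi> (Z n \<omega>))"
      by (subst suminf_finite[of "{\<kappa> \<omega>}"]) auto
  qed
  also have "\<dots> = (\<Sum>n. \<integral>\<^sup>+\<omega>. indicator {\<omega> \<in> space M. \<kappa> \<omega> = n} \<omega> * \<phi> (Z n \<omega>) \<partial>M)"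
    by (intro nn_integral_suminf borel_measurable_times_ennreal borel_measurable_indicator ev' measurable_compose[OF Z \<phi>])
  also have "\<dots> = (\<Sum>n. emeasure M {\<omega> \<in> space M. \<kappa> \<omega> = n}) * (\<integral>\<^sup>+\<omega>. \<phi> (X d \<omega>) \<partial>M)"
    by (simp add: split)
  also have "(\<Sum>n. emeasure M {\<omega> \<in> space M. \<kappa> \<omega> = n}) = emeasure M (\<Union>n. {\<omega> \<in> space M. \<kappa> \<omega> = n})"
    using ev' by (intro suminf_emeasure) (auto simp: disjoint_family_on_def)
  also have "(\<Union>n. {\<omega> \<in> space M. \<kappa> \<omega> = n}) = space M" by auto
  finally show ?thesis by (simp add: Z_def emeasure_space_1)
qed

end

section \<open>Continuity at the epochs\<close>

text \<open>  Truncated at \<open>1\<close>, the variables converge in mean, so that for each \<open>k\<close> some \<open>m\<close> makes the mean of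
  \<open>u k m\<close> nearly as small as the one of \<open>v k\<close>. Convergence in mean gives almost sure convergence along a
  subsequence.\<close>

lemma (in prob_space) AE_diagonal_subsequence:
  fixes u :: "nat \<Rightarrow> nat \<Rightarrow> 'a \<Rightarrow> real" and v :: "nat \<Rightarrow> 'a \<Rightarrow> real"
  assumes u [measurable]: "\<And>k m. u k m \<in> borel_measurable M" and v [measurable]: "\<And>k. v k \<in> borel_measurable M"
    and u0: "\<And>k m \<omega>. 0 \<le> u k m \<omega>"
    and uv: "\<And>k. AE \<omega> in M. (\<lambda>m. u k m \<omega>) \<longlonglongrightarrow> v k \<omega>"
    and v0: "AE \<omega> in M. (\<lambda>k. v k \<omega>) \<longlonglongrightarrow> 0"
  obtains a b :: "nat \<Rightarrow> nat" where "AE \<omega> in M. (\<lambda>l. u (a l) (b l) \<omega>) \<longlonglongrightarrow> 0"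
proof -
  let ?t = "\<lambda>y. min 1 \<bar>y :: real\<bar>"
  have lim: "(\<lambda>m. expectation (\<lambda>\<omega>. ?t (u k m \<omega>))) \<longlonglongrightarrow> expectation (\<lambda>\<omega>. ?t (v k \<omega>))" for k
  proof (rule integral_dominated_convergence[where w="\<lambda>_. 1"])
    show "AE \<omega> in M. (\<lambda>m. ?t (u k m \<omega>)) \<longlonglongrightarrow> ?t (v k \<omega>)"
      using uv[of k] by eventually_elim (intro tendsto_intros)
  qed auto
  have "(\<lambda>k. expectation (\<lambda>\<omega>. ?t (v k \<omega>))) \<longlonglongrightarrow> expectation (\<lambda>\<omega>. 0)"
  proof (rule integral_dominated_convergence[where w="\<lambda>_. 1"])
    show "AE \<omega> in M. (\<lambda>k. ?t (v k \<omega>)) \<longlonglongrightarrow> 0"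
      using v0
    proof eventually_elim
      case (elim \<omega>)
      then have "(\<lambda>k. ?t (v k \<omega>)) \<longlonglongrightarrow> ?t 0" by (intro tendsto_intros)
      then show ?case by simp
    qed
  qed auto
  then have lim0: "(\<lambda>k. expectation (\<lambda>\<omega>. ?t (v k \<omega>))) \<longlonglongrightarrow> 0" by simp
  have "\<exists>m. expectation (\<lambda>\<omega>. ?t (u k m \<omega>)) < expectation (\<lambda>\<omega>. ?t (v k \<omega>)) + 1 / real (Suc k)" for k
    using order_tendstoD(2)[OF lim[of k], of "expectation (\<lambda>\<omega>. ?t (v k \<omega>)) + 1 / real (Suc k)"]
    by (auto simp: eventually_sequentially)
  then obtain m where m: "\<And>k. expectation (\<lambda>\<omega>. ?t (u k (m k) \<omega>)) < expectation (\<lambda>\<omega>. ?t (v k \<omega>)) + 1 / real (Suc k)"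
    by metis
  have "(\<lambda>k. expectation (\<lambda>\<omega>. norm (?t (u k (m k) \<omega>)))) \<longlonglongrightarrow> 0"
  proof (rule tendsto_sandwich[where f="\<lambda>_. 0" and h="\<lambda>k. expectation (\<lambda>\<omega>. ?t (v k \<omega>)) + 1 / real (Suc k)"])
    show "(\<lambda>k. expectation (\<lambda>\<omega>. ?t (v k \<omega>)) + 1 / real (Suc k)) \<longlonglongrightarrow> 0"
      using tendsto_add[OF lim0 LIMSEQ_Suc[OF lim_const_over_n[of 1]]] by simp
    show "\<forall>\<^sub>F k in sequentially. expectation (\<lambda>\<omega>. norm (?t (u k (m k) \<omega>))) \<le> expectation (\<lambda>\<omega>. ?t (v k \<omega>)) + 1 / real (Suc k)"
      using m by (intro always_eventually allI less_imp_le) (simp del: of_nat_Suc)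
  qed auto
  moreover have "integrable M (\<lambda>\<omega>. ?t (u k (m k) \<omega>))" for k
    by (intro integrable_const_bound[where B=1]) auto
  ultimately obtain r :: "nat \<Rightarrow> nat" where
    r: "AE \<omega> in M. (\<lambda>l. ?t (u (r l) (m (r l)) \<omega>)) \<longlonglongrightarrow> 0"
    using tendsto_L1_AE_subseq[of M "\<lambda>k \<omega>. ?t (u k (m k) \<omega>)"] by blast
  have "AE \<omega> in M. (\<lambda>l. u (r l) (m (r l)) \<omega>) \<longlonglongrightarrow> 0"
    using r
  proof eventually_elim
    case (elim \<omega>)
    have "\<forall>\<^sub>F l in sequentially. ?t (u (r l) (m (r l)) \<omega>) < 1" using order_tendstoD(2)[OF elim, of 1] by simp
    then have "\<forall>\<^sub>F l in sequentially. ?t (u (r l) (m (r l)) \<omega>) = u (r l) (m (r l)) \<omega>"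
      by eventually_elim (use u0 in \<open>auto simp: min_def abs_of_nonneg\<close>)
    from Lim_transform_eventually[OF elim this] show ?case .
  qed
  then show thesis using that[of r "\<lambda>l. m (r l)"] by simp
qed

context random_walk begin

lemma measurable_last_argmax [measurable]: "(\<lambda>z. last_argmax z n) \<in> S \<rightarrow>\<^sub>M count_space UNIV"
proof (subst measurable_count_space_eq2_countable, intro conjI ballI)
  fix m
  show "(\<lambda>z. last_argmax z n) -` {m} \<inter> space S \<in> sets S"
  proof (cases "m \<le> n")
    case True
    have [measurable]: "(\<lambda>z. stays_negative (n - m) (\<lambda>i. z (m + i))) \<in> S \<rightarrow>\<^sub>M count_space UNIV"
      using measurable_compose[OF measurable_shift measurable_stays_negative] .
    have "(\<lambda>z. last_argmax z n) -` {m} \<inter> space S =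
      {z \<in> space S. ends_at_max m z \<and> stays_negative (n - m) (\<lambda>i. z (m + i))}"
      using last_argmax_eq_iff[OF True] by auto
    also have "\<dots> \<in> sets S" by measurable
    finally show ?thesis .
  next
    case False
    then have "(\<lambda>z. last_argmax z n) -` {m} \<inter> space S = {}" using last_argmax_mem(1)[of _ n] by auto
    then show ?thesis by simp
  qed
qed auto

lemma measurable_first_argmin [measurable]: "(\<lambda>z. first_argmin z n) \<in> S \<rightarrow>\<^sub>M count_space UNIV"
proof (subst measurable_count_space_eq2_countable, intro conjI ballI)
  fix m
  show "(\<lambda>z. first_argmin z n) -` {m} \<inter> space S \<in> sets S"
  proof (cases "m \<le> n")
    case True
    have "(\<lambda>z. first_argmin z n) -` {m} \<inter> space S =
      {z \<in> space S. (\<forall>j\<in>{..<m}. walk z m < walk z j) \<and> (\<forall>j\<in>{..n - m}. 0 \<le> walk z (m + j) - walk z m)}"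
      using first_argmin_eq_iff[OF True] by (auto simp: walk_shift)
    also have "\<dots> \<in> sets S" by (intro sets.sets_Collect_conj sets.sets_Collect_countable_Ball) measurable
    finally show ?thesis .
  next
    case False
    then have "(\<lambda>z. first_argmin z n) -` {m} \<inter> space S = {}" using first_argmin_mem(1)[of _ n] by auto
    then show ?thesis by simp
  qed
qed auto

end

lemma walk_extremes_cong:
  assumes "\<And>i. i < n \<Longrightarrow> z i = z' i"
  shows "walk_max z n = walk_max z' n" "last_argmax z n = last_argmax z' n"
    "walk_min z n = walk_min z' n" "first_argmin z n = first_argmin z' n" "walk z n = walk z' n"
proof -
  have w: "walk z j = walk z' j" if "j \<le> n" for j by (rule walk_cong) (use assms that in simp)
  have "walk z ` {..n} = walk z' ` {..n}" using w by (intro image_cong) auto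
  then show 1: "walk_max z n = walk_max z' n" "walk_min z n = walk_min z' n"
    unfolding walk_max_def walk_min_def by simp_all
  show "walk z n = walk z' n" using w by simp
  have eq: "{m. m \<le> n \<and> walk z m = c} = {m. m \<le> n \<and> walk z' m = c}" for c using w by auto
  show "last_argmax z n = last_argmax z' n" "first_argmin z n = first_argmin z' n"
    unfolding last_argmax_def first_argmin_def 1 eq by simp_all
qed

context levy_poisson begin

text \<open>  The increment over two grid cells around the epoch converges to the jump at the epoch, and it has the law of
  an increment over a fixed interval of vanishing length.\<close>

lemma AE_no_jump_at_epoch: "AE \<omega> in M. left_lim (\<lambda>t. X t \<omega>) (T n \<omega>) = X (T n \<omega>) \<omega>"
proof (cases "n = 0")
  case True
  then show ?thesis by (intro AE_I2) (simp add: epoch_zero left_lim_def)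
next
  case False
  define h where "h m = 1 / real (Suc m)" for m
  have h: "0 < h m" for m by (simp add: h_def)
  have h0: "h \<longlonglongrightarrow> 0" unfolding h_def by (rule LIMSEQ_Suc[OF lim_const_over_n])
  define \<kappa> where "\<kappa> m \<omega> = grid_len (h m) (T n \<omega>)" for m \<omega>
  define \<phi> where "\<phi> y = ennreal (min 1 \<bar>y\<bar>)" for y :: real
  have \<phi> [measurable]: "\<phi> \<in> borel_measurable borel" unfolding \<phi>_def by measurable
  define u where "u m \<omega> = \<phi> (X (real (\<kappa> m \<omega>) * h m + 2 * h m) \<omega> - X (real (\<kappa> m \<omega>) * h m) \<omega>)" for m \<omega>
  have \<kappa>V: "\<kappa> m \<in> VT \<rightarrow>\<^sub>M count_space UNIV" for m
    unfolding \<kappa>_def[abs_def] using T_VT by measurable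
  have \<kappa>M: "\<kappa> m \<in> M \<rightarrow>\<^sub>M count_space UNIV" for m
    unfolding \<kappa>_def[abs_def] by measurable
  have u_meas: "u m \<in> borel_measurable M" for m
  proof -
    have 1: "(\<lambda>\<omega>. X (real i * h m + 2 * h m) \<omega> - X (real i * h m) \<omega>) \<in> borel_measurable M" for i
      using h[of m] by (intro borel_measurable_diff measurable_process) auto
    have "(\<lambda>\<omega>. X (real (\<kappa> m \<omega>) * h m + 2 * h m) \<omega> - X (real (\<kappa> m \<omega>) * h m) \<omega>) \<in> borel_measurable M"
      by (rule measurable_compose_countable[OF 1 \<kappa>M])
    then show ?thesis unfolding u_def[abs_def] by measurable
  qed
  have int: "(\<integral>\<^sup>+\<omega>. u m \<omega> \<partial>M) = (\<integral>\<^sup>+\<omega>. \<phi> (X (2 * h m) \<omega>) \<partial>M)" for m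
    unfolding u_def using h[of m] by (intro nn_integral_increment_at_random_index \<kappa>V \<phi>) auto
  have "(\<lambda>m. \<integral>\<^sup>+\<omega>. \<phi> (X (2 * h m) \<omega>) \<partial>M) \<longlonglongrightarrow> (\<integral>\<^sup>+\<omega>. 0 \<partial>M)"
  proof (rule nn_integral_dominated_convergence[where w="\<lambda>_. 1"])
    show "(\<lambda>\<omega>. \<phi> (X (2 * h m) \<omega>)) \<in> borel_measurable M" for m
      using h[of m] by (intro measurable_compose[OF measurable_process \<phi>]) auto
    show "AE \<omega> in M. (\<lambda>m. \<phi> (X (2 * h m) \<omega>)) \<longlonglongrightarrow> 0"
      using start_zero AE_space
    proof eventually_elim
      case (elim \<omega>)
      have "(\<lambda>m. 2 * h m) \<longlonglongrightarrow> 2 * 0" by (intro tendsto_intros h0)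
      then have "filterlim (\<lambda>m. 2 * h m) (at_right 0) sequentially"
        using h by (auto simp: filterlim_at less_imp_neq[THEN not_sym] intro!: always_eventually)
      from filterlim_compose[OF cadlag_right[OF cadlag_paths[OF elim(2)] order_refl] this]
      have "(\<lambda>m. X (2 * h m) \<omega>) \<longlonglongrightarrow> 0" using elim by simp
      then have "(\<lambda>m. ennreal (min 1 \<bar>X (2 * h m) \<omega>\<bar>)) \<longlonglongrightarrow> ennreal (min 1 \<bar>0\<bar>)"
        by (intro tendsto_ennrealI tendsto_min tendsto_const tendsto_rabs)
      then show ?case by (simp add: \<phi>_def)
    qed
  qed (auto simp: \<phi>_def emeasure_space_1)
  then have "liminf (\<lambda>m. \<integral>\<^sup>+\<omega>. u m \<omega> \<partial>M) = 0"
    by (simp add: int lim_imp_Liminf)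
  moreover have "(\<integral>\<^sup>+\<omega>. liminf (\<lambda>m. u m \<omega>) \<partial>M) \<le> liminf (\<lambda>m. \<integral>\<^sup>+\<omega>. u m \<omega> \<partial>M)"
    by (rule nn_integral_liminf[OF u_meas])
  ultimately have int0: "(\<integral>\<^sup>+\<omega>. liminf (\<lambda>m. u m \<omega>) \<partial>M) = 0" by simp
  have "(\<lambda>\<omega>. liminf (\<lambda>m. u m \<omega>)) \<in> borel_measurable M" by (rule borel_measurable_liminf[OF u_meas])
  from iffD1[OF nn_integral_0_iff_AE[OF this] int0] have "AE \<omega> in M. liminf (\<lambda>m. u m \<omega>) = 0" .
  then show ?thesis using AE_space
  proof eventually_elim
    case (elim \<omega>)
    let ?x = "\<lambda>t. X t \<omega>" and ?\<tau> = "T n \<omega>"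
    have x: "cadlag ?x" using elim by (intro cadlag_paths)
    have \<tau>: "0 < ?\<tau>" using elim False by (intro T_pos) auto
    note b = grid_len_bounds[OF h \<tau>, folded \<kappa>_def]
    have near: "(\<lambda>m. ?\<tau> + c * h m) \<longlonglongrightarrow> ?\<tau>" for c
      using tendsto_add[OF tendsto_const tendsto_mult[OF tendsto_const h0], of ?\<tau> c] by simp
    have bl: "?\<tau> + (- 1) * h m \<le> real (\<kappa> m \<omega>) * h m" for m using b(2)[of m] by (simp add: algebra_simps)
    have l: "(\<lambda>m. real (\<kappa> m \<omega>) * h m) \<longlonglongrightarrow> ?\<tau>"
      by (rule tendsto_sandwich[OF _ _ near[of "- 1"] tendsto_const])
        (use bl b(1) less_imp_le in \<open>auto intro!: always_eventually\<close>)
    then have "filterlim (\<lambda>m. real (\<kappa> m \<omega>) * h m) (at_left ?\<tau>) sequentially"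
      using b(1) by (auto simp: filterlim_at less_imp_neq intro!: always_eventually)
    from filterlim_compose[OF cadlag_left_lim[OF x \<tau>] this]
    have 1: "(\<lambda>m. ?x (real (\<kappa> m \<omega>) * h m)) \<longlonglongrightarrow> left_lim ?x ?\<tau>" .
    have "(\<lambda>m. real (\<kappa> m \<omega>) * h m + 2 * h m) \<longlonglongrightarrow> ?\<tau> + 2 * 0" by (intro tendsto_intros l h0)
    moreover have br: "?\<tau> < real (\<kappa> m \<omega>) * h m + 2 * h m" for m
      using b(2)[of m] h[of m] by (simp add: algebra_simps)
    ultimately have "filterlim (\<lambda>m. real (\<kappa> m \<omega>) * h m + 2 * h m) (at_right ?\<tau>) sequentially"
      by (auto simp: filterlim_at less_imp_neq[THEN not_sym] intro!: always_eventually)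
    from filterlim_compose[OF cadlag_right[OF x less_imp_le[OF \<tau>]] this]
    have 2: "(\<lambda>m. ?x (real (\<kappa> m \<omega>) * h m + 2 * h m)) \<longlonglongrightarrow> ?x ?\<tau>" .
    have "(\<lambda>m. u m \<omega>) \<longlonglongrightarrow> \<phi> (?x ?\<tau> - left_lim ?x ?\<tau>)"
      unfolding u_def \<phi>_def by (intro tendsto_ennrealI tendsto_min tendsto_const tendsto_rabs tendsto_diff 1 2)
    then have "liminf (\<lambda>m. u m \<omega>) = \<phi> (?x ?\<tau> - left_lim ?x ?\<tau>)" by (intro lim_imp_Liminf) auto
    then have "\<phi> (?x ?\<tau> - left_lim ?x ?\<tau>) = 0" using elim by simp
    then show ?case by (auto simp: \<phi>_def min_def ennreal_eq_0_iff split: if_splits)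
  qed
qed

end

section \<open>From the grid to the path\<close>

lemma walk_max_tilt:
  assumes "\<And>l. walk z' l = walk z l + c * real l"
  shows "walk_max z n + c * real (last_argmax z n) \<le> walk_max z' n"
  using walk_max_upper[of "last_argmax z n" n z'] last_argmax_mem[of z n] assms by simp

lemma walk_min_tilt:
  assumes "\<And>l. walk z' l = walk z l + c * real l"
  shows "walk_min z' n \<le> walk_min z n + c * real (first_argmin z n)"
  using walk_min_lower[of "first_argmin z n" n z'] first_argmin_mem[of z n] assms by simp

lemma (in random_walk) measurable_parts:
  "(\<lambda>z. (walk_max z n, h * real (last_argmax z n))) \<in> S \<rightarrow>\<^sub>M borel \<Otimes>\<^sub>M borel"
  "(\<lambda>z. (walk_min z n, h * real (first_argmin z n))) \<in> S \<rightarrow>\<^sub>M borel \<Otimes>\<^sub>M borel"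
  "(\<lambda>z. (walk z n - walk_max z n, h * real (n - last_argmax z n))) \<in> S \<rightarrow>\<^sub>M borel \<Otimes>\<^sub>M borel"
proof -
  have [measurable]: "(\<lambda>z. real (last_argmax z n)) \<in> borel_measurable S"
    "(\<lambda>z. real (first_argmin z n)) \<in> borel_measurable S"
    "(\<lambda>z. real (n - last_argmax z n)) \<in> borel_measurable S"
    by (rule measurable_compose[OF measurable_last_argmax] measurable_compose[OF measurable_first_argmin], simp)+
  show "(\<lambda>z. (walk_max z n, h * real (last_argmax z n))) \<in> S \<rightarrow>\<^sub>M borel \<Otimes>\<^sub>M borel"
    "(\<lambda>z. (walk_min z n, h * real (first_argmin z n))) \<in> S \<rightarrow>\<^sub>M borel \<Otimes>\<^sub>M borel"
    "(\<lambda>z. (walk z n - walk_max z n, h * real (n - last_argmax z n))) \<in> S \<rightarrow>\<^sub>M borel \<Otimes>\<^sub>M borel"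
    by measurable
qed

context levy_poisson begin

definition grid_pos :: "real \<Rightarrow> nat \<Rightarrow> 'a \<Rightarrow> nat" where
  "grid_pos h i \<omega> = (\<Sum>j<i. grid_len h (gap j \<omega>))"

definition seg_steps :: "real \<Rightarrow> real \<Rightarrow> nat \<Rightarrow> 'a \<Rightarrow> nat \<Rightarrow> real" where
  "seg_steps h e i \<omega> j = grid_steps e h (\<lambda>t. X t \<omega>) (grid_pos h i \<omega> + j)"

abbreviation seg_len :: "real \<Rightarrow> nat \<Rightarrow> 'a \<Rightarrow> nat" where
  "seg_len h i \<omega> \<equiv> grid_len h (gap i \<omega>)"

definition grid_sup :: "real \<Rightarrow> real \<Rightarrow> nat \<Rightarrow> 'a \<Rightarrow> real \<times> real" where
  "grid_sup h e i \<omega> = (walk_max (seg_steps h e i \<omega>) (seg_len h i \<omega>),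
     h * real (last_argmax (seg_steps h e i \<omega>) (seg_len h i \<omega>)))"

definition grid_inf :: "real \<Rightarrow> real \<Rightarrow> nat \<Rightarrow> 'a \<Rightarrow> real \<times> real" where
  "grid_inf h e i \<omega> = (walk_min (seg_steps h e i \<omega>) (seg_len h i \<omega>),
     h * real (first_argmin (seg_steps h e i \<omega>) (seg_len h i \<omega>)))"

definition grid_rest :: "real \<Rightarrow> real \<Rightarrow> nat \<Rightarrow> 'a \<Rightarrow> real \<times> real" where
  "grid_rest h e i \<omega> = (walk (seg_steps h e i \<omega>) (seg_len h i \<omega>) - walk_max (seg_steps h e i \<omega>) (seg_len h i \<omega>),
     h * real (seg_len h i \<omega> - last_argmax (seg_steps h e i \<omega>) (seg_len h i \<omega>)))"

lemma grid_measurable: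
  assumes h: "0 < h"
  shows "grid_sup h e i \<in> M \<rightarrow>\<^sub>M borel \<Otimes>\<^sub>M borel" "grid_inf h e i \<in> M \<rightarrow>\<^sub>M borel \<Otimes>\<^sub>M borel"
    "grid_rest h e i \<in> M \<rightarrow>\<^sub>M borel \<Otimes>\<^sub>M borel"
    "(\<lambda>\<omega>. walk (seg_steps h e i \<omega>) (seg_len h i \<omega>)) \<in> borel_measurable M"
proof -
  interpret C: cut_walk M "\<lambda>j \<omega>. grid_steps e h (\<lambda>t. X t \<omega>) j" gap "grid_len h"
    "distr M borel (\<lambda>\<omega>. grid_steps e h (\<lambda>t. X t \<omega>) 0)" "ennreal (1 - exp (- rate * h))" "ennreal (exp (- rate * h))"
    using h by (rule cut_walk_grid)
  have F: "(\<lambda>\<omega>. F (seg_len h i \<omega>) (seg_steps h e i \<omega>)) \<in> M \<rightarrow>\<^sub>M R" if "\<And>n. F n \<in> C.W.S \<rightarrow>\<^sub>M R" 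
    for F :: "nat \<Rightarrow> (nat \<Rightarrow> real) \<Rightarrow> 'r" and R
    using measurable_compose[OF C.measurable_sample C.measurable_segment[of F R i, OF that]]
    by (simp add: C.len_def C.pos_def seg_steps_def[abs_def] grid_pos_def)
  show "grid_sup h e i \<in> M \<rightarrow>\<^sub>M borel \<Otimes>\<^sub>M borel" unfolding grid_sup_def[abs_def]
    by (rule F[of "\<lambda>n z. (walk_max z n, h * real (last_argmax z n))"]) (rule C.W.measurable_parts)
  show "grid_inf h e i \<in> M \<rightarrow>\<^sub>M borel \<Otimes>\<^sub>M borel" unfolding grid_inf_def[abs_def]
    by (rule F[of "\<lambda>n z. (walk_min z n, h * real (first_argmin z n))"]) (rule C.W.measurable_parts)
  show "grid_rest h e i \<in> M \<rightarrow>\<^sub>M borel \<Otimes>\<^sub>M borel" unfolding grid_rest_def[abs_def]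
    by (rule F[of "\<lambda>n z. (walk z n - walk_max z n, h * real (n - last_argmax z n))"]) (rule C.W.measurable_parts)
  show "(\<lambda>\<omega>. walk (seg_steps h e i \<omega>) (seg_len h i \<omega>)) \<in> borel_measurable M"
    by (rule F[of "\<lambda>n z. walk z n"]) (rule C.W.measurable_walk)
qed

text \<open>  The segments are independent, and each of them factorizes. All laws are those of the segment \<open>0\<close>.\<close>

theorem grid_factorization:
  fixes f g :: "nat \<Rightarrow> real \<times> real \<Rightarrow> ennreal"
  assumes h: "0 < h" and f [measurable]: "\<And>i. f i \<in> borel_measurable (borel \<Otimes>\<^sub>M borel)"
    and g [measurable]: "\<And>i. g i \<in> borel_measurable (borel \<Otimes>\<^sub>M borel)"
  shows "(\<integral>\<^sup>+\<omega>. (\<Prod>i<n. f i (grid_sup h e i \<omega>) * g i (grid_rest h e i \<omega>)) \<partial>M) =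
    (\<Prod>i<n. (\<integral>\<^sup>+\<omega>. f i (grid_sup h e 0 \<omega>) \<partial>M) * (\<integral>\<^sup>+\<omega>. g i (grid_inf h e 0 \<omega>) \<partial>M))"
proof -
  interpret C: cut_walk M "\<lambda>j \<omega>. grid_steps e h (\<lambda>t. X t \<omega>) j" gap "grid_len h"
    "distr M borel (\<lambda>\<omega>. grid_steps e h (\<lambda>t. X t \<omega>) 0)" "ennreal (1 - exp (- rate * h))" "ennreal (exp (- rate * h))"
    using h by (rule cut_walk_grid)
  let ?geo = "C.W.geo (ennreal (1 - exp (- rate * h))) (ennreal (exp (- rate * h)))"
  have seg: "(\<integral>\<^sup>+\<omega>. (\<Prod>i<n. F i (seg_len h i \<omega>) (seg_steps h e i \<omega>)) \<partial>M) = (\<Prod>i<n. ?geo (F i))"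
    if "\<And>i n. F i n \<in> borel_measurable C.W.S" "\<And>i n z z'. (\<And>j. j < n \<Longrightarrow> z j = z' j) \<Longrightarrow> F i n z = F i n z'"
    for F :: "nat \<Rightarrow> nat \<Rightarrow> (nat \<Rightarrow> real) \<Rightarrow> ennreal" and n
    using C.nn_integral_segments[of F n, OF that] by (simp add: C.len_def C.pos_def seg_steps_def[abs_def] grid_pos_def)
  define a where "a i m z = f i (walk_max z m, h * real (last_argmax z m))" for i m z
  define b where "b i m z = g i (walk z m - walk_max z m, h * real (m - last_argmax z m))" for i m z
  define c where "c i m z = g i (walk_min z m, h * real (first_argmin z m))" for i m z
  have meas: "a i m \<in> borel_measurable C.W.S" "b i m \<in> borel_measurable C.W.S" "c i m \<in> borel_measurable C.W.S" for i m
    unfolding a_def[abs_def] b_def[abs_def] c_def[abs_def]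
    by (rule measurable_compose[OF C.W.measurable_parts(1) f] measurable_compose[OF C.W.measurable_parts(2) g]
        measurable_compose[OF C.W.measurable_parts(3) g])+
  have cong: "a i m z = a i m z'" "b i m z = b i m z'" "c i m z = c i m z'" if "\<And>j. j < m \<Longrightarrow> z j = z' j" for i m z z'
    unfolding a_def b_def c_def using walk_extremes_cong[of m z z', OF that] by simp_all
  have ab_cong: "a i m z * b i m z = a i m z' * b i m z'" if "\<And>j. j < m \<Longrightarrow> z j = z' j" for i m z z'
    by (rule arg_cong2[where f="(*)"]) (rule cong, rule that, assumption)+
  have "(\<integral>\<^sup>+\<omega>. (\<Prod>i<n. a i (seg_len h i \<omega>) (seg_steps h e i \<omega>) * b i (seg_len h i \<omega>) (seg_steps h e i \<omega>)) \<partial>M) =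
      (\<Prod>i<n. ?geo (\<lambda>m z. a i m z * b i m z))"
    by (rule seg[of "\<lambda>i m z. a i m z * b i m z"]) (intro borel_measurable_times_ennreal meas, rule ab_cong)
  then have "(\<integral>\<^sup>+\<omega>. (\<Prod>i<n. f i (grid_sup h e i \<omega>) * g i (grid_rest h e i \<omega>)) \<partial>M) = (\<Prod>i<n. ?geo (\<lambda>m z. a i m z * b i m z))"
    by (simp only: a_def b_def grid_sup_def grid_rest_def)
  moreover have "?geo (\<lambda>m z. a i m z * b i m z) = ?geo (a i) * ?geo (c i)" for i
    using C.W.geo_Wiener_Hopf[of "\<lambda>(x, t). f i (x, h * t)" "\<lambda>(x, t). g i (x, h * t)", OF _ _ geometric_weights_sum[OF h]]
    by (simp add: a_def[abs_def] b_def[abs_def] c_def[abs_def])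
  moreover have "?geo (a i) = (\<integral>\<^sup>+\<omega>. f i (grid_sup h e 0 \<omega>) \<partial>M)" for i
    using seg[of "\<lambda>_. a i" 1, OF meas(1) cong(1)] by (simp add: a_def grid_sup_def)
  moreover have "?geo (c i) = (\<integral>\<^sup>+\<omega>. g i (grid_inf h e 0 \<omega>) \<partial>M)" for i
    using seg[of "\<lambda>_. c i" 1, OF meas(3) cong(3)] by (simp add: c_def grid_inf_def)
  ultimately show ?thesis by (simp only:)
qed

lemma walk_seg_steps_tilt:
  "walk (seg_steps h e' i \<omega>) l = walk (seg_steps h e i \<omega>) l + ((e' - e) * h) * real l"
  unfolding seg_steps_def[abs_def] walk_grid_steps by (simp add: algebra_simps)

lemma grid_sup_tilt: "fst (grid_sup h e i \<omega>) + (e' - e) * snd (grid_sup h e i \<omega>) \<le> fst (grid_sup h e' i \<omega>)"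
  using walk_max_tilt[OF walk_seg_steps_tilt[of h e' i \<omega> _ e], of "seg_len h i \<omega>"]
  by (simp add: grid_sup_def mult.assoc)

lemma grid_inf_tilt: "fst (grid_inf h e' i \<omega>) \<le> fst (grid_inf h e i \<omega>) + (e' - e) * snd (grid_inf h e i \<omega>)"
  using walk_min_tilt[OF walk_seg_steps_tilt[of h e' i \<omega> _ e], of "seg_len h i \<omega>"]
  by (simp add: grid_inf_def mult.assoc)

text \<open>  The maximum as a function of the drift lies above the line through \<open>(e, maximum)\<close> whose slope is the time of the
  maximum; comparing with the drifts \<open>0\<close> and \<open>2 e\<close> encloses this slope between difference quotients.\<close>

lemma grid_sup_time_bounds:
  assumes "0 < e"
  shows "(fst (grid_sup h e i \<omega>) - fst (grid_sup h 0 i \<omega>)) / e \<le> snd (grid_sup h e i \<omega>)"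
    "snd (grid_sup h e i \<omega>) \<le> (fst (grid_sup h (2 * e) i \<omega>) - fst (grid_sup h e i \<omega>)) / e"
  using grid_sup_tilt[of h e i \<omega> 0] grid_sup_tilt[of h e i \<omega> "2 * e"] assms by (simp_all add: field_simps)

lemma grid_inf_time_bounds:
  assumes "0 < e"
  shows "snd (grid_inf h e i \<omega>) \<le> (fst (grid_inf h e i \<omega>) - fst (grid_inf h 0 i \<omega>)) / e"
    "(fst (grid_inf h (2 * e) i \<omega>) - fst (grid_inf h e i \<omega>)) / e \<le> snd (grid_inf h e i \<omega>)"
  using grid_inf_tilt[of h 0 i \<omega> e] grid_inf_tilt[of h "2 * e" i \<omega> e] assms by (simp_all add: field_simps)

definition seg :: "nat \<Rightarrow> real \<Rightarrow> 'a \<Rightarrow> real" where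
  "seg i s \<omega> = X (T i \<omega> + s) \<omega> - X (T i \<omega>) \<omega>"

lemma seg_measurable: "0 \<le> s \<Longrightarrow> seg i s \<in> borel_measurable M"
proof -
  assume s: "0 \<le> s"
  have "(\<lambda>\<omega>. X (T i \<omega> + s) \<omega>) \<in> borel_measurable M"
    using s T_nonneg by (intro measurable_eval_cadlag[where Y=X and \<tau>="\<lambda>\<omega>. T i \<omega> + s"] measurable_process cadlag_paths) auto
  moreover have "(\<lambda>\<omega>. X (T i \<omega>) \<omega>) \<in> borel_measurable M"
    using T_nonneg by (intro measurable_eval_cadlag[where Y=X and \<tau>="T i"] measurable_process cadlag_paths) auto
  ultimately show ?thesis unfolding seg_def[abs_def] by measurable
qed

lemma seg_cadlag: "\<omega> \<in> space M \<Longrightarrow> cadlag (\<lambda>s. seg i s \<omega>)"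
  unfolding seg_def by (intro cadlag_restart cadlag_paths T_nonneg)

lemma seg_end: "seg i (gap i \<omega>) \<omega> = X (T (Suc i) \<omega>) \<omega> - X (T i \<omega>) \<omega>"
  by (simp add: seg_def gap_def)

definition sup_part :: "nat \<Rightarrow> 'a \<Rightarrow> real \<times> real" where
  "sup_part i \<omega> = (running_sup (\<lambda>s. seg i s \<omega>) (gap i \<omega>), last_sup_time (\<lambda>s. seg i s \<omega>) (gap i \<omega>))"

definition inf_part :: "nat \<Rightarrow> 'a \<Rightarrow> real \<times> real" where
  "inf_part i \<omega> = (running_inf (\<lambda>s. seg i s \<omega>) (gap i \<omega>), first_inf_time (\<lambda>s. seg i s \<omega>) (gap i \<omega>))"

definition rest_part :: "nat \<Rightarrow> 'a \<Rightarrow> real \<times> real" where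
  "rest_part i \<omega> = (seg i (gap i \<omega>) \<omega>, gap i \<omega>) - sup_part i \<omega>"

definition drift_sup :: "real \<Rightarrow> nat \<Rightarrow> 'a \<Rightarrow> real" where
  "drift_sup e i \<omega> = running_sup (\<lambda>s. seg i s \<omega> + e * s) (gap i \<omega>)"

definition drift_inf :: "real \<Rightarrow> nat \<Rightarrow> 'a \<Rightarrow> real" where
  "drift_inf e i \<omega> = running_inf (\<lambda>s. seg i s \<omega> + e * s) (gap i \<omega>)"

lemma drift_measurable [measurable]:
  "drift_sup e i \<in> borel_measurable M" "drift_inf e i \<in> borel_measurable M"
  unfolding drift_sup_def[abs_def] drift_inf_def[abs_def]
  by (intro measurable_running_sup_drift measurable_running_inf_drift seg_measurable seg_cadlag gap_measurable less_imp_le[OF gap_pos]; assumption)+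

lemma seg_end_measurable [measurable]: "(\<lambda>\<omega>. seg i (gap i \<omega>) \<omega>) \<in> borel_measurable M"
  by (intro measurable_eval_cadlag[where Y="seg i" and \<tau>="gap i"] seg_measurable seg_cadlag gap_measurable less_imp_le[OF gap_pos])

lemma part_measurable [measurable]:
  "sup_part i \<in> M \<rightarrow>\<^sub>M borel \<Otimes>\<^sub>M borel" "inf_part i \<in> M \<rightarrow>\<^sub>M borel \<Otimes>\<^sub>M borel" "rest_part i \<in> M \<rightarrow>\<^sub>M borel \<Otimes>\<^sub>M borel"
proof -
  have 1: "(\<lambda>\<omega>. last_sup_time (\<lambda>s. seg i s \<omega>) (gap i \<omega>)) \<in> borel_measurable M"
    "(\<lambda>\<omega>. first_inf_time (\<lambda>s. seg i s \<omega>) (gap i \<omega>)) \<in> borel_measurable M"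
    by (intro measurable_last_sup_time measurable_first_inf_time seg_measurable seg_cadlag gap_measurable less_imp_le[OF gap_pos]; assumption)+
  have 2: "(\<lambda>\<omega>. running_sup (\<lambda>s. seg i s \<omega>) (gap i \<omega>)) \<in> borel_measurable M"
    "(\<lambda>\<omega>. running_inf (\<lambda>s. seg i s \<omega>) (gap i \<omega>)) \<in> borel_measurable M"
    using drift_measurable[of 0 i] by (simp_all add: drift_sup_def[abs_def] drift_inf_def[abs_def])
  note [measurable] = 1 2
  show "sup_part i \<in> M \<rightarrow>\<^sub>M borel \<Otimes>\<^sub>M borel" "inf_part i \<in> M \<rightarrow>\<^sub>M borel \<Otimes>\<^sub>M borel" "rest_part i \<in> M \<rightarrow>\<^sub>M borel \<Otimes>\<^sub>M borel"
    unfolding sup_part_def[abs_def] inf_part_def[abs_def] rest_part_def[abs_def] minus_prod_def by simp_all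
qed


text \<open>  The segments of the grid walk are concatenated without the rest of the cell in which an epoch lies.
  Each epoch therefore moves the walk by at most \<open>h\<close> to the left of the true epoch, and the shifts add up.\<close>

lemma grid_pos_bounds:
  assumes \<omega>: "\<omega> \<in> space M" and h: "0 < h"
  shows "real (grid_pos h i \<omega>) * h \<le> T i \<omega>" "T i \<omega> \<le> real (grid_pos h i \<omega>) * h + real i * h"
proof (induction i)
  case (Suc i)
  note b = grid_len_bounds[OF h gap_pos[OF \<omega>], of i]
  have t: "T (Suc i) \<omega> = T i \<omega> + gap i \<omega>" by (simp add: gap_def)
  case 1 show ?case using Suc(1) b by (simp add: grid_pos_def t algebra_simps)
  case 2 show ?case using Suc(2) b by (simp add: grid_pos_def t algebra_simps)
qed (simp_all add: grid_pos_def epoch_zero[OF \<omega>])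

lemma grid_pos_tendsto:
  assumes \<omega>: "\<omega> \<in> space M" and h: "\<And>m. 0 < h m" "h \<longlonglongrightarrow> 0"
  shows "(\<lambda>m. real (grid_pos (h m) i \<omega>) * h m) \<longlonglongrightarrow> T i \<omega>"
proof (rule tendsto_sandwich[where f="\<lambda>m. T i \<omega> - real i * h m" and h="\<lambda>_. T i \<omega>"])
  show "(\<lambda>m. T i \<omega> - real i * h m) \<longlonglongrightarrow> T i \<omega>"
    using tendsto_diff[OF tendsto_const tendsto_mult[OF tendsto_const h(2)], of "T i \<omega>" "real i"] by simp
  show "\<forall>\<^sub>F m in sequentially. T i \<omega> - real i * h m \<le> real (grid_pos (h m) i \<omega>) * h m"
    using grid_pos_bounds(2)[OF \<omega> h(1)] by (intro always_eventually allI) (simp add: diff_le_eq)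
qed (use grid_pos_bounds(1)[OF \<omega> h(1)] in auto)

lemma grid_parts_tendsto:
  assumes \<omega>: "\<omega> \<in> space M" and nj: "\<And>n. left_lim (\<lambda>t. X t \<omega>) (T n \<omega>) = X (T n \<omega>) \<omega>"
    and h: "\<And>m. 0 < h m" "h \<longlonglongrightarrow> 0"
  shows "(\<lambda>m. fst (grid_sup (h m) e i \<omega>)) \<longlonglongrightarrow> drift_sup e i \<omega>"
    "(\<lambda>m. fst (grid_inf (h m) e i \<omega>)) \<longlonglongrightarrow> drift_inf e i \<omega>"
    "(\<lambda>m. walk (seg_steps (h m) e i \<omega>) (seg_len (h m) i \<omega>)) \<longlonglongrightarrow> seg i (gap i \<omega>) \<omega> + e * gap i \<omega>"
    "(\<lambda>m. h m * real (seg_len (h m) i \<omega>)) \<longlonglongrightarrow> gap i \<omega>"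
proof -
  have S: "grid_pos h' i \<omega> + seg_len h' i \<omega> = grid_pos h' (Suc i) \<omega>" for h' by (simp add: grid_pos_def)
  have lt: "T i \<omega> < T (Suc i) \<omega>" using gap_pos[OF \<omega>, of i] by (simp add: gap_def)
  note K = grid_pos_bounds(1)[OF \<omega> h(1)] grid_pos_tendsto[OF \<omega> h]
  have N: "real (grid_pos (h m) i \<omega> + seg_len (h m) i \<omega>) * h m \<le> T (Suc i) \<omega>"
    "(\<lambda>m. real (grid_pos (h m) i \<omega> + seg_len (h m) i \<omega>) * h m) \<longlonglongrightarrow> T (Suc i) \<omega>" for m
    unfolding S using K by blast+
  note prem = cadlag_paths[OF \<omega>] T_nonneg[OF \<omega>] lt nj nj h K N
  show "(\<lambda>m. fst (grid_sup (h m) e i \<omega>)) \<longlonglongrightarrow> drift_sup e i \<omega>"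
    using walk_max_grid_tendsto[OF prem, of e] by (simp add: grid_sup_def seg_steps_def[abs_def] drift_sup_def seg_def gap_def)
  show "(\<lambda>m. fst (grid_inf (h m) e i \<omega>)) \<longlonglongrightarrow> drift_inf e i \<omega>"
    using walk_min_grid_tendsto[OF prem, of e] by (simp add: grid_inf_def seg_steps_def[abs_def] drift_inf_def seg_def gap_def)
  show "(\<lambda>m. walk (seg_steps (h m) e i \<omega>) (seg_len (h m) i \<omega>)) \<longlonglongrightarrow> seg i (gap i \<omega>) \<omega> + e * gap i \<omega>"
    using walk_grid_tendsto[OF prem, of e] by (simp add: seg_steps_def[abs_def] seg_def gap_def)
  have "(\<lambda>m. real (grid_pos (h m) i \<omega> + seg_len (h m) i \<omega>) * h m - real (grid_pos (h m) i \<omega>) * h m) \<longlonglongrightarrow> T (Suc i) \<omega> - T i \<omega>"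
    by (intro tendsto_diff N K)
  then show "(\<lambda>m. h m * real (seg_len (h m) i \<omega>)) \<longlonglongrightarrow> gap i \<omega>" by (simp add: gap_def algebra_simps)
qed

text \<open>Total distance between the discretized quantities of a segment and their limits. The times of the
  extremes on the grid need not converge for a fixed drift; the difference quotients that enclose
  them do.\<close>

definition grid_error :: "real \<Rightarrow> real \<Rightarrow> nat \<Rightarrow> 'a \<Rightarrow> real" where
  "grid_error h e i \<omega> =
     \<bar>fst (grid_sup h e i \<omega>) - fst (sup_part i \<omega>)\<bar> +
     \<bar>(fst (grid_sup h e i \<omega>) - fst (grid_sup h 0 i \<omega>)) / e - snd (sup_part i \<omega>)\<bar> +
     \<bar>(fst (grid_sup h (2 * e) i \<omega>) - fst (grid_sup h e i \<omega>)) / e - snd (sup_part i \<omega>)\<bar> +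
     \<bar>walk (seg_steps h e i \<omega>) (seg_len h i \<omega>) - seg i (gap i \<omega>) \<omega>\<bar> +
     \<bar>h * real (seg_len h i \<omega>) - gap i \<omega>\<bar> +
     \<bar>fst (grid_inf h e i \<omega>) - fst (inf_part i \<omega>)\<bar> +
     \<bar>(fst (grid_inf h e i \<omega>) - fst (grid_inf h 0 i \<omega>)) / e - snd (inf_part i \<omega>)\<bar> +
     \<bar>(fst (grid_inf h (2 * e) i \<omega>) - fst (grid_inf h e i \<omega>)) / e - snd (inf_part i \<omega>)\<bar>"

definition drift_error :: "real \<Rightarrow> nat \<Rightarrow> 'a \<Rightarrow> real" where
  "drift_error e i \<omega> =
     \<bar>drift_sup e i \<omega> - fst (sup_part i \<omega>)\<bar> +
     \<bar>(drift_sup e i \<omega> - drift_sup 0 i \<omega>) / e - snd (sup_part i \<omega>)\<bar> +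
     \<bar>(drift_sup (2 * e) i \<omega> - drift_sup e i \<omega>) / e - snd (sup_part i \<omega>)\<bar> +
     \<bar>seg i (gap i \<omega>) \<omega> + e * gap i \<omega> - seg i (gap i \<omega>) \<omega>\<bar> +
     \<bar>gap i \<omega> - gap i \<omega>\<bar> +
     \<bar>drift_inf e i \<omega> - fst (inf_part i \<omega>)\<bar> +
     \<bar>(drift_inf e i \<omega> - drift_inf 0 i \<omega>) / e - snd (inf_part i \<omega>)\<bar> +
     \<bar>(drift_inf (2 * e) i \<omega> - drift_inf e i \<omega>) / e - snd (inf_part i \<omega>)\<bar>"

lemma grid_error_nonneg: "0 \<le> grid_error h e i \<omega>"
  unfolding grid_error_def by (intro add_nonneg_nonneg abs_ge_zero)

lemma grid_error_measurable:
  assumes h: "0 < h" shows "grid_error h e i \<in> borel_measurable M"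
proof -
  note [measurable] = grid_measurable[OF h]
  show ?thesis unfolding grid_error_def[abs_def] by measurable
qed

lemma drift_error_measurable: "drift_error e i \<in> borel_measurable M"
  unfolding drift_error_def[abs_def] by measurable

lemma grid_error_tendsto:
  assumes \<omega>: "\<omega> \<in> space M" and nj: "\<And>n. left_lim (\<lambda>t. X t \<omega>) (T n \<omega>) = X (T n \<omega>) \<omega>"
    and h: "\<And>m. 0 < h m" "h \<longlonglongrightarrow> 0" and e: "0 < e"
  shows "(\<lambda>m. grid_error (h m) e i \<omega>) \<longlonglongrightarrow> drift_error e i \<omega>"
  unfolding grid_error_def drift_error_def using e
  by (intro tendsto_add tendsto_rabs tendsto_diff tendsto_divide tendsto_const grid_parts_tendsto[OF \<omega> nj h]) auto

lemma drift_error_tendsto: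
  assumes \<omega>: "\<omega> \<in> space M" and e: "\<And>k. 0 < e k" "e \<longlonglongrightarrow> 0"
  shows "(\<lambda>k. drift_error (e k) i \<omega>) \<longlonglongrightarrow> 0"
proof -
  have g: "0 \<le> gap i \<omega>" using gap_pos[OF \<omega>] by (rule less_imp_le)
  have e2: "(\<lambda>k. 2 * e k) \<longlonglongrightarrow> 0" "\<And>k. 0 < 2 * e k" using tendsto_mult[OF tendsto_const e(2), of 2] e(1) by auto
  have quot: "(\<lambda>k. (F (e k) - F 0) / e k - G) \<longlonglongrightarrow> 0" "(\<lambda>k. (F (2 * e k) - F (e k)) / e k - G) \<longlonglongrightarrow> 0"
      "(\<lambda>k. F (e k) - F 0) \<longlonglongrightarrow> 0"
    if 1: "(\<lambda>k. (F (e k) - F 0) / e k) \<longlonglongrightarrow> G" and 2: "(\<lambda>k. (F (2 * e k) - F 0) / (2 * e k)) \<longlonglongrightarrow> G"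
    for F :: "real \<Rightarrow> real" and G
  proof -
    show "(\<lambda>k. (F (e k) - F 0) / e k - G) \<longlonglongrightarrow> 0" using tendsto_diff[OF 1 tendsto_const[of G]] by simp
    have "(\<lambda>k. 2 * ((F (2 * e k) - F 0) / (2 * e k)) - (F (e k) - F 0) / e k - G) \<longlonglongrightarrow> 2 * G - G - G"
      by (intro tendsto_intros 1 2)
    moreover have "2 * ((F (2 * e k) - F 0) / (2 * e k)) - (F (e k) - F 0) / e k - G = (F (2 * e k) - F (e k)) / e k - G" for k
      using e(1)[of k] by (simp add: field_simps)
    ultimately show "(\<lambda>k. (F (2 * e k) - F (e k)) / e k - G) \<longlonglongrightarrow> 0" by simp
    have "(\<lambda>k. e k * ((F (e k) - F 0) / e k)) \<longlonglongrightarrow> 0 * G" by (intro tendsto_mult e 1)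
    moreover have "e k * ((F (e k) - F 0) / e k) = F (e k) - F 0" for k using e(1)[of k] by simp
    ultimately show "(\<lambda>k. F (e k) - F 0) \<longlonglongrightarrow> 0" by simp
  qed
  have s: "fst (sup_part i \<omega>) = drift_sup 0 i \<omega>" "snd (sup_part i \<omega>) = last_sup_time (\<lambda>s. seg i s \<omega>) (gap i \<omega>)"
    "fst (inf_part i \<omega>) = drift_inf 0 i \<omega>" "snd (inf_part i \<omega>) = first_inf_time (\<lambda>s. seg i s \<omega>) (gap i \<omega>)"
    by (simp_all add: sup_part_def inf_part_def drift_sup_def drift_inf_def)
  have "(\<lambda>k. (drift_sup (e k) i \<omega> - drift_sup 0 i \<omega>) / e k) \<longlonglongrightarrow> snd (sup_part i \<omega>)"
    "(\<lambda>k. (drift_sup (2 * e k) i \<omega> - drift_sup 0 i \<omega>) / (2 * e k)) \<longlonglongrightarrow> snd (sup_part i \<omega>)"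
    unfolding s drift_sup_def
    using last_sup_time_derivative[OF seg_cadlag[OF \<omega>] g e(2,1)] last_sup_time_derivative[OF seg_cadlag[OF \<omega>] g e2] by simp_all
  note sup = quot[OF this]
  have "(\<lambda>k. (drift_inf (e k) i \<omega> - drift_inf 0 i \<omega>) / e k) \<longlonglongrightarrow> snd (inf_part i \<omega>)"
    "(\<lambda>k. (drift_inf (2 * e k) i \<omega> - drift_inf 0 i \<omega>) / (2 * e k)) \<longlonglongrightarrow> snd (inf_part i \<omega>)"
    unfolding s drift_inf_def
    using first_inf_time_derivative[OF seg_cadlag[OF \<omega>] g e(2,1)] first_inf_time_derivative[OF seg_cadlag[OF \<omega>] g e2] by simp_all
  note inf = quot[OF this]
  have "(\<lambda>k. seg i (gap i \<omega>) \<omega> + e k * gap i \<omega> - seg i (gap i \<omega>) \<omega>) \<longlonglongrightarrow> 0"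
    using tendsto_mult[OF e(2) tendsto_const[of "gap i \<omega>"]] by simp
  moreover have "(\<lambda>k. gap i \<omega> - gap i \<omega>) \<longlonglongrightarrow> 0" by simp
  ultimately have "(\<lambda>k. drift_error (e k) i \<omega>) \<longlonglongrightarrow> \<bar>0\<bar> + \<bar>0\<bar> + \<bar>0\<bar> + \<bar>0\<bar> + \<bar>0\<bar> + \<bar>0\<bar> + \<bar>0\<bar> + \<bar>0\<bar>"
    unfolding drift_error_def s(1,3) by (intro tendsto_add tendsto_rabs sup inf)
  then show ?thesis by simp
qed

lemma grid_error_bounds:
  assumes e: "0 < e" and h: "0 < h"
  shows "\<bar>fst (grid_sup h e i \<omega>) - fst (sup_part i \<omega>)\<bar> \<le> grid_error h e i \<omega>"
    "\<bar>snd (grid_sup h e i \<omega>) - snd (sup_part i \<omega>)\<bar> \<le> grid_error h e i \<omega>"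
    "\<bar>fst (grid_inf h e i \<omega>) - fst (inf_part i \<omega>)\<bar> \<le> grid_error h e i \<omega>"
    "\<bar>snd (grid_inf h e i \<omega>) - snd (inf_part i \<omega>)\<bar> \<le> grid_error h e i \<omega>"
    "\<bar>fst (grid_rest h e i \<omega>) - fst (rest_part i \<omega>)\<bar> \<le> grid_error h e i \<omega>"
    "\<bar>snd (grid_rest h e i \<omega>) - snd (rest_part i \<omega>)\<bar> \<le> grid_error h e i \<omega>"
proof -
  have r: "fst (grid_rest h e i \<omega>) = walk (seg_steps h e i \<omega>) (seg_len h i \<omega>) - fst (grid_sup h e i \<omega>)"
    "fst (rest_part i \<omega>) = seg i (gap i \<omega>) \<omega> - fst (sup_part i \<omega>)"
    "snd (grid_rest h e i \<omega>) = h * real (seg_len h i \<omega>) - snd (grid_sup h e i \<omega>)"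
    "snd (rest_part i \<omega>) = gap i \<omega> - snd (sup_part i \<omega>)"
    using last_argmax_mem(1)[of "seg_steps h e i \<omega>" "seg_len h i \<omega>"]
    by (simp_all add: grid_rest_def grid_sup_def rest_part_def of_nat_diff algebra_simps)
  define t where "t = [fst (grid_sup h e i \<omega>) - fst (sup_part i \<omega>),
     (fst (grid_sup h e i \<omega>) - fst (grid_sup h 0 i \<omega>)) / e - snd (sup_part i \<omega>),
     (fst (grid_sup h (2 * e) i \<omega>) - fst (grid_sup h e i \<omega>)) / e - snd (sup_part i \<omega>),
     walk (seg_steps h e i \<omega>) (seg_len h i \<omega>) - seg i (gap i \<omega>) \<omega>,
     h * real (seg_len h i \<omega>) - gap i \<omega>,
     fst (grid_inf h e i \<omega>) - fst (inf_part i \<omega>),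
     (fst (grid_inf h e i \<omega>) - fst (grid_inf h 0 i \<omega>)) / e - snd (inf_part i \<omega>),
     (fst (grid_inf h (2 * e) i \<omega>) - fst (grid_inf h e i \<omega>)) / e - snd (inf_part i \<omega>)]"
  define a where "a j = \<bar>t ! j\<bar>" for j
  have a: "0 \<le> a j" for j by (simp add: a_def)
  have err: "grid_error h e i \<omega> = a 0 + a 1 + a 2 + a 3 + a 4 + a 5 + a 6 + a 7"
    unfolding grid_error_def a_def t_def by simp
  have small: "a 0 \<le> grid_error h e i \<omega>" "a 1 + a 2 \<le> grid_error h e i \<omega>" "a 0 + a 3 \<le> grid_error h e i \<omega>"
    "a 1 + a 2 + a 4 \<le> grid_error h e i \<omega>" "a 5 \<le> grid_error h e i \<omega>" "a 6 + a 7 \<le> grid_error h e i \<omega>"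
    unfolding err using a[of 0] a[of 1] a[of 2] a[of 3] a[of 4] a[of 5] a[of 6] a[of 7] by linarith+
  have b1: "\<bar>snd (grid_sup h e i \<omega>) - snd (sup_part i \<omega>)\<bar> \<le> a 1 + a 2"
    using grid_sup_time_bounds[OF e, of h i \<omega>] by (simp add: a_def t_def)
  have b2: "\<bar>snd (grid_inf h e i \<omega>) - snd (inf_part i \<omega>)\<bar> \<le> a 6 + a 7"
    using grid_inf_time_bounds[OF e, of h i \<omega>] by (simp add: a_def t_def)
  have a0: "a 0 = \<bar>fst (grid_sup h e i \<omega>) - fst (sup_part i \<omega>)\<bar>"
    "a 5 = \<bar>fst (grid_inf h e i \<omega>) - fst (inf_part i \<omega>)\<bar>"
    "a 3 = \<bar>walk (seg_steps h e i \<omega>) (seg_len h i \<omega>) - seg i (gap i \<omega>) \<omega>\<bar>"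
    "a 4 = \<bar>h * real (seg_len h i \<omega>) - gap i \<omega>\<bar>"
    by (simp_all add: a_def t_def)
  show "\<bar>fst (grid_sup h e i \<omega>) - fst (sup_part i \<omega>)\<bar> \<le> grid_error h e i \<omega>"
    "\<bar>fst (grid_inf h e i \<omega>) - fst (inf_part i \<omega>)\<bar> \<le> grid_error h e i \<omega>"
    using small a0 by simp_all
  show "\<bar>snd (grid_sup h e i \<omega>) - snd (sup_part i \<omega>)\<bar> \<le> grid_error h e i \<omega>"
    "\<bar>snd (grid_inf h e i \<omega>) - snd (inf_part i \<omega>)\<bar> \<le> grid_error h e i \<omega>"
    by (rule order_trans[OF b1 small(2)], rule order_trans[OF b2 small(6)])
  show "\<bar>fst (grid_rest h e i \<omega>) - fst (rest_part i \<omega>)\<bar> \<le> grid_error h e i \<omega>"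
    unfolding r using small(3) a0(1,3) by linarith
  show "\<bar>snd (grid_rest h e i \<omega>) - snd (rest_part i \<omega>)\<bar> \<le> grid_error h e i \<omega>"
    unfolding r using small(4) a0(4) b1 by linarith
qed

text \<open>  For a fixed drift the error converges as the grid is refined, and its limit vanishes with the drift.
  The drift cannot be tied to the mesh by a formula, because the speed of the first convergence depends on the path.\<close>

lemma grid_parts_converge:
  obtains h e :: "nat \<Rightarrow> real" where "\<And>l. 0 < h l"
    "AE \<omega> in M. \<forall>i<n. (\<lambda>l. grid_sup (h l) (e l) i \<omega>) \<longlonglongrightarrow> sup_part i \<omega> \<and>
       (\<lambda>l. grid_rest (h l) (e l) i \<omega>) \<longlonglongrightarrow> rest_part i \<omega> \<and>
       (\<lambda>l. grid_inf (h l) (e l) i \<omega>) \<longlonglongrightarrow> inf_part i \<omega>"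
proof -
  define s where "s k = 1 / real (Suc k)" for k
  have s: "0 < s k" for k by (simp add: s_def)
  have s0: "s \<longlonglongrightarrow> 0" unfolding s_def by (rule LIMSEQ_Suc[OF lim_const_over_n])
  obtain a b where ab: "AE \<omega> in M. (\<lambda>l. \<Sum>i<n. grid_error (s (b l)) (s (a l)) i \<omega>) \<longlonglongrightarrow> 0"
  proof (rule AE_diagonal_subsequence[where u="\<lambda>k m \<omega>. \<Sum>i<n. grid_error (s m) (s k) i \<omega>" and v="\<lambda>k \<omega>. \<Sum>i<n. drift_error (s k) i \<omega>"])
    show "(\<lambda>\<omega>. \<Sum>i<n. grid_error (s m) (s k) i \<omega>) \<in> borel_measurable M" for k m
      by (intro borel_measurable_sum grid_error_measurable s)
    show "(\<lambda>\<omega>. \<Sum>i<n. drift_error (s k) i \<omega>) \<in> borel_measurable M" for k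
      by (intro borel_measurable_sum drift_error_measurable)
    show "0 \<le> (\<Sum>i<n. grid_error (s m) (s k) i \<omega>)" for k m \<omega> by (intro sum_nonneg grid_error_nonneg)
    have "AE \<omega> in M. \<forall>n. left_lim (\<lambda>t. X t \<omega>) (T n \<omega>) = X (T n \<omega>) \<omega>"
      unfolding AE_all_countable by (intro allI AE_no_jump_at_epoch)
    then show "AE \<omega> in M. (\<lambda>m. \<Sum>i<n. grid_error (s m) (s k) i \<omega>) \<longlonglongrightarrow> (\<Sum>i<n. drift_error (s k) i \<omega>)" for k
      using AE_space by eventually_elim (intro tendsto_sum grid_error_tendsto s s0; simp)
    show "AE \<omega> in M. (\<lambda>k. \<Sum>i<n. drift_error (s k) i \<omega>) \<longlonglongrightarrow> 0"
    proof (rule AE_I2)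
      fix \<omega> assume "\<omega> \<in> space M"
      then have "(\<lambda>k. \<Sum>i<n. drift_error (s k) i \<omega>) \<longlonglongrightarrow> (\<Sum>i<n. 0)"
        by (intro tendsto_sum drift_error_tendsto s s0)
      then show "(\<lambda>k. \<Sum>i<n. drift_error (s k) i \<omega>) \<longlonglongrightarrow> 0" by simp
    qed
  qed
  show thesis
  proof (rule that)
    show "0 < s (b l)" for l by (rule s)
    show "AE \<omega> in M. \<forall>i<n. (\<lambda>l. grid_sup (s (b l)) (s (a l)) i \<omega>) \<longlonglongrightarrow> sup_part i \<omega> \<and>
       (\<lambda>l. grid_rest (s (b l)) (s (a l)) i \<omega>) \<longlonglongrightarrow> rest_part i \<omega> \<and>
       (\<lambda>l. grid_inf (s (b l)) (s (a l)) i \<omega>) \<longlonglongrightarrow> inf_part i \<omega>"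
      using ab
    proof eventually_elim
      case (elim \<omega>)
      show ?case
      proof (intro allI impI)
        fix i assume i: "i < n"
        have err: "(\<lambda>l. grid_error (s (b l)) (s (a l)) i \<omega>) \<longlonglongrightarrow> 0"
        proof (rule tendsto_sandwich[OF _ _ tendsto_const elim])
          have "grid_error (s (b l)) (s (a l)) i \<omega> \<le> (\<Sum>i<n. grid_error (s (b l)) (s (a l)) i \<omega>)" for l
            using i by (intro member_le_sum grid_error_nonneg) auto
          then show "\<forall>\<^sub>F l in sequentially. grid_error (s (b l)) (s (a l)) i \<omega> \<le> (\<Sum>i<n. grid_error (s (b l)) (s (a l)) i \<omega>)"
            by simp
        qed (simp add: grid_error_nonneg)
        have lim: "u \<longlonglongrightarrow> c" if "\<And>l. \<bar>fst (u l) - fst c\<bar> \<le> grid_error (s (b l)) (s (a l)) i \<omega>"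
          "\<And>l. \<bar>snd (u l) - snd c\<bar> \<le> grid_error (s (b l)) (s (a l)) i \<omega>" for u :: "nat \<Rightarrow> real \<times> real" and c
        proof -
          have "(\<lambda>l. fst (u l)) \<longlonglongrightarrow> fst c" "(\<lambda>l. snd (u l)) \<longlonglongrightarrow> snd c"
            by (rule Lim_transform_bound[OF _ err, THEN Lim_null[THEN iffD2]], use that in \<open>simp add: abs_of_nonneg grid_error_nonneg\<close>)+
          from tendsto_Pair[OF this] show ?thesis by simp
        qed
        show "(\<lambda>l. grid_sup (s (b l)) (s (a l)) i \<omega>) \<longlonglongrightarrow> sup_part i \<omega> \<and>
          (\<lambda>l. grid_rest (s (b l)) (s (a l)) i \<omega>) \<longlonglongrightarrow> rest_part i \<omega> \<and>
          (\<lambda>l. grid_inf (s (b l)) (s (a l)) i \<omega>) \<longlonglongrightarrow> inf_part i \<omega>"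
          by (intro conjI lim grid_error_bounds s)
      qed
    qed
  qed
qed

end

section \<open>Wiener-Hopf factorization between the epochs\<close>

text \<open>Continuous functions that converge to the indicator of an open set. The whole space is treated separately
  because the distance to the empty set is \<open>0\<close> by convention.\<close>

definition bump :: "nat \<Rightarrow> 'b::metric_space set \<Rightarrow> 'b \<Rightarrow> real" where
  "bump k A x = (if A = UNIV then 1 else min 1 (real k * infdist x (- A)))"

lemma bump_range: "0 \<le> bump k A x" "bump k A x \<le> 1"
  by (simp_all add: bump_def infdist_nonneg)

lemma bump_continuous: "isCont (bump k A) x"
  unfolding bump_def[abs_def] by (cases "A = UNIV") (auto intro!: continuous_intros)

lemma bump_tendsto:
  assumes "open A" shows "(\<lambda>k. bump k A x) \<longlonglongrightarrow> indicator A x"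
proof (cases "A = UNIV")
  case True
  then show ?thesis by (simp add: bump_def)
next
  case False
  then have ne: "- A \<noteq> {}" by auto
  show ?thesis
  proof (cases "x \<in> A")
    case True
    have "infdist x (- A) \<noteq> 0"
      using in_closed_iff_infdist_zero[of "- A" x] assms ne True by (auto simp: closed_def)
    then have d: "0 < infdist x (- A)" using infdist_nonneg[of x "- A"] by linarith
    obtain n where "1 / infdist x (- A) < real n" using reals_Archimedean2 by blast
    then have n: "1 < real n * infdist x (- A)" using d by (simp add: field_simps)
    have "bump k A x = 1" if "n \<le> k" for k
    proof -
      have "real n * infdist x (- A) \<le> real k * infdist x (- A)" using that d by (intro mult_right_mono) auto
      then show ?thesis using n False by (simp add: bump_def)
    qed
    then have "\<forall>\<^sub>F k in sequentially. bump k A x = 1" unfolding eventually_sequentially by blast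
    then show ?thesis using True by (simp add: tendsto_eventually)
  next
    case F: False
    then show ?thesis using False by (simp add: bump_def)
  qed
qed

context levy_poisson begin

lemma expectation_eq_nn_integral:
  fixes F :: "'a \<Rightarrow> real"
  assumes "F \<in> borel_measurable M" "\<And>\<omega>. 0 \<le> F \<omega>" "\<And>\<omega>. F \<omega> \<le> 1"
  shows "(\<integral>\<^sup>+\<omega>. ennreal (F \<omega>) \<partial>M) = ennreal (expectation F)"
  using assms by (intro nn_integral_eq_integral integrable_const_bound[where B=1]) auto

lemma expectation_grid_factorization:
  fixes f g :: "nat \<Rightarrow> real \<times> real \<Rightarrow> real"
  assumes h: "0 < h" and f [measurable]: "\<And>i. f i \<in> borel_measurable (borel \<Otimes>\<^sub>M borel)"
    and g [measurable]: "\<And>i. g i \<in> borel_measurable (borel \<Otimes>\<^sub>M borel)"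
    and r: "\<And>i x. 0 \<le> f i x" "\<And>i x. f i x \<le> 1" "\<And>i x. 0 \<le> g i x" "\<And>i x. g i x \<le> 1"
  shows "expectation (\<lambda>\<omega>. \<Prod>i<n. f i (grid_sup h e i \<omega>) * g i (grid_rest h e i \<omega>)) =
    (\<Prod>i<n. expectation (\<lambda>\<omega>. f i (grid_sup h e 0 \<omega>)) * expectation (\<lambda>\<omega>. g i (grid_inf h e 0 \<omega>)))"
proof -
  let ?P = "\<lambda>\<omega>. \<Prod>i<n. f i (grid_sup h e i \<omega>) * g i (grid_rest h e i \<omega>)"
  let ?a = "\<lambda>i. expectation (\<lambda>\<omega>. f i (grid_sup h e 0 \<omega>))"
  let ?b = "\<lambda>i. expectation (\<lambda>\<omega>. g i (grid_inf h e 0 \<omega>))"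
  note [measurable] = grid_measurable[OF h]
  have pos: "0 \<le> ?a i" "0 \<le> ?b i"
    "0 \<le> expectation (\<lambda>\<omega>. ?P \<omega>)" for i
    by (intro integral_nonneg_AE AE_I2 prod_nonneg mult_nonneg_nonneg ballI r)+
  have "ennreal (expectation (\<lambda>\<omega>. ?P \<omega>)) =
    (\<integral>\<^sup>+\<omega>. ennreal (?P \<omega>) \<partial>M)"
    by (intro expectation_eq_nn_integral[symmetric] prod_nonneg prod_le_1 mult_nonneg_nonneg mult_le_one conjI ballI r) measurable
  also have "\<dots> = (\<integral>\<^sup>+\<omega>. (\<Prod>i<n. ennreal (f i (grid_sup h e i \<omega>)) * ennreal (g i (grid_rest h e i \<omega>))) \<partial>M)"
    by (simp add: prod_ennreal ennreal_mult[symmetric] r)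
  also have "\<dots> = (\<Prod>i<n. (\<integral>\<^sup>+\<omega>. ennreal (f i (grid_sup h e 0 \<omega>)) \<partial>M) * (\<integral>\<^sup>+\<omega>. ennreal (g i (grid_inf h e 0 \<omega>)) \<partial>M))"
    by (rule grid_factorization[OF h]) measurable
  also have "\<dots> = (\<Prod>i<n. ennreal (?a i) * ennreal (?b i))"
    by (intro prod.cong refl arg_cong2[where f="(*)"] expectation_eq_nn_integral r) measurable
  also have "\<dots> = ennreal (\<Prod>i<n. ?a i * ?b i)"
    by (simp add: prod_ennreal ennreal_mult[symmetric] pos)
  finally show ?thesis
    by (subst (asm) ennreal_inj) (intro pos prod_nonneg mult_nonneg_nonneg ballI)+
qed

lemma expectation_parts_continuous:
  fixes f g :: "nat \<Rightarrow> real \<times> real \<Rightarrow> real"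
  assumes f: "\<And>i x. isCont (f i) x" and g: "\<And>i x. isCont (g i) x"
    and r: "\<And>i x. 0 \<le> f i x" "\<And>i x. f i x \<le> 1" "\<And>i x. 0 \<le> g i x" "\<And>i x. g i x \<le> 1"
  shows "expectation (\<lambda>\<omega>. \<Prod>i<n. f i (sup_part i \<omega>) * g i (rest_part i \<omega>)) =
    (\<Prod>i<n. expectation (\<lambda>\<omega>. f i (sup_part 0 \<omega>)) * expectation (\<lambda>\<omega>. g i (inf_part 0 \<omega>)))"
proof -
  have [measurable]: "f i \<in> borel_measurable (borel \<Otimes>\<^sub>M borel)" "g i \<in> borel_measurable (borel \<Otimes>\<^sub>M borel)" for i
    unfolding borel_prod by (intro borel_measurable_continuous_onI continuous_at_imp_continuous_on ballI f g)+
  obtain h e :: "nat \<Rightarrow> real" where h: "\<And>l. 0 < h l" and conv: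
    "AE \<omega> in M. \<forall>i<Suc n. (\<lambda>l. grid_sup (h l) (e l) i \<omega>) \<longlonglongrightarrow> sup_part i \<omega> \<and>
       (\<lambda>l. grid_rest (h l) (e l) i \<omega>) \<longlonglongrightarrow> rest_part i \<omega> \<and>
       (\<lambda>l. grid_inf (h l) (e l) i \<omega>) \<longlonglongrightarrow> inf_part i \<omega>"
    using grid_parts_converge[of "Suc n"] by blast
  let ?P = "\<lambda>l \<omega>. \<Prod>i<n. f i (grid_sup (h l) (e l) i \<omega>) * g i (grid_rest (h l) (e l) i \<omega>)"
  note [measurable] = grid_measurable[OF h]
  have 1: "(\<lambda>l. expectation (\<lambda>\<omega>. ?P l \<omega>))
    \<longlonglongrightarrow> expectation (\<lambda>\<omega>. \<Prod>i<n. f i (sup_part i \<omega>) * g i (rest_part i \<omega>))"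
  proof (rule integral_dominated_convergence[where w="\<lambda>_. 1"])
    show "AE \<omega> in M. (\<lambda>l. ?P l \<omega>)
      \<longlonglongrightarrow> (\<Prod>i<n. f i (sup_part i \<omega>) * g i (rest_part i \<omega>))"
      using conv by eventually_elim (intro tendsto_prod tendsto_mult isCont_tendsto_compose[OF f] isCont_tendsto_compose[OF g]; simp)
    show "AE \<omega> in M. norm (?P l \<omega>) \<le> 1" for l
    proof (rule AE_I2)
      fix \<omega>
      have "0 \<le> (?P l \<omega>)"
        by (intro prod_nonneg mult_nonneg_nonneg ballI r)
      moreover have "(?P l \<omega>) \<le> 1"
        by (intro prod_le_1 conjI mult_nonneg_nonneg mult_le_one r)
      ultimately show "norm (?P l \<omega>) \<le> 1" by simp
    qed
  qed measurable
  have 2: "(\<lambda>l. expectation (\<lambda>\<omega>. f i (grid_sup (h l) (e l) 0 \<omega>))) \<longlonglongrightarrow> expectation (\<lambda>\<omega>. f i (sup_part 0 \<omega>))" for i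
  proof (rule integral_dominated_convergence[where w="\<lambda>_. 1"])
    show "AE \<omega> in M. (\<lambda>l. f i (grid_sup (h l) (e l) 0 \<omega>)) \<longlonglongrightarrow> f i (sup_part 0 \<omega>)"
      using conv by eventually_elim (intro isCont_tendsto_compose[OF f]; simp)
  qed (use r in auto)
  have 3: "(\<lambda>l. expectation (\<lambda>\<omega>. g i (grid_inf (h l) (e l) 0 \<omega>))) \<longlonglongrightarrow> expectation (\<lambda>\<omega>. g i (inf_part 0 \<omega>))" for i
  proof (rule integral_dominated_convergence[where w="\<lambda>_. 1"])
    show "AE \<omega> in M. (\<lambda>l. g i (grid_inf (h l) (e l) 0 \<omega>)) \<longlonglongrightarrow> g i (inf_part 0 \<omega>)"
      using conv by eventually_elim (intro isCont_tendsto_compose[OF g]; simp)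
  qed (use r in auto)
  have "(\<lambda>l. \<Prod>i<n. expectation (\<lambda>\<omega>. f i (grid_sup (h l) (e l) 0 \<omega>)) * expectation (\<lambda>\<omega>. g i (grid_inf (h l) (e l) 0 \<omega>)))
    \<longlonglongrightarrow> (\<Prod>i<n. expectation (\<lambda>\<omega>. f i (sup_part 0 \<omega>)) * expectation (\<lambda>\<omega>. g i (inf_part 0 \<omega>)))"
    by (intro tendsto_prod tendsto_mult 2 3)
  moreover have "expectation (\<lambda>\<omega>. ?P l \<omega>) =
    (\<Prod>i<n. expectation (\<lambda>\<omega>. f i (grid_sup (h l) (e l) 0 \<omega>)) * expectation (\<lambda>\<omega>. g i (grid_inf (h l) (e l) 0 \<omega>)))" for l
    by (rule expectation_grid_factorization[OF h]) (measurable, (rule r)+)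
  ultimately show ?thesis using 1 LIMSEQ_unique by simp
qed

lemma prob_parts_open:
  fixes A B :: "nat \<Rightarrow> (real \<times> real) set"
  assumes A: "\<And>i. open (A i)" and B: "\<And>i. open (B i)"
  shows "prob {\<omega> \<in> space M. \<forall>i<n. sup_part i \<omega> \<in> A i \<and> rest_part i \<omega> \<in> B i} =
    (\<Prod>i<n. prob {\<omega> \<in> space M. sup_part 0 \<omega> \<in> A i} * prob {\<omega> \<in> space M. inf_part 0 \<omega> \<in> B i})"
proof -
  let ?P = "\<lambda>k \<omega>. \<Prod>i<n. bump k (A i) (sup_part i \<omega>) * bump k (B i) (rest_part i \<omega>)"
  let ?I = "\<lambda>\<omega>. \<Prod>i<n. indicat_real (A i) (sup_part i \<omega>) * indicat_real (B i) (rest_part i \<omega>)"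
  have [measurable]: "A i \<in> sets (borel \<Otimes>\<^sub>M borel)" "B i \<in> sets (borel \<Otimes>\<^sub>M borel)" for i
    unfolding borel_prod using A B by auto
  have bump [measurable]: "bump k C \<in> borel_measurable (borel \<Otimes>\<^sub>M borel)" for k and C :: "(real \<times> real) set"
    unfolding borel_prod by (intro borel_measurable_continuous_onI continuous_at_imp_continuous_on ballI bump_continuous)
  have 1: "(\<lambda>k. expectation (\<lambda>\<omega>. ?P k \<omega>))
    \<longlonglongrightarrow> expectation (\<lambda>\<omega>. ?I \<omega>)"
  proof (rule integral_dominated_convergence[where w="\<lambda>_. 1"])
    show "AE \<omega> in M. (\<lambda>k. ?P k \<omega>)
      \<longlonglongrightarrow> (?I \<omega>)"
      by (intro AE_I2 tendsto_prod tendsto_mult bump_tendsto A B)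
    show "AE \<omega> in M. norm (?P k \<omega>) \<le> 1" for k
    proof (rule AE_I2)
      fix \<omega>
      have "0 \<le> (?P k \<omega>)"
        by (intro prod_nonneg mult_nonneg_nonneg ballI bump_range)
      moreover have "(?P k \<omega>) \<le> 1"
        by (intro prod_le_1 conjI mult_nonneg_nonneg mult_le_one bump_range)
      ultimately show "norm (?P k \<omega>) \<le> 1" by simp
    qed
  qed measurable
  have 2: "(\<lambda>k. expectation (\<lambda>\<omega>. bump k C (Z \<omega>))) \<longlonglongrightarrow> expectation (\<lambda>\<omega>. indicat_real C (Z \<omega>))"
    if C: "open C" and [measurable]: "Z \<in> M \<rightarrow>\<^sub>M borel \<Otimes>\<^sub>M borel" for C and Z :: "'a \<Rightarrow> real \<times> real"
  proof (rule integral_dominated_convergence[where w="\<lambda>_. 1"])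
    have [measurable]: "C \<in> sets (borel \<Otimes>\<^sub>M borel)" unfolding borel_prod using C by auto
    show "(\<lambda>\<omega>. indicat_real C (Z \<omega>) :: real) \<in> borel_measurable M" by measurable
    show "AE \<omega> in M. norm (bump k C (Z \<omega>)) \<le> 1" for k
      by (intro AE_I2) (simp add: abs_of_nonneg bump_range)
    show "AE \<omega> in M. (\<lambda>k. bump k C (Z \<omega>)) \<longlonglongrightarrow> indicat_real C (Z \<omega>)"
      by (intro AE_I2 bump_tendsto C)
  qed measurable
  have "(\<lambda>k. \<Prod>i<n. expectation (\<lambda>\<omega>. bump k (A i) (sup_part 0 \<omega>)) * expectation (\<lambda>\<omega>. bump k (B i) (inf_part 0 \<omega>)))
    \<longlonglongrightarrow> (\<Prod>i<n. expectation (\<lambda>\<omega>. indicat_real (A i) (sup_part 0 \<omega>)) * expectation (\<lambda>\<omega>. indicat_real (B i) (inf_part 0 \<omega>)))"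
    by (intro tendsto_prod tendsto_mult 2 A B part_measurable)
  moreover have "expectation (\<lambda>\<omega>. ?P k \<omega>) =
    (\<Prod>i<n. expectation (\<lambda>\<omega>. bump k (A i) (sup_part 0 \<omega>)) * expectation (\<lambda>\<omega>. bump k (B i) (inf_part 0 \<omega>)))" for k
    by (rule expectation_parts_continuous) (rule bump_continuous bump_range)+
  ultimately have eq: "expectation (\<lambda>\<omega>. ?I \<omega>) =
    (\<Prod>i<n. expectation (\<lambda>\<omega>. indicat_real (A i) (sup_part 0 \<omega>)) * expectation (\<lambda>\<omega>. indicat_real (B i) (inf_part 0 \<omega>)))"
    using 1 LIMSEQ_unique by simp
  have ind: "expectation (\<lambda>\<omega>. indicat_real C (Z \<omega>)) = prob {\<omega> \<in> space M. Z \<omega> \<in> C}"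
    if [measurable]: "C \<in> sets (borel \<Otimes>\<^sub>M borel)" "Z \<in> M \<rightarrow>\<^sub>M borel \<Otimes>\<^sub>M borel" for C and Z :: "'a \<Rightarrow> real \<times> real"
  proof -
    have "expectation (\<lambda>\<omega>. indicat_real C (Z \<omega>)) = expectation (indicat_real {\<omega> \<in> space M. Z \<omega> \<in> C})"
      by (intro Bochner_Integration.integral_cong) (auto simp: indicator_def)
    then show ?thesis by simp
  qed
  have "expectation (\<lambda>\<omega>. ?I \<omega>) =
    expectation (indicat_real {\<omega> \<in> space M. \<forall>i<n. sup_part i \<omega> \<in> A i \<and> rest_part i \<omega> \<in> B i})"
  proof (rule Bochner_Integration.integral_cong[OF refl])
    fix \<omega> assume "\<omega> \<in> space M"
    then show "(?I \<omega>) =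
      (indicat_real {\<omega> \<in> space M. \<forall>i<n. sup_part i \<omega> \<in> A i \<and> rest_part i \<omega> \<in> B i} \<omega> :: real)"
      by (auto simp: indicator_def prod_zero_iff intro!: prod.neutral)
  qed
  also have "\<dots> = prob {\<omega> \<in> space M. \<forall>i<n. sup_part i \<omega> \<in> A i \<and> rest_part i \<omega> \<in> B i}"
    by simp
  finally show ?thesis using eq by (simp add: ind)
qed

text \<open>The two kinds of parts form one sequence, in the order of time, so that one statement expresses
  their joint independence.\<close>

definition part :: "nat \<Rightarrow> 'a \<Rightarrow> real \<times> real" where
  "part j = (if even j then sup_part (j div 2) else rest_part (j div 2))"

lemma part_rv [measurable]: "part j \<in> M \<rightarrow>\<^sub>M borel \<Otimes>\<^sub>M borel"
  unfolding part_def by simp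

lemma prob_part_open:
  assumes "open C"
  shows "prob {\<omega> \<in> space M. part j \<omega> \<in> C} =
    (if even j then prob {\<omega> \<in> space M. sup_part 0 \<omega> \<in> C} else prob {\<omega> \<in> space M. inf_part 0 \<omega> \<in> C})"
proof -
  let ?n = "Suc (j div 2)"
  let ?A = "\<lambda>i. if even j \<and> i = j div 2 then C else UNIV" and ?B = "\<lambda>i. if odd j \<and> i = j div 2 then C else UNIV"
  have "{\<omega> \<in> space M. part j \<omega> \<in> C} = {\<omega> \<in> space M. \<forall>i<?n. sup_part i \<omega> \<in> ?A i \<and> rest_part i \<omega> \<in> ?B i}"
    unfolding part_def by auto
  then have "prob {\<omega> \<in> space M. part j \<omega> \<in> C} =
    (\<Prod>i<?n. prob {\<omega> \<in> space M. sup_part 0 \<omega> \<in> ?A i} * prob {\<omega> \<in> space M. inf_part 0 \<omega> \<in> ?B i})"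
    using prob_parts_open[of ?A ?B ?n] assms by simp
  also have "\<dots> = (if even j then prob {\<omega> \<in> space M. sup_part 0 \<omega> \<in> C} else prob {\<omega> \<in> space M. inf_part 0 \<omega> \<in> C})"
    by (auto simp: prob_space intro!: prod.neutral)
  finally show ?thesis .
qed

text \<open>  The open sets form a generator that is stable under intersections.\<close>

theorem part_indep: "indep_vars (\<lambda>_. borel \<Otimes>\<^sub>M borel) part UNIV"
proof -
  have "indep_vars (\<lambda>_. borel \<Otimes>\<^sub>M borel) part {..<2 * Suc n}" for n
  proof (subst indep_vars_finite[where E="\<lambda>_. {C. open C}"])
    show "sets (borel \<Otimes>\<^sub>M borel) = sigma_sets (space (borel \<Otimes>\<^sub>M borel)) {C :: (real \<times> real) set. open C}"
      unfolding borel_prod by (simp add: borel_def)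
    show "Int_stable {C :: (real \<times> real) set. open C}" by (auto simp: Int_stable_def)
    show "\<forall>A\<in>{..<2 * Suc n} \<rightarrow> {C. open C}. prob (\<Inter>j\<in>{..<2 * Suc n}. part j -` A j \<inter> space M) =
      (\<Prod>j\<in>{..<2 * Suc n}. prob (part j -` A j \<inter> space M))"
    proof
      fix A :: "nat \<Rightarrow> (real \<times> real) set" assume "A \<in> {..<2 * Suc n} \<rightarrow> {C. open C}"
      then have A: "open (A j)" if "j < 2 * Suc n" for j using that by auto
      define A1 where "A1 i = (if i < Suc n then A (2 * i) else UNIV)" for i
      define B1 where "B1 i = (if i < Suc n then A (2 * i + 1) else UNIV)" for i
      have op: "open (A1 i)" "open (B1 i)" for i unfolding A1_def B1_def using A by auto
      have v: "part j -` C \<inter> space M = {\<omega> \<in> space M. part j \<omega> \<in> C}" for j C by auto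
      have "(\<Inter>j\<in>{..<2 * Suc n}. part j -` A j \<inter> space M) =
        {\<omega> \<in> space M. \<forall>i<Suc n. sup_part i \<omega> \<in> A1 i \<and> rest_part i \<omega> \<in> B1 i}"
      proof (intro set_eqI iffI)
        fix \<omega> assume a: "\<omega> \<in> (\<Inter>j\<in>{..<2 * Suc n}. part j -` A j \<inter> space M)"
        have w0: "\<omega> \<in> part j -` A j \<inter> space M" if "j < 2 * Suc n" for j
          by (rule INT_D[OF a]) (use that in simp)
        have w: "\<omega> \<in> space M" "\<And>j. j < 2 * Suc n \<Longrightarrow> part j \<omega> \<in> A j" using w0 w0[of 0] by simp_all
        have "sup_part i \<omega> \<in> A1 i \<and> rest_part i \<omega> \<in> B1 i" if "i < Suc n" for i
          using w(2)[of "2 * i"] w(2)[of "2 * i + 1"] that by (simp add: part_def A1_def B1_def)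
        then show "\<omega> \<in> {\<omega> \<in> space M. \<forall>i<Suc n. sup_part i \<omega> \<in> A1 i \<and> rest_part i \<omega> \<in> B1 i}" using w by simp
      next
        fix \<omega> assume "\<omega> \<in> {\<omega> \<in> space M. \<forall>i<Suc n. sup_part i \<omega> \<in> A1 i \<and> rest_part i \<omega> \<in> B1 i}"
        then have w: "\<omega> \<in> space M" "\<And>i. i < Suc n \<Longrightarrow> sup_part i \<omega> \<in> A1 i \<and> rest_part i \<omega> \<in> B1 i" by auto
        have "part j \<omega> \<in> A j" if "j < 2 * Suc n" for j
          using w(2)[of "j div 2"] that by (auto simp: part_def A1_def B1_def split: if_splits)
        then show "\<omega> \<in> (\<Inter>j\<in>{..<2 * Suc n}. part j -` A j \<inter> space M)" using w(1) by (intro INT_I) simp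
      qed
      then have "prob (\<Inter>j\<in>{..<2 * Suc n}. part j -` A j \<inter> space M) =
        (\<Prod>i<Suc n. prob {\<omega> \<in> space M. sup_part 0 \<omega> \<in> A1 i} * prob {\<omega> \<in> space M. inf_part 0 \<omega> \<in> B1 i})"
        using prob_parts_open[of A1 B1 "Suc n", OF op] by simp
      also have "\<dots> = (\<Prod>i<Suc n. prob (part (2 * i) -` A (2 * i) \<inter> space M) * prob (part (2 * i + 1) -` A (2 * i + 1) \<inter> space M))"
        by (intro prod.cong refl) (simp add: v prob_part_open A A1_def B1_def)
      also have "\<dots> = (\<Prod>j\<in>{..<2 * Suc n}. prob (part j -` A j \<inter> space M))"
      proof -
        have "(\<Prod>i<m. u (2 * i) * u (2 * i + 1)) = (\<Prod>j<2 * m. u j)" for m and u :: "nat \<Rightarrow> real"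
          by (induction m) (simp_all add: mult.assoc)
        then show ?thesis .
      qed
      finally show "prob (\<Inter>j\<in>{..<2 * Suc n}. part j -` A j \<inter> space M) =
        (\<Prod>j\<in>{..<2 * Suc n}. prob (part j -` A j \<inter> space M))" .
    qed
  qed (auto simp: space_pair_measure)
  note fin = this
  have "indep_vars (\<lambda>_. borel \<Otimes>\<^sub>M borel) part {..<n}" for n
    by (rule indep_vars_subset[OF fin[of n]]) auto
  then show ?thesis by (rule indep_vars_nat_if_initial)
qed

lemma part_law:
  "distr M (borel \<Otimes>\<^sub>M borel) (part j) = distr M (borel \<Otimes>\<^sub>M borel) (if even j then sup_part 0 else inf_part 0)"
proof (rule measure_eqI_generator_eq[where E="{C. open C}" and \<Omega>=UNIV and A="\<lambda>_. UNIV"])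
  show "Int_stable {C :: (real \<times> real) set. open C}" by (auto simp: Int_stable_def)
  fix C :: "(real \<times> real) set" assume "C \<in> {C. open C}"
  then have C: "open C" by simp
  then have [measurable]: "C \<in> sets (borel \<Otimes>\<^sub>M borel)" unfolding borel_prod by auto
  show "emeasure (distr M (borel \<Otimes>\<^sub>M borel) (part j)) C = emeasure (distr M (borel \<Otimes>\<^sub>M borel) (if even j then sup_part 0 else inf_part 0)) C"
    using prob_part_open[OF C, of j]
    by (subst (1 2) emeasure_distr) (auto simp: emeasure_eq_measure vimage_def Int_def conj_commute)
next
  interpret D: prob_space "distr M (borel \<Otimes>\<^sub>M borel) (part j)" by (rule prob_space_distr) (rule part_rv)
  show "emeasure (distr M (borel \<Otimes>\<^sub>M borel) (part j)) UNIV \<noteq> \<infinity>" by simp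
  have "sets (borel \<Otimes>\<^sub>M borel) = sigma_sets UNIV {C :: (real \<times> real) set. open C}"
    unfolding borel_prod by (simp add: borel_def)
  then show "sets (distr M (borel \<Otimes>\<^sub>M borel) (part j)) = sigma_sets UNIV {C. open C}"
    "sets (distr M (borel \<Otimes>\<^sub>M borel) (if even j then sup_part 0 else inf_part 0)) = sigma_sets UNIV {C. open C}"
    by simp_all
qed auto

lemma sup_law_eq: "sup_law M X T = distr M (borel \<Otimes>\<^sub>M borel) (sup_part 0)"
  and inf_law_eq: "inf_law M X T = distr M (borel \<Otimes>\<^sub>M borel) (inf_part 0)"
proof -
  have 1: "(\<lambda>\<omega>. running_sup (\<lambda>t. X t \<omega> + 0 * t) (T 1 \<omega>)) \<in> borel_measurable M"
    "(\<lambda>\<omega>. running_inf (\<lambda>t. X t \<omega> + 0 * t) (T 1 \<omega>)) \<in> borel_measurable M"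
    "(\<lambda>\<omega>. last_sup_time (\<lambda>t. X t \<omega>) (T 1 \<omega>)) \<in> borel_measurable M"
    "(\<lambda>\<omega>. first_inf_time (\<lambda>t. X t \<omega>) (T 1 \<omega>)) \<in> borel_measurable M"
    by (intro measurable_running_sup_drift measurable_running_inf_drift measurable_last_sup_time measurable_first_inf_time
      measurable_process cadlag_paths T_measurable T_nonneg; assumption)+
  then have "(\<lambda>\<omega>. running_sup (\<lambda>t. X t \<omega>) (T 1 \<omega>)) \<in> borel_measurable M"
    "(\<lambda>\<omega>. running_inf (\<lambda>t. X t \<omega>) (T 1 \<omega>)) \<in> borel_measurable M" by simp_all
  note 2 = this
  have "AE \<omega> in M. sup_part 0 \<omega> = (running_sup (\<lambda>t. X t \<omega>) (T 1 \<omega>), last_sup_time (\<lambda>t. X t \<omega>) (T 1 \<omega>)) \<and>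
    inf_part 0 \<omega> = (running_inf (\<lambda>t. X t \<omega>) (T 1 \<omega>), first_inf_time (\<lambda>t. X t \<omega>) (T 1 \<omega>))"
    using start_zero AE_space
    by eventually_elim (simp add: sup_part_def inf_part_def seg_def gap_def epoch_zero)
  then have ae: "AE \<omega> in M. sup_part 0 \<omega> = (running_sup (\<lambda>t. X t \<omega>) (T 1 \<omega>), last_sup_time (\<lambda>t. X t \<omega>) (T 1 \<omega>))"
    "AE \<omega> in M. inf_part 0 \<omega> = (running_inf (\<lambda>t. X t \<omega>) (T 1 \<omega>), first_inf_time (\<lambda>t. X t \<omega>) (T 1 \<omega>))"
    by auto
  show "sup_law M X T = distr M (borel \<Otimes>\<^sub>M borel) (sup_part 0)" unfolding sup_law_def
    by (rule distr_cong_AE[OF refl refl ae(1) part_measurable(1), symmetric]) (intro measurable_Pair 1 2)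
  show "inf_law M X T = distr M (borel \<Otimes>\<^sub>M borel) (inf_part 0)" unfolding inf_law_def
    by (rule distr_cong_AE[OF refl refl ae(2) part_measurable(2), symmetric]) (intro measurable_Pair 1 2)
qed

end

section \<open>Parisian ruin as ruin of the walk of suprema\<close>

definition hits :: "nat \<Rightarrow> (nat \<Rightarrow> real) \<Rightarrow> nat \<Rightarrow> bool" where
  "hits r s n \<longleftrightarrow> r \<le> n \<and> (\<forall>j\<in>{n - r..n}. s j < 0)"

definition first_hit :: "nat \<Rightarrow> (nat \<Rightarrow> real) \<Rightarrow> nat \<Rightarrow> bool" where
  "first_hit r s n \<longleftrightarrow> hits r s n \<and> (\<forall>m<n. \<not> hits r s m)"

lemma first_hit_cong:
  assumes "\<And>j. j \<le> n \<Longrightarrow> s j = s' j" shows "first_hit r s n = first_hit r s' n"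
  using assms unfolding first_hit_def hits_def by auto

lemma first_hit_Suc:
  assumes s0: "0 \<le> s 0"
  shows "\<not> first_hit r s 0" "first_hit r s (Suc n) \<longleftrightarrow> first_hit r (\<lambda>j. s (Suc j)) n"
proof -
  have 0: "\<not> hits r s 0" using s0 by (auto simp: hits_def)
  have S: "hits r s (Suc n) \<longleftrightarrow> hits r (\<lambda>j. s (Suc j)) n" for n
  proof (cases "r \<le> n")
    case True
    then have im: "{Suc n - r..Suc n} = Suc ` {n - r..n}" by (simp add: Suc_diff_le image_Suc_atLeastAtMost)
    have "(\<forall>j\<in>Suc ` {n - r..n}. s j < 0) \<longleftrightarrow> (\<forall>j\<in>{n - r..n}. s (Suc j) < 0)" by blast
    with True show ?thesis by (simp only: hits_def im le_SucI[OF True] simp_thms)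
  next
    case False
    have "\<not> hits r s (Suc n)"
    proof
      assume h: "hits r s (Suc n)"
      then have "r = Suc n" using False by (simp add: hits_def)
      then show False using h s0 by (force simp: hits_def)
    qed
    then show ?thesis using False by (simp add: hits_def)
  qed
  show "\<not> first_hit r s 0" using 0 by (simp add: first_hit_def)
  show "first_hit r s (Suc n) \<longleftrightarrow> first_hit r (\<lambda>j. s (Suc j)) n"
    unfolding first_hit_def S All_less_Suc2 using 0 by simp
qed

lemma sets_first_hit:
  assumes s: "\<And>j. (\<lambda>x. s x j) \<in> borel_measurable N"
  shows "{x \<in> space N. first_hit r (s x) n} \<in> sets N"
  unfolding first_hit_def hits_def
  by (intro sets.sets_Collect_conj sets.sets_Collect_countable_Ball sets.sets_Collect_countable_All sets.sets_Collect_imp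
      sets.sets_Collect_neg sets.sets_Collect_const borel_measurable_less s borel_measurable_const)

lemma ruin_functional_at_epochs:
  assumes T: "strict_mono T" and \<tau>: "\<tau> x T = (INF i\<in>{i. H i}. ereal (T i))"
  shows "ennreal (ruin_functional \<alpha> \<beta> \<tau> x T) =
      (\<Sum>n. of_bool (H n \<and> (\<forall>m<n. \<not> H m)) * ennreal (exp (- \<alpha> * T n + \<beta> * x (T n))))" (is ?sum)
    and "(\<And>i. H i \<Longrightarrow> 0 \<le> T i \<and> x (T i) < 0) \<Longrightarrow> 0 \<le> \<alpha> \<Longrightarrow> 0 \<le> \<beta> \<Longrightarrow> ruin_functional \<alpha> \<beta> \<tau> x T \<le> 1"
proof -
  let ?le = "ruin_functional \<alpha> \<beta> \<tau> x T \<le> 1"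
  have "?sum \<and> ((\<forall>i. H i \<longrightarrow> 0 \<le> T i \<and> x (T i) < 0) \<longrightarrow> 0 \<le> \<alpha> \<longrightarrow> 0 \<le> \<beta> \<longrightarrow> ?le)"
  proof (cases "\<exists>i. H i")
    case True
    define i where "i = (LEAST i. H i)"
    have i: "H i" "\<And>m. m < i \<Longrightarrow> \<not> H m" using True by (auto simp: i_def LeastI_ex dest: not_less_Least)
    have "\<tau> x T = ereal (T i)" unfolding \<tau>
    proof (rule antisym)
      show "(INF i\<in>{i. H i}. ereal (T i)) \<le> ereal (T i)" using i by (intro INF_lower) auto
      show "ereal (T i) \<le> (INF i\<in>{i. H i}. ereal (T i))"
      proof (rule INF_greatest)
        fix m assume "m \<in> {i. H i}"
        then have "i \<le> m" using i(2)[of m] by force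
        then show "ereal (T i) \<le> ereal (T m)" using T by (simp add: strict_mono_less_eq)
      qed
    qed
    then have val: "ruin_functional \<alpha> \<beta> \<tau> x T = exp (- \<alpha> * T i + \<beta> * x (T i))" by (simp add: ruin_functional_def)
    have "(H n \<and> (\<forall>m<n. \<not> H m)) \<longleftrightarrow> n = i" for n using i by (metis linorder_neqE_nat)
    then have ?sum by (subst suminf_finite[of "{i}"]) (auto simp: val)
    moreover have "?le" if "0 \<le> T i \<and> x (T i) < 0" "0 \<le> \<alpha>" "0 \<le> \<beta>"
    proof -
      have "0 \<le> \<alpha> * T i" "\<beta> * x (T i) \<le> 0" using that by (auto intro: mult_nonneg_nonneg mult_nonneg_nonpos)
      then show ?thesis by (simp add: val)
    qed
    ultimately show ?thesis using i(1) by blast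
  next
    case False
    then have "{i. H i} = {}" by auto
    then have "\<tau> x T = \<infinity>" unfolding \<tau> by (simp only: image_empty Inf_empty top_ereal_def)
    then show ?thesis using False by (simp add: ruin_functional_def)
  qed
  then show ?sum "(\<And>i. H i \<Longrightarrow> 0 \<le> T i \<and> x (T i) < 0) \<Longrightarrow> 0 \<le> \<alpha> \<Longrightarrow> 0 \<le> \<beta> \<Longrightarrow> ?le" by blast+
qed

lemma ruin_functional_nonneg: "0 \<le> ruin_functional \<alpha> \<beta> \<tau> x T"
  by (simp add: ruin_functional_def)

text \<open>  Finitely many suprema are compared, so that the strict inequality passes to their maximum.\<close>

lemma SUP_epochs_less_iff:
  assumes x: "cadlag x" and T: "strict_mono T" "0 \<le> T 0" and n: "a \<le> n"
  shows "(SUP t\<in>{T a..T (Suc n)}. x t) < c \<longleftrightarrow> (\<forall>j\<in>{a..n}. (SUP t\<in>{T j..T (Suc j)}. x t) < (c :: real))"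
  using n
proof (induction n rule: dec_induct)
  case base
  then show ?case by simp
next
  case (step n)
  have T0: "0 \<le> T i" for i using T strict_mono_less_eq[OF T(1), of 0 i] by simp
  have le: "T a \<le> T (Suc n)" "T (Suc n) \<le> T (Suc (Suc n))" using step(1) strict_mono_less_eq[OF T(1)] by auto
  then have "{T a..T (Suc (Suc n))} = {T a..T (Suc n)} \<union> {T (Suc n)..T (Suc (Suc n))}" by auto
  then have "(SUP t\<in>{T a..T (Suc (Suc n))}. x t) = max (SUP t\<in>{T a..T (Suc n)}. x t) (SUP t\<in>{T (Suc n)..T (Suc (Suc n))}. x t)"
    using le cadlag_bdd_above[OF x T0] by (simp add: cSUP_union sup_max)
  moreover have "{a..Suc n} = insert (Suc n) {a..n}" using step(1) by auto
  ultimately show ?case using step(3) by auto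
qed

text \<open>  The contribution of ruin at step \<open>n\<close> for a walk that starts at \<open>v\<close>; the components of \<open>\<xi>\<close> are the steps
  and their durations.\<close>

definition walk_payoff :: "real \<Rightarrow> real \<Rightarrow> nat \<Rightarrow> real \<Rightarrow> (nat \<Rightarrow> real \<times> real) \<Rightarrow> nat \<Rightarrow> ennreal" where
  "walk_payoff \<alpha> \<beta> r v \<xi> n = of_bool (first_hit r (\<lambda>j. v + (\<Sum>i<j. fst (\<xi> i))) n) *
     ennreal (exp (- \<alpha> * (\<Sum>i<n. snd (\<xi> i)) + \<beta> * (v + (\<Sum>i<n. fst (\<xi> i)))))"

lemma walk_payoff_cong:
  assumes "\<And>i. i < n \<Longrightarrow> \<xi> i = \<xi>' i" shows "walk_payoff \<alpha> \<beta> r v \<xi> n = walk_payoff \<alpha> \<beta> r v \<xi>' n"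
proof -
  have s: "(\<Sum>i<j. f (\<xi> i)) = (\<Sum>i<j. f (\<xi>' i))" if "j \<le> n" for j and f :: "real \<times> real \<Rightarrow> real"
    using assms that by (intro sum.cong) auto
  have "first_hit r (\<lambda>j. v + (\<Sum>i<j. fst (\<xi> i))) n = first_hit r (\<lambda>j. v + (\<Sum>i<j. fst (\<xi>' i))) n"
    by (rule first_hit_cong) (simp add: s)
  then show ?thesis unfolding walk_payoff_def by (simp add: s)
qed

lemma walk_payoff_start_nonneg:
  assumes u: "0 \<le> u"
  shows "walk_payoff \<alpha> \<beta> r u \<xi> 0 = 0"
    "walk_payoff \<alpha> \<beta> r u (case_nat p \<xi>) (Suc n) = ennreal (exp (- \<alpha> * snd p)) * walk_payoff \<alpha> \<beta> r (u + fst p) \<xi> n"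
proof -
  show "walk_payoff \<alpha> \<beta> r u \<xi> 0 = 0"
    using first_hit_Suc(1)[of "\<lambda>j. u + (\<Sum>i<j. fst (\<xi> i))" r] u by (simp add: walk_payoff_def)
  have s: "(\<Sum>i<Suc j. f (case_nat p \<xi> i)) = f p + (\<Sum>i<j. f (\<xi> i))" for j and f :: "real \<times> real \<Rightarrow> real"
    by (simp only: sum.lessThan_Suc_shift nat.case)
  have "first_hit r (\<lambda>j. u + (\<Sum>i<j. fst (case_nat p \<xi> i))) (Suc n) = first_hit r (\<lambda>j. (u + fst p) + (\<Sum>i<j. fst (\<xi> i))) n"
    using u by (subst first_hit_Suc(2)) (simp_all only: s lessThan_0 sum.empty add_0_right add.assoc)
  then show "walk_payoff \<alpha> \<beta> r u (case_nat p \<xi>) (Suc n) = ennreal (exp (- \<alpha> * snd p)) * walk_payoff \<alpha> \<beta> r (u + fst p) \<xi> n"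
    unfolding walk_payoff_def s by (simp add: ennreal_mult[symmetric] exp_add[symmetric] algebra_simps)
qed

lemma measurable_walk_payoff:
  assumes v [measurable]: "v \<in> borel_measurable N" and \<xi>: "\<And>i. (\<lambda>x. \<xi> x i) \<in> N \<rightarrow>\<^sub>M borel \<Otimes>\<^sub>M borel"
  shows "(\<lambda>x. walk_payoff \<alpha> \<beta> r (v x) (\<xi> x) n) \<in> borel_measurable N"
proof -
  have [measurable]: "(\<lambda>x. fst (\<xi> x i)) \<in> borel_measurable N" "(\<lambda>x. snd (\<xi> x i)) \<in> borel_measurable N" for i
    using measurable_compose[OF \<xi> measurable_fst] measurable_compose[OF \<xi> measurable_snd] by auto
  have [measurable]: "Measurable.pred N (\<lambda>x. first_hit r (\<lambda>j. v x + (\<Sum>i<j. fst (\<xi> x i))) n)"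
    unfolding pred_def by (rule sets_first_hit) measurable
  show ?thesis unfolding walk_payoff_def by measurable
qed

context levy_poisson begin

abbreviation "B2 \<equiv> (borel \<Otimes>\<^sub>M borel :: (real \<times> real) measure)"
abbreviation "\<mu> \<equiv> sup_law M X T"
abbreviation "\<nu> \<equiv> inf_law M X T"

text \<open>  The law of a step of the observed walk together with its duration. Defining it as the law of a sum of
  independent parts makes it visible that the steps of the walk of suprema have the same law.\<close>

definition "\<rho> = distr (\<mu> \<Otimes>\<^sub>M \<nu>) B2 (\<lambda>(p, p'). p + p')"
abbreviation "Q \<equiv> \<Pi>\<^sub>M i\<in>(UNIV::nat set). \<rho>"

lemma sets_laws [measurable_cong, simp]: "sets \<mu> = sets B2" "sets \<nu> = sets B2" "sets \<rho> = sets B2"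
  by (simp_all add: sup_law_def inf_law_def \<rho>_def)

lemma measurable_plus_B2 [measurable]: "(\<lambda>(p, p'). p + p') \<in> B2 \<Otimes>\<^sub>M B2 \<rightarrow>\<^sub>M B2"
  unfolding plus_prod_def by measurable

lemma measurable_plus_B2' [measurable (raw)]:
  assumes [measurable]: "f \<in> N \<rightarrow>\<^sub>M B2" "g \<in> N \<rightarrow>\<^sub>M B2" shows "(\<lambda>x. f x + g x) \<in> N \<rightarrow>\<^sub>M B2"
  unfolding plus_prod_def by measurable

lemma prob_spaces: "prob_space \<mu>" "prob_space \<nu>" "prob_space \<rho>"
proof -
  show m: "prob_space \<mu>" "prob_space \<nu>" unfolding sup_law_eq inf_law_eq by (intro prob_space_distr part_measurable)+
  interpret m: prob_space \<mu> by (rule m)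
  interpret n: prob_space \<nu> by (rule m)
  interpret mn: pair_prob_space \<mu> \<nu> ..
  show "prob_space \<rho>" unfolding \<rho>_def by (intro mn.prob_space_distr) (simp cong: measurable_cong_sets)
qed

lemma part_law_cases:
  "even j \<Longrightarrow> distr M B2 (part j) = \<mu>" "odd j \<Longrightarrow> distr M B2 (part j) = \<nu>"
  using part_law[of j] by (simp_all add: sup_law_eq inf_law_eq)

lemma block_law:
  assumes "even a" "odd b" shows "distr M B2 (\<lambda>\<omega>. part a \<omega> + part b \<omega>) = \<rho>"
proof -
  have "a \<noteq> b" using assms by auto
  then have "indep_var B2 (part a) B2 (part b)"
    using indep_var_compose[OF indep_var_restrict[OF part_indep, of "{a}" "{b}"]
        measurable_component_singleton[of a] measurable_component_singleton[of b]]
    by (simp add: comp_def)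
  then have "distr M (B2 \<Otimes>\<^sub>M B2) (\<lambda>\<omega>. (part a \<omega>, part b \<omega>)) = \<mu> \<Otimes>\<^sub>M \<nu>"
    unfolding indep_var_distribution_eq using part_law_cases assms by simp
  then have "\<rho> = distr (distr M (B2 \<Otimes>\<^sub>M B2) (\<lambda>\<omega>. (part a \<omega>, part b \<omega>))) B2 (\<lambda>(p, p'). p + p')"
    by (simp add: \<rho>_def)
  also have "\<dots> = distr M B2 (\<lambda>\<omega>. part a \<omega> + part b \<omega>)"
    by (subst distr_distr) (simp_all add: comp_def)
  finally show ?thesis by simp
qed

text \<open>  The indices are left general because two groupings occur: a supremum followed by its own remainder gives the
  observed walk, and a remainder followed by the next supremum gives the walk of suprema.\<close>

lemma blocks_law:
  assumes par: "\<And>j. even (a j)" "\<And>j. odd (b j)" and disj: "disjoint_family (\<lambda>j. {a j, b j})"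
  shows "distr M (\<Pi>\<^sub>M j\<in>UNIV. B2) (\<lambda>\<omega> j. part (a j) \<omega> + part (b j) \<omega>) = Q"
proof -
  have "indep_vars (\<lambda>j. \<Pi>\<^sub>M i\<in>{a j, b j}. B2) (\<lambda>j \<omega>. \<lambda>i\<in>{a j, b j}. part i \<omega>) UNIV"
    by (rule indep_vars_restrict[OF part_indep]) (use disj in auto)
  then have "indep_vars (\<lambda>j. B2) (\<lambda>j \<omega>. (\<lambda>i\<in>{a j, b j}. part i \<omega>) (a j) + (\<lambda>i\<in>{a j, b j}. part i \<omega>) (b j)) UNIV"
    by (rule indep_vars_compose2) (intro measurable_plus_B2' measurable_component_singleton; simp)
  then have "indep_vars (\<lambda>j. B2) (\<lambda>j \<omega>. part (a j) \<omega> + part (b j) \<omega>) UNIV" by simp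
  then have "distr M (\<Pi>\<^sub>M j\<in>UNIV. B2) (\<lambda>\<omega>. \<lambda>j\<in>UNIV. part (a j) \<omega> + part (b j) \<omega>) =
      (\<Pi>\<^sub>M j\<in>UNIV. distr M B2 (\<lambda>\<omega>. part (a j) \<omega> + part (b j) \<omega>))"
    by (subst (asm) indep_vars_iff_distr_eq_PiM) auto
  then show ?thesis by (simp only: block_law[OF par(1) par(2)] restrict_UNIV)
qed

lemma nn_integral_blocks_after_zero:
  assumes par: "\<And>j. even (a j)" "\<And>j. odd (b j)" and disj: "disjoint_family (\<lambda>j. {a j, b j})"
    and a0: "\<And>j. a j \<noteq> 0" and G: "G \<in> borel_measurable (B2 \<Otimes>\<^sub>M (\<Pi>\<^sub>M j\<in>UNIV. B2))"
  shows "(\<integral>\<^sup>+\<omega>. G (part 0 \<omega>, \<lambda>j. part (a j) \<omega> + part (b j) \<omega>) \<partial>M) = (\<integral>\<^sup>+p. \<integral>\<^sup>+\<xi>. G (p, \<xi>) \<partial>Q \<partial>\<mu>)"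
proof -
  let ?Z = "\<lambda>\<omega> j. part (a j) \<omega> + part (b j) \<omega>"
  have "b j \<noteq> 0" for j using par(2)[of j] by (metis even_zero)
  then have m: "(\<lambda>y j. y (a j) + y (b j)) \<in> (\<Pi>\<^sub>M i\<in>- {0}. B2) \<rightarrow>\<^sub>M (\<Pi>\<^sub>M j\<in>UNIV. B2)"
    using a0 by (intro measurable_PiM_single' measurable_plus_B2' measurable_component_singleton) (auto simp: space_pair_measure)
  let ?R = "\<lambda>\<omega>. \<lambda>i\<in>{0::nat}. part i \<omega>"
  have "indep_var (\<Pi>\<^sub>M i\<in>{0}. B2) ?R (\<Pi>\<^sub>M i\<in>- {0}. B2) (\<lambda>\<omega>. \<lambda>i\<in>- {0}. part i \<omega>)"
    by (rule indep_var_restrict[OF part_indep]) auto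
  from indep_var_compose[OF this measurable_ident m]
  have "indep_var (\<Pi>\<^sub>M i\<in>{0}. B2) ?R (\<Pi>\<^sub>M j\<in>UNIV. B2) ?Z"
    using a0 \<open>\<And>j. b j \<noteq> 0\<close> by (simp add: comp_def)
  then have rv: "?Z \<in> M \<rightarrow>\<^sub>M (\<Pi>\<^sub>M j\<in>UNIV. B2)" "?R \<in> M \<rightarrow>\<^sub>M (\<Pi>\<^sub>M i\<in>{0}. B2)"
    and d: "distr M ((\<Pi>\<^sub>M i\<in>{0}. B2) \<Otimes>\<^sub>M (\<Pi>\<^sub>M j\<in>UNIV. B2)) (\<lambda>\<omega>. (?R \<omega>, ?Z \<omega>)) = distr M (\<Pi>\<^sub>M i\<in>{0}. B2) ?R \<Otimes>\<^sub>M Q"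
    unfolding indep_var_distribution_eq using blocks_law[OF par disj] by simp_all
  interpret R: prob_space \<rho> by (rule prob_spaces)
  interpret S: sequence_space \<rho> ..
  have sQ: "sets Q = sets (\<Pi>\<^sub>M j\<in>(UNIV::nat set). B2)" by (intro sets_PiM_cong) auto
  have G': "(\<lambda>(y, \<xi>). G (y 0, \<xi>)) \<in> borel_measurable ((\<Pi>\<^sub>M i\<in>{0::nat}. B2) \<Otimes>\<^sub>M (\<Pi>\<^sub>M j\<in>UNIV. B2))"
    using G by measurable
  have G'': "(\<lambda>(y, \<xi>). G (y 0, \<xi>)) \<in> borel_measurable (distr M (\<Pi>\<^sub>M i\<in>{0::nat}. B2) ?R \<Otimes>\<^sub>M Q)"
    using G' by (subst measurable_cong_sets[OF sets_pair_measure_cong[OF sets_distr sQ] refl])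
  have GQ: "(\<lambda>p. \<integral>\<^sup>+\<xi>. G (p, \<xi>) \<partial>Q) \<in> borel_measurable B2"
    by (rule S.P.borel_measurable_nn_integral_fst) (use G in \<open>subst measurable_cong_sets[OF sets_pair_measure_cong[OF refl sQ] refl]\<close>)
  have "(\<integral>\<^sup>+\<omega>. G (part 0 \<omega>, ?Z \<omega>) \<partial>M) = (\<integral>\<^sup>+(y, \<xi>). G (y 0, \<xi>) \<partial>distr M ((\<Pi>\<^sub>M i\<in>{0}. B2) \<Otimes>\<^sub>M (\<Pi>\<^sub>M j\<in>UNIV. B2)) (\<lambda>\<omega>. (?R \<omega>, ?Z \<omega>)))"
    using rv G' by (subst nn_integral_distr) auto
  also have "\<dots> = (\<integral>\<^sup>+y. \<integral>\<^sup>+\<xi>. G (y 0, \<xi>) \<partial>Q \<partial>distr M (\<Pi>\<^sub>M i\<in>{0}. B2) ?R)"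
    unfolding d by (subst S.P.nn_integral_fst[OF G'', symmetric]) simp
  also have "\<dots> = (\<integral>\<^sup>+\<omega>. \<integral>\<^sup>+\<xi>. G (part 0 \<omega>, \<xi>) \<partial>Q \<partial>M)"
  proof (subst nn_integral_distr[OF rv(2)])
    show "(\<lambda>y. \<integral>\<^sup>+\<xi>. G (y 0, \<xi>) \<partial>Q) \<in> borel_measurable (distr M (\<Pi>\<^sub>M i\<in>{0::nat}. B2) ?R)"
      unfolding measurable_distr_eq1 by (rule measurable_compose[OF _ GQ]) (rule measurable_component_singleton, simp)
  qed simp
  also have "\<dots> = (\<integral>\<^sup>+p. \<integral>\<^sup>+\<xi>. G (p, \<xi>) \<partial>Q \<partial>distr M B2 (part 0))"
    using GQ by (subst nn_integral_distr) auto
  finally show ?thesis using part_law_cases(1)[of 0] by simp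
qed


lemma part_even_add_odd:
  "part (2 * i) \<omega> + part (Suc (2 * i)) \<omega> = (X (T (Suc i) \<omega>) \<omega> - X (T i \<omega>) \<omega>, gap i \<omega>)"
  by (simp add: part_def rest_part_def seg_end)

lemma fst_part_even: "fst (part (2 * i) \<omega>) = running_sup (\<lambda>s. seg i s \<omega>) (gap i \<omega>)"
  by (simp add: part_def sup_part_def)

lemma sum_blocks:
  assumes \<omega>: "\<omega> \<in> space M"
  shows "(\<Sum>i<n. fst (part (2 * i) \<omega> + part (Suc (2 * i)) \<omega>)) = X (T n \<omega>) \<omega> - X 0 \<omega>"
    "(\<Sum>i<n. snd (part (2 * i) \<omega> + part (Suc (2 * i)) \<omega>)) = T n \<omega>"
  unfolding part_even_add_odd using epoch_zero[OF \<omega>] T_eq_sum_gap[OF \<omega>]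
  by (induction n) auto

text \<open>  Starting with the first supremum and grouping each remainder with the next supremum leads to the level
  and the time of the \<open>n\<close>-th supremum.\<close>

lemma sum_shifted_blocks:
  assumes \<omega>: "\<omega> \<in> space M"
  shows "fst (part 0 \<omega>) + (\<Sum>i<n. fst (part (Suc (Suc (2 * i))) \<omega> + part (Suc (2 * i)) \<omega>)) =
      X (T n \<omega>) \<omega> - X 0 \<omega> + fst (part (2 * n) \<omega>)"
    "snd (part 0 \<omega>) + (\<Sum>i<n. snd (part (Suc (Suc (2 * i))) \<omega> + part (Suc (2 * i)) \<omega>)) =
      T n \<omega> + snd (part (2 * n) \<omega>)"
proof (induction n)
  case (Suc n)
  have f: "fst (part (Suc (2 * n)) \<omega>) = X (T (Suc n) \<omega>) \<omega> - X (T n \<omega>) \<omega> - fst (part (2 * n) \<omega>)"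
    "snd (part (Suc (2 * n)) \<omega>) = T (Suc n) \<omega> - T n \<omega> - snd (part (2 * n) \<omega>)"
    using part_even_add_odd[of n \<omega>] by (auto simp: prod_eq_iff gap_def algebra_simps)
  case 1 show ?case using Suc(1) f by simp
  case 2 show ?case using Suc(2) f by simp
qed (simp_all add: epoch_zero[OF \<omega>])

text \<open>The initial value \<open>X 0\<close> vanishes only almost surely. It is kept in the pathwise formulas, so that they hold on
  the whole space and yield measurability.\<close>

lemma obs_functional_eq:
  assumes \<omega>: "\<omega> \<in> space M"
  shows "ennreal (ruin_functional \<alpha> \<beta> (parisian_ruin_obs r) (\<lambda>t. v + X t \<omega>) (\<lambda>i. T i \<omega>)) =
      (\<Sum>n. walk_payoff \<alpha> \<beta> r (v + X 0 \<omega>) (\<lambda>j. part (2 * j) \<omega> + part (Suc (2 * j)) \<omega>) n)"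
    and "0 \<le> \<alpha> \<Longrightarrow> 0 \<le> \<beta> \<Longrightarrow> ruin_functional \<alpha> \<beta> (parisian_ruin_obs r) (\<lambda>t. v + X t \<omega>) (\<lambda>i. T i \<omega>) \<le> 1"
proof -
  let ?H = "hits r (\<lambda>j. v + X (T j \<omega>) \<omega>)"
  have \<tau>: "parisian_ruin_obs r (\<lambda>t. v + X t \<omega>) (\<lambda>i. T i \<omega>) = (INF i\<in>{i. ?H i}. ereal (T i \<omega>))"
    by (simp add: parisian_ruin_obs_def hits_def)
  note R = ruin_functional_at_epochs[OF epochs_increasing[OF \<omega>], where \<tau>="parisian_ruin_obs r" and H="?H", OF \<tau>]
  show "ennreal (ruin_functional \<alpha> \<beta> (parisian_ruin_obs r) (\<lambda>t. v + X t \<omega>) (\<lambda>i. T i \<omega>)) =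
      (\<Sum>n. walk_payoff \<alpha> \<beta> r (v + X 0 \<omega>) (\<lambda>j. part (2 * j) \<omega> + part (Suc (2 * j)) \<omega>) n)"
    unfolding R(1) walk_payoff_def sum_blocks[OF \<omega>] first_hit_def by (simp add: add.assoc)
  show "ruin_functional \<alpha> \<beta> (parisian_ruin_obs r) (\<lambda>t. v + X t \<omega>) (\<lambda>i. T i \<omega>) \<le> 1" if "0 \<le> \<alpha>" "0 \<le> \<beta>"
    using T_nonneg[OF \<omega>] by (intro R(2) that) (auto simp: hits_def)
qed

lemma SUP_segment_eq:
  assumes \<omega>: "\<omega> \<in> space M"
  shows "(SUP t\<in>{T j \<omega>..T (Suc j) \<omega>}. v + X t \<omega>) = v + X (T j \<omega>) \<omega> + fst (part (2 * j) \<omega>)"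
proof -
  have "cadlag (\<lambda>t. v + X t \<omega>)"
    using cadlag_restart[OF cadlag_paths[OF \<omega>] order_refl, of "- v"] by (simp add: add.commute)
  moreover have "T j \<omega> \<le> T (Suc j) \<omega>" using gap_pos[OF \<omega>, of j] by (simp add: gap_def)
  ultimately show ?thesis
    using running_sup_restart[of "\<lambda>t. v + X t \<omega>" "T j \<omega>" "T (Suc j) \<omega>" 0] T_nonneg[OF \<omega>, of j]
    by (simp add: fst_part_even seg_def gap_def)
qed

text \<open>  Ruin at the epoch \<open>n + 1\<close> means a first run of \<open>k - 1\<close> negative suprema that ends with segment \<open>n\<close>.
  At that epoch the path is at the \<open>n\<close>-th supremum plus the remainder of segment \<open>n\<close>, which splits the
  exponential.\<close>

lemma cont_functional_eq:
  assumes \<omega>: "\<omega> \<in> space M" and k: "2 \<le> k"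
  shows "ennreal (ruin_functional \<alpha> \<beta> (parisian_ruin_cont k) (\<lambda>t. v + X t \<omega>) (\<lambda>i. T i \<omega>)) =
      (\<Sum>n. walk_payoff \<alpha> \<beta> (k - 2) (v + X 0 \<omega> + fst (part 0 \<omega>)) (\<lambda>j. part (Suc (Suc (2 * j))) \<omega> + part (Suc (2 * j)) \<omega>) n *
        ennreal (exp (- \<alpha> * snd (part 0 \<omega>))) * ennreal (exp (- \<alpha> * snd (part (Suc (2 * n)) \<omega>) + \<beta> * fst (part (Suc (2 * n)) \<omega>))))"
    and "0 \<le> \<alpha> \<Longrightarrow> 0 \<le> \<beta> \<Longrightarrow> ruin_functional \<alpha> \<beta> (parisian_ruin_cont k) (\<lambda>t. v + X t \<omega>) (\<lambda>i. T i \<omega>) \<le> 1"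
proof -
  let ?x = "\<lambda>t. v + X t \<omega>" and ?T = "\<lambda>i. T i \<omega>"
  let ?G = "\<lambda>r n. walk_payoff \<alpha> \<beta> r (v + X 0 \<omega> + fst (part 0 \<omega>)) (\<lambda>j. part (Suc (Suc (2 * j))) \<omega> + part (Suc (2 * j)) \<omega>) n *
        ennreal (exp (- \<alpha> * snd (part 0 \<omega>))) * ennreal (exp (- \<alpha> * snd (part (Suc (2 * n)) \<omega>) + \<beta> * fst (part (Suc (2 * n)) \<omega>)))"
  define r where "r = k - 2"
  have k_eq: "k = r + 2" using k by (simp add: r_def)
  have x: "cadlag ?x"
    using cadlag_restart[OF cadlag_paths[OF \<omega>] order_refl, of "- v"] by (simp add: add.commute)
  have mono: "strict_mono ?T" by (rule epochs_increasing[OF \<omega>])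
  define s where "s j = (SUP t\<in>{?T j..?T (Suc j)}. ?x t)" for j
  define H where "H i \<longleftrightarrow> (\<exists>n. i = Suc n \<and> hits r s n)" for i
  have H_iff: "k - 1 \<le> i \<and> (SUP t\<in>{?T (i + 1 - k)..?T i}. ?x t) < 0 \<longleftrightarrow> H i" for i
  proof (cases i)
    case 0
    then show ?thesis using k by (simp add: H_def)
  next
    case (Suc n)
    have "(SUP t\<in>{?T (n - r)..?T (Suc n)}. ?x t) < 0 \<longleftrightarrow> (\<forall>j\<in>{n - r..n}. s j < 0)"
      unfolding s_def using T_nonneg[OF \<omega>] by (intro SUP_epochs_less_iff x mono) auto
    then show ?thesis unfolding H_def hits_def Suc k_eq by simp
  qed
  have \<tau>: "parisian_ruin_cont k ?x ?T = (INF i\<in>{i. H i}. ereal (?T i))"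
    unfolding parisian_ruin_cont_def H_iff ..
  note R = ruin_functional_at_epochs[OF mono, where \<tau>="parisian_ruin_cont k" and H=H, OF \<tau>]
  have H0: "\<not> H 0" and HS: "H (Suc n) \<longleftrightarrow> hits r s n" for n by (auto simp: H_def)
  have first: "H (Suc n) \<and> (\<forall>m<Suc n. \<not> H m) \<longleftrightarrow> first_hit r s n" for n
    unfolding All_less_Suc2 HS first_hit_def using H0 by simp
  have s_eq: "s j = (v + X 0 \<omega> + fst (part 0 \<omega>)) + (\<Sum>i<j. fst (part (Suc (Suc (2 * i))) \<omega> + part (Suc (2 * i)) \<omega>))" for j
    using SUP_segment_eq[OF \<omega>, where v=v and j=j] sum_shifted_blocks(1)[OF \<omega>, of j] by (simp add: s_def)
  have term_eq: "of_bool (H (Suc n) \<and> (\<forall>m<Suc n. \<not> H m)) * ennreal (exp (- \<alpha> * T (Suc n) \<omega> + \<beta> * (v + X (T (Suc n) \<omega>) \<omega>))) =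
    ?G r n" for n
  proof -
    let ?\<xi> = "\<lambda>j. part (Suc (Suc (2 * j))) \<omega> + part (Suc (2 * j)) \<omega>"
    have e: "fst (part (2 * n) \<omega>) + fst (part (Suc (2 * n)) \<omega>) = X (T (Suc n) \<omega>) \<omega> - X (T n \<omega>) \<omega>"
      "snd (part (2 * n) \<omega>) + snd (part (Suc (2 * n)) \<omega>) = T (Suc n) \<omega> - T n \<omega>"
      using part_even_add_odd[of n \<omega>] by (auto simp: prod_eq_iff gap_def)
    have tm: "T (Suc n) \<omega> = (\<Sum>i<n. snd (?\<xi> i)) + snd (part 0 \<omega>) + snd (part (Suc (2 * n)) \<omega>)"
      using sum_shifted_blocks(2)[OF \<omega>, of n] e(2) by linarith
    have xs: "v + X (T (Suc n) \<omega>) \<omega> = v + X 0 \<omega> + fst (part 0 \<omega>) + (\<Sum>i<n. fst (?\<xi> i)) + fst (part (Suc (2 * n)) \<omega>)"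
      using sum_shifted_blocks(1)[OF \<omega>, of n] e(1) by linarith
    have "exp (- \<alpha> * T (Suc n) \<omega> + \<beta> * (v + X (T (Suc n) \<omega>) \<omega>)) =
      exp (- \<alpha> * (\<Sum>i<n. snd (?\<xi> i)) + \<beta> * (v + X 0 \<omega> + fst (part 0 \<omega>) + (\<Sum>i<n. fst (?\<xi> i)))) *
      exp (- \<alpha> * snd (part 0 \<omega>)) * exp (- \<alpha> * snd (part (Suc (2 * n)) \<omega>) + \<beta> * fst (part (Suc (2 * n)) \<omega>))"
      unfolding xs unfolding tm exp_add[symmetric] by (simp add: algebra_simps)
    moreover have "first_hit r s n = first_hit r (\<lambda>j. (v + X 0 \<omega> + fst (part 0 \<omega>)) + (\<Sum>i<j. fst (?\<xi> i))) n"
      by (rule first_hit_cong) (rule s_eq)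
    ultimately show ?thesis unfolding first walk_payoff_def by (simp add: ennreal_mult mult.assoc)
  qed
  have "(\<Sum>n. of_bool (H n \<and> (\<forall>m<n. \<not> H m)) * ennreal (exp (- \<alpha> * T n \<omega> + \<beta> * (v + X (T n \<omega>) \<omega>)))) =
    (\<Sum>n. of_bool (H (Suc n) \<and> (\<forall>m<Suc n. \<not> H m)) * ennreal (exp (- \<alpha> * T (Suc n) \<omega> + \<beta> * (v + X (T (Suc n) \<omega>) \<omega>))))"
    by (subst suminf_offset[of _ 1]) (simp_all add: H0)
  then show "ennreal (ruin_functional \<alpha> \<beta> (parisian_ruin_cont k) ?x ?T) =
      (\<Sum>n. ?G (k - 2) n)"
    unfolding R(1) term_eq r_def[symmetric] .
  show "ruin_functional \<alpha> \<beta> (parisian_ruin_cont k) ?x ?T \<le> 1" if "0 \<le> \<alpha>" "0 \<le> \<beta>"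
  proof (rule R(2)[OF _ that])
    fix i assume "H i"
    then obtain n where n: "i = Suc n" "hits r s n" by (auto simp: H_def)
    have "?x (?T (Suc n)) \<le> s n"
      unfolding s_def using T_nonneg[OF \<omega>, of n] gap_pos[OF \<omega>, of n] by (intro cSUP_upper cadlag_bdd_above[OF x]) (auto simp: gap_def)
    also have "s n < 0" using n(2) by (auto simp: hits_def)
    finally show "0 \<le> ?T i \<and> ?x (?T i) < 0" using n T_nonneg[OF \<omega>] by simp
  qed
qed


definition obs_value :: "real \<Rightarrow> real \<Rightarrow> nat \<Rightarrow> real \<Rightarrow> ennreal" where
  "obs_value \<alpha> \<beta> r v = (\<integral>\<^sup>+\<xi>. (\<Sum>n. walk_payoff \<alpha> \<beta> r v \<xi> n) \<partial>Q)"

definition rest_factor :: "real \<Rightarrow> real \<Rightarrow> ennreal" where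
  "rest_factor \<alpha> \<beta> = (\<integral>\<^sup>+p. ennreal (exp (- \<alpha> * snd p + \<beta> * fst p)) \<partial>\<nu>)"

lemma sets_Q: "sets Q = sets (\<Pi>\<^sub>M j\<in>(UNIV::nat set). B2)"
  by (intro sets_PiM_cong) auto

lemma Q_component: "(\<lambda>\<xi>. \<xi> i) \<in> Q \<rightarrow>\<^sub>M B2"
  by (subst measurable_cong_sets[OF sets_Q refl]) (rule measurable_component_singleton, simp)

lemma measurable_walk_payoff_Q:
  "(\<lambda>(v, \<xi>). walk_payoff \<alpha> \<beta> r v \<xi> n) \<in> borel_measurable (borel \<Otimes>\<^sub>M Q)"
  unfolding case_prod_beta'
  by (intro measurable_walk_payoff measurable_fst) (rule measurable_compose[OF measurable_snd Q_component])

lemma measurable_obs_value [measurable]: "obs_value \<alpha> \<beta> r \<in> borel_measurable borel"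
proof -
  interpret R: prob_space \<rho> by (rule prob_spaces)
  interpret S: sequence_space \<rho> ..
  have "(\<lambda>(v, \<xi>). \<Sum>n. walk_payoff \<alpha> \<beta> r v \<xi> n) \<in> borel_measurable (borel \<Otimes>\<^sub>M Q)"
    using measurable_walk_payoff_Q[of \<alpha> \<beta> r] unfolding case_prod_beta' by (intro borel_measurable_suminf_order)
  from S.P.borel_measurable_nn_integral[OF this] show ?thesis unfolding obs_value_def[abs_def] .
qed

lemma expectation_from_eq:
  assumes m: "(\<lambda>\<omega>. ennreal (F (\<lambda>t. v + X t \<omega>) (\<lambda>i. T i \<omega>))) \<in> borel_measurable M"
    and F0: "\<And>x t. 0 \<le> F x t" and F1: "\<And>\<omega>. \<omega> \<in> space M \<Longrightarrow> F (\<lambda>t. v + X t \<omega>) (\<lambda>i. T i \<omega>) \<le> 1"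
  shows "ennreal (expectation_from M X T v F) = (\<integral>\<^sup>+\<omega>. ennreal (F (\<lambda>t. v + X t \<omega>) (\<lambda>i. T i \<omega>)) \<partial>M)"
    "0 \<le> expectation_from M X T v F"
proof -
  have m': "(\<lambda>\<omega>. F (\<lambda>t. v + X t \<omega>) (\<lambda>i. T i \<omega>)) \<in> borel_measurable M"
  proof -
    have "(\<lambda>\<omega>. enn2real (ennreal (F (\<lambda>t. v + X t \<omega>) (\<lambda>i. T i \<omega>)))) \<in> borel_measurable M" using m by measurable
    then show ?thesis using F0 by simp
  qed
  have "integrable M (\<lambda>\<omega>. F (\<lambda>t. v + X t \<omega>) (\<lambda>i. T i \<omega>))"
    using m' F0 F1 by (intro integrable_const_bound[where B=1] AE_I2) auto
  then show "ennreal (expectation_from M X T v F) = (\<integral>\<^sup>+\<omega>. ennreal (F (\<lambda>t. v + X t \<omega>) (\<lambda>i. T i \<omega>)) \<partial>M)"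
    unfolding expectation_from_def by (intro nn_integral_eq_integral[symmetric] AE_I2 F0)
  show "0 \<le> expectation_from M X T v F" unfolding expectation_from_def by (intro integral_nonneg_AE AE_I2 F0)
qed

lemma X0_measurable: "X 0 \<in> borel_measurable M" by (rule measurable_process) simp

lemma expectation_obs:
  assumes "0 \<le> \<alpha>" "0 \<le> \<beta>"
  shows "ennreal (expectation_from M X T v (ruin_functional \<alpha> \<beta> (parisian_ruin_obs r))) = obs_value \<alpha> \<beta> r v"
    "0 \<le> expectation_from M X T v (ruin_functional \<alpha> \<beta> (parisian_ruin_obs r))"
proof -
  let ?\<xi> = "\<lambda>\<omega> j. part (2 * j) \<omega> + part (Suc (2 * j)) \<omega>"
  let ?F = "\<lambda>\<omega>. ruin_functional \<alpha> \<beta> (parisian_ruin_obs r) (\<lambda>t. v + X t \<omega>) (\<lambda>i. T i \<omega>)"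
  have pm: "(\<lambda>\<omega>. walk_payoff \<alpha> \<beta> r (v + X 0 \<omega>) (?\<xi> \<omega>) n) \<in> borel_measurable M" for n
    by (intro measurable_walk_payoff borel_measurable_add borel_measurable_const X0_measurable measurable_plus_B2' part_rv)
  have m: "(\<lambda>\<omega>. ennreal (?F \<omega>)) \<in> borel_measurable M"
    by (subst measurable_cong[OF obs_functional_eq(1)]) (auto intro: borel_measurable_suminf_order[OF pm])
  have F1: "?F \<omega> \<le> 1" if "\<omega> \<in> space M" for \<omega> by (rule obs_functional_eq(2)[OF that assms])
  have E: "ennreal (expectation_from M X T v (ruin_functional \<alpha> \<beta> (parisian_ruin_obs r))) = (\<integral>\<^sup>+\<omega>. ennreal (?F \<omega>) \<partial>M)"
    "0 \<le> expectation_from M X T v (ruin_functional \<alpha> \<beta> (parisian_ruin_obs r))"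
    by (rule expectation_from_eq[OF m ruin_functional_nonneg], rule F1, assumption)+
  show "0 \<le> expectation_from M X T v (ruin_functional \<alpha> \<beta> (parisian_ruin_obs r))" by (rule E(2))
  have "AE \<omega> in M. ennreal (?F \<omega>) = (\<Sum>n. walk_payoff \<alpha> \<beta> r v (?\<xi> \<omega>) n)"
    using start_zero AE_space by eventually_elim (simp add: obs_functional_eq(1))
  then have "(\<integral>\<^sup>+\<omega>. ennreal (?F \<omega>) \<partial>M) = (\<integral>\<^sup>+\<omega>. (\<Sum>n. walk_payoff \<alpha> \<beta> r v (?\<xi> \<omega>) n) \<partial>M)"
    by (rule nn_integral_cong_AE)
  also have "\<dots> = (\<integral>\<^sup>+\<xi>. (\<Sum>n. walk_payoff \<alpha> \<beta> r v \<xi> n) \<partial>distr M (\<Pi>\<^sub>M j\<in>UNIV. B2) ?\<xi>)"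
  proof (rule nn_integral_distr[symmetric])
    show "?\<xi> \<in> M \<rightarrow>\<^sub>M (\<Pi>\<^sub>M j\<in>UNIV. B2)"
      by (intro measurable_PiM_single' measurable_plus_B2' part_rv) (auto simp: space_pair_measure)
    show "(\<lambda>\<xi>. \<Sum>n. walk_payoff \<alpha> \<beta> r v \<xi> n) \<in> borel_measurable (distr M (\<Pi>\<^sub>M j\<in>UNIV. B2) ?\<xi>)"
      unfolding measurable_distr_eq1
      by (intro borel_measurable_suminf_order measurable_walk_payoff borel_measurable_const measurable_component_singleton) simp
  qed
  also have "distr M (\<Pi>\<^sub>M j\<in>UNIV. B2) ?\<xi> = Q"
  proof (rule blocks_law)
    show "disjoint_family (\<lambda>j. {2 * j, Suc (2 * j)})"
      unfolding disjoint_family_on_def by (auto; presburger)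
  qed auto
  finally show "ennreal (expectation_from M X T v (ruin_functional \<alpha> \<beta> (parisian_ruin_obs r))) = obs_value \<alpha> \<beta> r v"
    unfolding E(1) obs_value_def by simp
qed

text \<open>  The remainder at ruin is independent of the walk of suprema up to ruin, but it also enters the next step of this walk.
  Since step \<open>n\<close> of the walk is the last one that matters, the later steps may be replaced by steps built from
  other parts; the whole sequence is then independent of the remainder and of the first supremum.\<close>

lemma expectation_cont:
  assumes "0 \<le> \<alpha>" "0 \<le> \<beta>" and k: "2 \<le> k"
  shows "ennreal (expectation_from M X T v (ruin_functional \<alpha> \<beta> (parisian_ruin_cont k))) =
      (\<integral>\<^sup>+p. ennreal (exp (- \<alpha> * snd p)) * obs_value \<alpha> \<beta> (k - 2) (v + fst p) \<partial>\<mu>) * rest_factor \<alpha> \<beta>"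
    "0 \<le> expectation_from M X T v (ruin_functional \<alpha> \<beta> (parisian_ruin_cont k))"
proof -
  interpret R: prob_space \<rho> by (rule prob_spaces)
  interpret S: sequence_space \<rho> ..
  define r where "r = k - 2"
  let ?\<xi> = "\<lambda>\<omega> j. part (Suc (Suc (2 * j))) \<omega> + part (Suc (2 * j)) \<omega>"
  let ?F = "\<lambda>\<omega>. ruin_functional \<alpha> \<beta> (parisian_ruin_cont k) (\<lambda>t. v + X t \<omega>) (\<lambda>i. T i \<omega>)"
  let ?e = "\<lambda>p :: real \<times> real. ennreal (exp (- \<alpha> * snd p))"
  let ?w = "\<lambda>p :: real \<times> real. ennreal (exp (- \<alpha> * snd p + \<beta> * fst p))"
  let ?pay = "walk_payoff \<alpha> \<beta> r"
  let ?G = "\<lambda>n \<omega>. ?pay (v + fst (part 0 \<omega>)) (?\<xi> \<omega>) n * ?e (part 0 \<omega>) * ?w (part (Suc (2 * n)) \<omega>)"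
  let ?g = "\<lambda>n p \<xi>. ?pay (v + fst p) \<xi> n * ?e p"
  let ?E = "expectation_from M X T v (ruin_functional \<alpha> \<beta> (parisian_ruin_cont k))"
  have [measurable]: "?e \<in> borel_measurable B2" "?w \<in> borel_measurable B2" by measurable
  have pm: "(\<lambda>\<omega>. ?pay (v + x \<omega> + fst (part 0 \<omega>)) (?\<xi> \<omega>) n * ?e (part 0 \<omega>) * ?w (part (Suc (2 * n)) \<omega>)) \<in> borel_measurable M"
    if [measurable]: "x \<in> borel_measurable M" for n x
    by (intro borel_measurable_times_ennreal measurable_walk_payoff measurable_plus_B2' part_rv) measurable
  have m: "(\<lambda>\<omega>. ennreal (?F \<omega>)) \<in> borel_measurable M"
  proof (subst measurable_cong)
    show "ennreal (?F \<omega>) = (\<Sum>n. ?pay (v + X 0 \<omega> + fst (part 0 \<omega>)) (?\<xi> \<omega>) n * ?e (part 0 \<omega>) * ?w (part (Suc (2 * n)) \<omega>))"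
      if "\<omega> \<in> space M" for \<omega> unfolding r_def by (rule cont_functional_eq(1)[OF that k])
    show "(\<lambda>\<omega>. \<Sum>n. ?pay (v + X 0 \<omega> + fst (part 0 \<omega>)) (?\<xi> \<omega>) n * ?e (part 0 \<omega>) * ?w (part (Suc (2 * n)) \<omega>)) \<in> borel_measurable M"
      by (rule borel_measurable_suminf_order) (rule pm[OF X0_measurable])
  qed
  have F1: "?F \<omega> \<le> 1" if "\<omega> \<in> space M" for \<omega> by (rule cont_functional_eq(2)[OF that k assms(1,2)])
  have E: "ennreal (?E) = (\<integral>\<^sup>+\<omega>. ennreal (?F \<omega>) \<partial>M)"
    "0 \<le> ?E"
    by (rule expectation_from_eq[OF m ruin_functional_nonneg], rule F1, assumption)+
  show "0 \<le> ?E" by (rule E(2))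
  have one: "(\<integral>\<^sup>+\<omega>. ?G n \<omega> \<partial>M) =
    (\<integral>\<^sup>+p. \<integral>\<^sup>+\<xi>. ?g n p \<xi> \<partial>Q \<partial>\<mu>) * rest_factor \<alpha> \<beta>" for n
  proof -
    define a where "a j = Suc (Suc (2 * j))" for j :: nat
    \<comment> \<open>skips the index of the remainder of segment \<open>n\<close>; from step \<open>n\<close> on each supremum is grouped with its own remainder\<close>
    define b where "b j = (if j < n then Suc (2 * j) else Suc (Suc (Suc (2 * j))))" for j
    have "?pay (v + fst (part 0 \<omega>)) (?\<xi> \<omega>) n =
        ?pay (v + fst (part 0 \<omega>)) (\<lambda>j. part (a j) \<omega> + part (b j) \<omega>) n" for \<omega>
      by (rule walk_payoff_cong) (simp add: a_def b_def)
    then have "(\<integral>\<^sup>+\<omega>. ?G n \<omega> \<partial>M) =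
      (\<integral>\<^sup>+\<omega>. (?pay (v + fst (part 0 \<omega>)) (\<lambda>j. part (a j) \<omega> + part (b j) \<omega>) n * ?e (part 0 \<omega>)) * ?w (part (Suc (2 * n)) \<omega>) \<partial>M)"
      by simp
    also have "\<dots> = (\<integral>\<^sup>+\<omega>. ?pay (v + fst (part 0 \<omega>)) (\<lambda>j. part (a j) \<omega> + part (b j) \<omega>) n * ?e (part 0 \<omega>) \<partial>M) *
      (\<integral>\<^sup>+\<omega>. ?w (part (Suc (2 * n)) \<omega>) \<partial>M)"
    proof (rule nn_integral_indep_split[OF part_indep, where d="(0, 0)" and ?J1.0="- {Suc (2 * n)}" and ?J2.0="{Suc (2 * n)}"
          and ?G1.0="\<lambda>y. ?pay (v + fst (y 0)) (\<lambda>j. y (a j) + y (b j)) n * ?e (y 0)" and ?G2.0="\<lambda>y. ?w (y (Suc (2 * n)))"])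
      have c: "(\<lambda>y. y i) \<in> (\<Pi>\<^sub>M i\<in>(UNIV::nat set). B2) \<rightarrow>\<^sub>M B2" for i by (rule measurable_component_singleton) simp
      show "(\<lambda>y. ?pay (v + fst (y 0)) (\<lambda>j. y (a j) + y (b j)) n * ?e (y 0)) \<in> borel_measurable (\<Pi>\<^sub>M i\<in>UNIV. B2)"
        by (intro borel_measurable_times_ennreal measurable_walk_payoff borel_measurable_add borel_measurable_const
            measurable_compose[OF c measurable_fst] measurable_plus_B2' c measurable_compose[OF c \<open>?e \<in> borel_measurable B2\<close>])
      show "(\<lambda>y. ?w (y (Suc (2 * n)))) \<in> borel_measurable (\<Pi>\<^sub>M i\<in>UNIV. B2)"
        by (rule measurable_compose[OF c \<open>?w \<in> borel_measurable B2\<close>])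
      fix y y' :: "nat \<Rightarrow> real \<times> real" assume y: "\<And>i. i \<in> - {Suc (2 * n)} \<Longrightarrow> y i = y' i"
      have "a j \<noteq> Suc (2 * n)" for j unfolding a_def by presburger
      moreover have "b j \<noteq> Suc (2 * n)" for j
      proof (cases "j < n")
        case False
        then have "b j = Suc (Suc (Suc (2 * j)))" by (simp add: b_def)
        with False show ?thesis by presburger
      qed (simp add: b_def)
      ultimately have "(\<lambda>j. y (a j) + y (b j)) = (\<lambda>j. y' (a j) + y' (b j))" using y by simp
      then show "?pay (v + fst (y 0)) (\<lambda>j. y (a j) + y (b j)) n * ?e (y 0) =
        ?pay (v + fst (y' 0)) (\<lambda>j. y' (a j) + y' (b j)) n * ?e (y' 0)"
        using y[of 0] by simp
    qed (auto simp: space_pair_measure)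
    also have "(\<integral>\<^sup>+\<omega>. ?w (part (Suc (2 * n)) \<omega>) \<partial>M) = rest_factor \<alpha> \<beta>"
      unfolding rest_factor_def part_law_cases(2)[of "Suc (2 * n)", simplified, symmetric] by (subst nn_integral_distr) auto
    also have "(\<integral>\<^sup>+\<omega>. ?pay (v + fst (part 0 \<omega>)) (\<lambda>j. part (a j) \<omega> + part (b j) \<omega>) n * ?e (part 0 \<omega>) \<partial>M) =
      (\<integral>\<^sup>+p. \<integral>\<^sup>+\<xi>. ?g n p \<xi> \<partial>Q \<partial>\<mu>)"
    proof -
      have c: "(\<lambda>y. snd y i) \<in> B2 \<Otimes>\<^sub>M (\<Pi>\<^sub>M i\<in>(UNIV::nat set). B2) \<rightarrow>\<^sub>M B2" for i
        by (rule measurable_compose[OF measurable_snd]) (rule measurable_component_singleton, simp)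
      have "disjoint_family (\<lambda>j. {a j, b j})"
        unfolding disjoint_family_on_def a_def b_def by (auto split: if_splits; presburger)
      moreover have "(\<lambda>(p, \<xi>). ?g n p \<xi>) \<in> borel_measurable (B2 \<Otimes>\<^sub>M (\<Pi>\<^sub>M j\<in>UNIV. B2))"
        unfolding case_prod_beta'
        by (intro borel_measurable_times_ennreal measurable_walk_payoff c borel_measurable_add borel_measurable_const
            measurable_compose[OF measurable_fst measurable_fst] measurable_compose[OF measurable_fst \<open>?e \<in> borel_measurable B2\<close>])
      ultimately show ?thesis
        using nn_integral_blocks_after_zero[of a b "\<lambda>(p, \<xi>). ?g n p \<xi>"]
        by (simp add: a_def b_def)
    qed
    finally show ?thesis .
  qed
  have q: "(\<lambda>(p, \<xi>). ?g n p \<xi>) \<in> borel_measurable (\<mu> \<Otimes>\<^sub>M Q)" for n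
  proof (subst measurable_cong_sets[OF sets_pair_measure_cong[OF sets_laws(1) refl] refl])
    show "(\<lambda>(p, \<xi>). ?g n p \<xi>) \<in> borel_measurable (B2 \<Otimes>\<^sub>M Q)"
      unfolding case_prod_beta'
      by (intro borel_measurable_times_ennreal measurable_walk_payoff measurable_compose[OF measurable_snd Q_component] borel_measurable_add borel_measurable_const
          measurable_compose[OF measurable_fst measurable_fst] measurable_compose[OF measurable_fst \<open>?e \<in> borel_measurable B2\<close>])
  qed
  have payoff_Q: "(\<lambda>\<xi>. walk_payoff \<alpha> \<beta> r u \<xi> n) \<in> borel_measurable Q" for u n
    by (intro measurable_walk_payoff borel_measurable_const Q_component)
  have "AE \<omega> in M. ennreal (?F \<omega>) =
    (\<Sum>n. ?G n \<omega>)"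
    using start_zero AE_space by eventually_elim (simp add: cont_functional_eq(1)[OF _ k] r_def)
  then have "(\<integral>\<^sup>+\<omega>. ennreal (?F \<omega>) \<partial>M) =
    (\<integral>\<^sup>+\<omega>. (\<Sum>n. ?G n \<omega>) \<partial>M)"
    by (rule nn_integral_cong_AE)
  also have "\<dots> = (\<Sum>n. \<integral>\<^sup>+\<omega>. ?G n \<omega> \<partial>M)"
    using pm[of "\<lambda>_. 0"] by (intro nn_integral_suminf) simp
  also have "\<dots> = (\<Sum>n. \<integral>\<^sup>+p. \<integral>\<^sup>+\<xi>. ?g n p \<xi> \<partial>Q \<partial>\<mu>) * rest_factor \<alpha> \<beta>"
    unfolding one by (rule ennreal_suminf_multc)
  also have "(\<Sum>n. \<integral>\<^sup>+p. \<integral>\<^sup>+\<xi>. ?g n p \<xi> \<partial>Q \<partial>\<mu>) =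
    (\<integral>\<^sup>+p. (\<Sum>n. \<integral>\<^sup>+\<xi>. ?g n p \<xi> \<partial>Q) \<partial>\<mu>)"
    by (rule nn_integral_suminf[symmetric]) (use S.P.borel_measurable_nn_integral_fst[OF q] in simp)
  also have "\<dots> = (\<integral>\<^sup>+p. ?e p * obs_value \<alpha> \<beta> r (v + fst p) \<partial>\<mu>)"
    unfolding obs_value_def nn_integral_suminf[OF payoff_Q] nn_integral_multc[OF payoff_Q] ennreal_suminf_multc
    by (simp only: mult.commute)
  finally show "ennreal (?E) =
      (\<integral>\<^sup>+p. ennreal (exp (- \<alpha> * snd p)) * obs_value \<alpha> \<beta> (k - 2) (v + fst p) \<partial>\<mu>) * rest_factor \<alpha> \<beta>"
    unfolding E(1) r_def[symmetric] .
qed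

text \<open>A step from a nonnegative level \<open>u\<close> can be put in front of the walk without changing the time of ruin and the
  position at ruin, because \<open>u\<close> does not belong to a run of negative values.\<close>

lemma obs_value_first_step:
  assumes u: "0 \<le> u"
  shows "(\<integral>\<^sup>+p. ennreal (exp (- \<alpha> * snd p)) * obs_value \<alpha> \<beta> r (u + fst p) \<partial>\<rho>) = obs_value \<alpha> \<beta> r u"
proof -
  interpret R: prob_space \<rho> by (rule prob_spaces)
  interpret S: sequence_space \<rho> ..
  have payoff_Q: "(\<lambda>\<xi>. walk_payoff \<alpha> \<beta> r u \<xi> n) \<in> borel_measurable Q" for u n
    by (intro measurable_walk_payoff borel_measurable_const Q_component)
  have suminf_Q: "(\<lambda>\<xi>. \<Sum>n. walk_payoff \<alpha> \<beta> r u \<xi> n) \<in> borel_measurable Q" for u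
    by (rule borel_measurable_suminf_order[OF payoff_Q])
  have cn: "(\<lambda>(p, \<xi>). case_nat p \<xi>) \<in> \<rho> \<Otimes>\<^sub>M Q \<rightarrow>\<^sub>M Q" by measurable
  have head: "(\<Sum>n. walk_payoff \<alpha> \<beta> r u \<xi> n) = (\<Sum>n. walk_payoff \<alpha> \<beta> r u \<xi> (Suc n))" for \<xi>
    using walk_payoff_start_nonneg(1)[OF u] by (subst suminf_offset[of _ 1]) simp_all
  have "obs_value \<alpha> \<beta> r u = (\<integral>\<^sup>+\<xi>. (\<Sum>n. walk_payoff \<alpha> \<beta> r u \<xi> n) \<partial>distr (\<rho> \<Otimes>\<^sub>M Q) Q (\<lambda>(p, \<xi>). case_nat p \<xi>))"
    unfolding obs_value_def S.PiM_iter ..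
  also have "\<dots> = (\<integral>\<^sup>+z. (\<Sum>n. walk_payoff \<alpha> \<beta> r u (case z of (p, \<xi>) \<Rightarrow> case_nat p \<xi>) n) \<partial>(\<rho> \<Otimes>\<^sub>M Q))"
    using suminf_Q by (subst nn_integral_distr[OF cn]) simp_all
  also have "\<dots> = (\<integral>\<^sup>+p. \<integral>\<^sup>+\<xi>. (\<Sum>n. walk_payoff \<alpha> \<beta> r u (case_nat p \<xi>) n) \<partial>Q \<partial>\<rho>)"
    by (subst S.P.nn_integral_fst[symmetric]) (use measurable_compose[OF cn suminf_Q] in \<open>simp_all add: case_prod_beta'\<close>)
  also have "\<dots> = (\<integral>\<^sup>+p. \<integral>\<^sup>+\<xi>. ennreal (exp (- \<alpha> * snd p)) * (\<Sum>n. walk_payoff \<alpha> \<beta> r (u + fst p) \<xi> n) \<partial>Q \<partial>\<rho>)"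
    unfolding head walk_payoff_start_nonneg(2)[OF u] ennreal_suminf_cmult ..
  also have "\<dots> = (\<integral>\<^sup>+p. ennreal (exp (- \<alpha> * snd p)) * obs_value \<alpha> \<beta> r (u + fst p) \<partial>\<rho>)"
    unfolding obs_value_def nn_integral_cmult[OF suminf_Q] ..
  finally show ?thesis ..
qed

lemma nn_integral_\<rho>:
  assumes [measurable]: "f \<in> borel_measurable B2"
  shows "(\<integral>\<^sup>+p. f p \<partial>\<rho>) = (\<integral>\<^sup>+p'. \<integral>\<^sup>+p. f (p' + p) \<partial>\<mu> \<partial>\<nu>)"
proof -
  interpret m: prob_space \<mu> by (rule prob_spaces)
  interpret n: prob_space \<nu> by (rule prob_spaces)
  interpret mn: pair_sigma_finite \<mu> \<nu> ..
  have pm: "(\<lambda>(p, p'). p + p') \<in> \<mu> \<Otimes>\<^sub>M \<nu> \<rightarrow>\<^sub>M B2"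
    by (subst measurable_cong_sets[OF sets_pair_measure_cong[OF sets_laws(1,2)] refl]) (rule measurable_plus_B2)
  have fm: "(\<lambda>(p, p'). f (p + p')) \<in> borel_measurable (\<mu> \<Otimes>\<^sub>M \<nu>)"
    using measurable_compose[OF pm assms] by (simp add: case_prod_beta')
  have "(\<integral>\<^sup>+p. f p \<partial>\<rho>) = (\<integral>\<^sup>+(p, p'). f (p + p') \<partial>(\<mu> \<Otimes>\<^sub>M \<nu>))"
    unfolding \<rho>_def using assms by (subst nn_integral_distr[OF pm]) (simp_all add: case_prod_beta')
  also have "\<dots> = (\<integral>\<^sup>+p'. \<integral>\<^sup>+p. f (p + p') \<partial>\<mu> \<partial>\<nu>)"
    by (subst mn.nn_integral_snd[symmetric, OF fm]) simp
  finally show ?thesis by (simp only: add.commute)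
qed

lemma integral_law_eq:
  fixes f :: "real \<times> real \<Rightarrow> real"
  assumes L: "sets L = sets B2" and f: "f \<in> borel_measurable B2" "\<And>p. 0 \<le> f p"
  shows "(\<integral>p. f p \<partial>L) = enn2real (\<integral>\<^sup>+p. ennreal (f p) \<partial>L)"
  using f by (intro integral_eq_nn_integral AE_I2) (simp_all cong: measurable_cong_sets add: measurable_cong_sets[OF L refl])

end

theorem proposition5:
  fixes M :: "'a measure" and X :: "real \<Rightarrow> 'a \<Rightarrow> real"
    and rate :: real and T :: "nat \<Rightarrow> 'a \<Rightarrow> real"
    and k :: nat and u \<alpha> \<beta> :: real
  assumes "levy_poisson M X rate T"
    and "2 \<le> k" and "0 \<le> u" and "0 \<le> \<alpha>" and "0 \<le> \<beta>"
  shows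
    "expectation_from M X T u (ruin_functional \<alpha> \<beta> (parisian_ruin_cont k)) =
       (\<integral>(y, t). exp (- \<alpha> * t) *
            expectation_from M X T (u + y) (ruin_functional \<alpha> \<beta> (parisian_ruin_obs (k - 2)))
          \<partial>sup_law M X T) *
       (\<integral>(y, t). exp (- \<alpha> * t + \<beta> * y) \<partial>inf_law M X T)
     \<and>
     expectation_from M X T u (ruin_functional \<alpha> \<beta> (parisian_ruin_obs (k - 2))) *
       (\<integral>(y, t). exp (- \<alpha> * t + \<beta> * y) \<partial>inf_law M X T) =
       (\<integral>(y, t). exp (- \<alpha> * t) *
            expectation_from M X T (u + y) (ruin_functional \<alpha> \<beta> (parisian_ruin_cont k))
          \<partial>inf_law M X T)"
proof -
  interpret levy_poisson M X rate T by fact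
  let ?O = "\<lambda>v. expectation_from M X T v (ruin_functional \<alpha> \<beta> (parisian_ruin_obs (k - 2)))"
  let ?C = "\<lambda>v. expectation_from M X T v (ruin_functional \<alpha> \<beta> (parisian_ruin_cont k))"
  note O = expectation_obs[OF assms(4,5), where r="k - 2"]
  note C = expectation_cont[OF assms(4,5,2)]
  have O_eq: "?O v = enn2real (obs_value \<alpha> \<beta> (k - 2) v)" for v
    using O(2)[of v] unfolding O(1)[symmetric] by simp
  have O_meas [measurable]: "?O \<in> borel_measurable borel" unfolding O_eq by measurable
  define h where "h v = (\<integral>\<^sup>+p. ennreal (exp (- \<alpha> * snd p)) * obs_value \<alpha> \<beta> (k - 2) (v + fst p) \<partial>\<mu>)" for v
  have h_meas [measurable]: "h \<in> borel_measurable borel"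
  proof -
    interpret m: prob_space \<mu> by (rule prob_spaces)
    have "(\<lambda>(v, p). ennreal (exp (- \<alpha> * snd p)) * obs_value \<alpha> \<beta> (k - 2) (v + fst p)) \<in> borel_measurable (borel \<Otimes>\<^sub>M B2)"
      by measurable
    then have "(\<lambda>(v, p). ennreal (exp (- \<alpha> * snd p)) * obs_value \<alpha> \<beta> (k - 2) (v + fst p)) \<in> borel_measurable (borel \<Otimes>\<^sub>M \<mu>)"
      by (subst measurable_cong_sets[OF sets_pair_measure_cong[OF refl sets_laws(1)] refl])
    from m.borel_measurable_nn_integral[OF this] show ?thesis unfolding h_def[abs_def] .
  qed
  have C_eq: "?C v = enn2real (h v * rest_factor \<alpha> \<beta>)" for v
    using C(2)[of v] unfolding h_def C(1)[symmetric] by simp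
  have C_meas [measurable]: "?C \<in> borel_measurable borel" unfolding C_eq by measurable
  have rest: "(\<integral>(y, t). exp (- \<alpha> * t + \<beta> * y) \<partial>\<nu>) = enn2real (rest_factor \<alpha> \<beta>)"
    unfolding case_prod_beta' rest_factor_def by (rule integral_law_eq[OF sets_laws(2)]) measurable
  have sup: "(\<integral>(y, t). exp (- \<alpha> * t) * ?O (u + y) \<partial>\<mu>) = enn2real (h u)"
    unfolding case_prod_beta' h_def O(1)[symmetric]
    by (subst integral_law_eq[OF sets_laws(1)]) (measurable, simp_all add: O(2) ennreal_mult)
  have inf: "(\<integral>(y, t). exp (- \<alpha> * t) * ?C (u + y) \<partial>\<nu>) =
      enn2real (\<integral>\<^sup>+p. ennreal (exp (- \<alpha> * snd p)) * (h (u + fst p) * rest_factor \<alpha> \<beta>) \<partial>\<nu>)"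
    unfolding case_prod_beta' h_def C(1)[symmetric]
    by (subst integral_law_eq[OF sets_laws(2)]) (measurable, simp_all add: C(2) ennreal_mult)
  \<comment> \<open>the shift by \<open>D\<close> and the first supremum merge into one step of the observed walk\<close>
  have "(\<integral>\<^sup>+p. ennreal (exp (- \<alpha> * snd p)) * (h (u + fst p) * rest_factor \<alpha> \<beta>) \<partial>\<nu>) =
    (\<integral>\<^sup>+p. ennreal (exp (- \<alpha> * snd p)) * h (u + fst p) \<partial>\<nu>) * rest_factor \<alpha> \<beta>"
    by (subst nn_integral_multc[symmetric]) (simp_all cong: measurable_cong_sets add: mult.assoc)
  also have "(\<integral>\<^sup>+p. ennreal (exp (- \<alpha> * snd p)) * h (u + fst p) \<partial>\<nu>) =
    (\<integral>\<^sup>+p'. \<integral>\<^sup>+p. ennreal (exp (- \<alpha> * snd (p' + p))) * obs_value \<alpha> \<beta> (k - 2) (u + fst (p' + p)) \<partial>\<mu> \<partial>\<nu>)"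
  proof (rule nn_integral_cong)
    fix p' :: "real \<times> real"
    have "ennreal (exp (- \<alpha> * snd p')) * h (u + fst p') =
      (\<integral>\<^sup>+p. ennreal (exp (- \<alpha> * snd p')) * (ennreal (exp (- \<alpha> * snd p)) * obs_value \<alpha> \<beta> (k - 2) (u + fst p' + fst p)) \<partial>\<mu>)"
      unfolding h_def by (subst nn_integral_cmult) (simp_all cong: measurable_cong_sets)
    also have "\<dots> = (\<integral>\<^sup>+p. ennreal (exp (- \<alpha> * snd (p' + p))) * obs_value \<alpha> \<beta> (k - 2) (u + fst (p' + p)) \<partial>\<mu>)"
      by (intro nn_integral_cong) (simp add: mult.assoc[symmetric] ennreal_mult[symmetric] exp_add[symmetric] algebra_simps)
    finally show "ennreal (exp (- \<alpha> * snd p')) * h (u + fst p') =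
      (\<integral>\<^sup>+p. ennreal (exp (- \<alpha> * snd (p' + p))) * obs_value \<alpha> \<beta> (k - 2) (u + fst (p' + p)) \<partial>\<mu>)" .
  qed
  also have "\<dots> = (\<integral>\<^sup>+p. ennreal (exp (- \<alpha> * snd p)) * obs_value \<alpha> \<beta> (k - 2) (u + fst p) \<partial>\<rho>)"
    by (rule nn_integral_\<rho>[symmetric]) measurable
  also have "\<dots> = obs_value \<alpha> \<beta> (k - 2) u" by (rule obs_value_first_step[OF assms(3)])
  finally have inf': "(\<integral>\<^sup>+p. ennreal (exp (- \<alpha> * snd p)) * (h (u + fst p) * rest_factor \<alpha> \<beta>) \<partial>\<nu>) =
    obs_value \<alpha> \<beta> (k - 2) u * rest_factor \<alpha> \<beta>" .
  show ?thesis
    unfolding sup rest inf inf' C_eq[of u] O_eq[of u] enn2real_mult by simp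
qed

end
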